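(* Let $X$ be a Euclidean building of type $A_2$ with projective plane at infinity $\mathbb P$, and let $(F_1,F_2,F_3)$, $F_i=(p_i,D_i)$, be a generic triple of flags of $\mathbb P$, with associated flats $A_{ij},A_p,A_D$ and points $y_k,y_k^*$ as defined in the context. Let $(i,j,k)$ be a cyclic permutation of $(1,2,3)$ and identify $A_{ij}$ with $\mathbb A$ by a marked flat sending $\mathfrak C$ to $F_j$. Let $x\in A_{ij}$. Then: (i) The intersection $A_{ij}\cap A_p$ is the sector at $y_k$ bounded by the rays to $p_i$ and $p_j$. That is, $x\in A_p$ if and only if $$\varphi_1(x)\ge\varphi_1(y_k)\ \text{ and }\ \varphi_2(x)\le\varphi_2(y_k).$$ (ii) The intersection $A_{ij}\cap A_D$ is the sector at $y_k^*$ bounded by the rays to $D_i$ and $D_j$. That is, $x\in A_D$ if and only if $$\varphi_1(x)\le\varphi_1(y_k^* )\ \text{ and }\ \varphi_2(x)\ge\varphi_2(y_k^* ).$$ (iii) The intersection $A_{ij}\cap A_{jk}$ is the intersection of the sector at $y_k$ bounded by the rays to $p_j$ and $D_i\cap D_j$, and the sector at $y_k^*$ bounded by the rays to $D_j$ and $p_ip_j$. That is, $x\in A_{jk}$ if and only if $$\varphi_1(x)\ge\varphi_1(y_k^* ),\quad \varphi_2(x)\ge\varphi_2(y_k),\quad \varphi_3(x)\le\min(\varphi_3(y_k),\varphi_3(y_k^* )).$$ (iv) The intersection $A_{ij}\cap A_{ki}$ is the intersection of the sector at $y_k$ bounded by the rays to $p_i$ and $D_i\cap D_j$, and the sector at $y_k^*$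 bounded by the rays to $D_i$ and $p_ip_j$. That is, $x\in A_{ki}$ if and only if $$\varphi_1(x)\le\varphi_1(y_k),\quad \varphi_2(x)\le\varphi_2(y_k^* ),\quad \varphi_3(x)\ge\max(\varphi_3(y_k),\varphi_3(y_k^* )).$$
   Context: **Model flat.** $\mathbb A=\{\lambda\in\mathbb R^3:\lambda_1+\lambda_2+\lambda_3=0\}$, identified with $\mathbb R^3/\mathbb R(1,1,1)$; $[\lambda]$ is the class of $\lambda\in\mathbb R^3$, and $\varepsilon_1,\varepsilon_2,\varepsilon_3$ is the canonical basis of $\mathbb R^3$. $W=\mathfrak S_3$ acts by permuting coordinates, preserving a Euclidean metric; $W_{aff}$ is the group of all affine isomorphisms of $\mathbb A$ with linear part in $W$. $\mathfrak C=\{\lambda\in\mathbb A:\lambda_1>\lambda_2>\lambda_3\}$. Roots: $\varphi_1(\lambda)=\lambda_1-\lambda_2$, $\varphi_2(\lambda)=\lambda_2-\lambda_3$, $\varphi_3(\lambda)=\lambda_3-\lambda_1$. **Euclidean building of type $A_2$.** A CAT(0) metric space $X$ with a maximal collection of isometric embeddings $f:\mathbb A\to X$ (marked flats) such that: (A1) the collection is invariant under precomposition by $W_{aff}$; (A2) for marked flats $f,f'$, the transition map $f^{-1}\circ f'$ is the restriction of an element of $W_{aff}$; (A3') any two rays of $X$ are initially contained in a common marked flat. Flats and Weyl chambers are the images of $\mathbb A$ and $\mathfrak C$ under marked flats. **Infinity.** The CAT(0) boundary $\partial_\infty X$ is a spherical building whose chambers (ideal chambers) and apartments are the boundaries of Weyl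 chambers and of flats. It is the incidence graph of a projective plane $\mathbb P$: points of $\mathbb P$ are the ideal points of rays of type $[\varepsilon_1]$ (images under marked flats of rays of direction in $W[\varepsilon_1]$), lines are the ideal points of rays of type $[\varepsilon_1+\varepsilon_2]$, and $p\in D$ iff $p,D$ are the vertices of a common ideal chamber. Ideal chambers are thus flags $(p,D)$. Flags $(p,D),(p',D')$ are opposite iff $p\notin D'$ and $p'\notin D$; then a unique flat $A(F,F')$ contains both in its boundary. Three noncollinear points (resp. nonconcurrent lines) lie in the boundary of a unique flat. A marked flat $f$ sends $\mathfrak C$ to $F$ if the ideal chamber of $f(\mathfrak C)$ is $F$. In a flat identified with $\mathbb A$ by $f$, $\varphi_m(x)$ means $\varphi_m(f^{-1}(x))$. The sector at $y$ bounded by two rays from $y$ in a flat is the closed convex cone of that flat with apex $y$ generated by these rays. **Triples, flats and points.** A triple of flags $F_i=(p_i,D_i)$ is generic if the flags are pairwise opposite, the $p_i$ are not collinear and the $D_i$ not concurrent. $A_{ij}=A(F_i,F_j)$, $A_p$ is the flat with $p_1,p_2,p_3$ in its boundary and $A_D$ the flat with $D_1,D_2,D_3$ in its boundary. For $\{i,j,k\}=\{1,2,3\}$, let $p_{ij}=D_i\cap D_j$ and $D_{ij}=p_ip_j$. The point $y_k$ is the center of the projective frame $(p_1,p_2,p_3,p_{ij})$, i.e. the unique point common to the four flats determined by three of these four points; equivalently, it is the unique point $y\in A_{ij}$ which is an orthogonal projection of $p_k$ on $A_{ij}$ (the Alexandrov angle at $y$ between $[y,p_k)$ and $[y,w]$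 is $\ge\pi/2$ for all $w\in A_{ij}\setminus\{y\}$). Dually, $y_k^*$ is the center of $(D_1,D_2,D_3,D_{ij})$, i.e. the unique point common to the four flats determined by three of these four lines; equivalently, the orthogonal projection of $D_k$ on $A_{ij}$. *)

theory Defs
  imports "HOL-Analysis.Analysis"
begin

section \<open>CAT(0) spaces and their boundary at infinity\<close>

definition geodesic_between :: "'a::metric_space \<Rightarrow> 'a \<Rightarrow> (real \<Rightarrow> 'a) \<Rightarrow> bool" where
  "geodesic_between x y c \<longleftrightarrow>
     c 0 = x \<and> c 1 = y \<and> (\<forall>s\<in>{0..1}. \<forall>t\<in>{0..1}. dist (c s) (c t) = \<bar>s - t\<bar> * dist x y)"

text \<open>Comparison inequality for geodesic triangles. Any two sides of a triangle have a common
  vertex, so it is enough to compare points on two sides issued from the vertex \<open>x\<close>;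
  the primed points span a comparison triangle in the Euclidean plane.\<close>

definition cat0_space :: "'a::metric_space itself \<Rightarrow> bool" where
  "cat0_space _ \<longleftrightarrow>
     (\<forall>x y::'a. \<exists>c. geodesic_between x y c) \<and>
     (\<forall>(x::'a) y z c c' (x'::real^2) y' z'.
        geodesic_between x y c \<and> geodesic_between x z c' \<and>
        dist x' y' = dist x y \<and> dist x' z' = dist x z \<and> dist y' z' = dist y z \<longrightarrow>
        (\<forall>s\<in>{0..1}. \<forall>t\<in>{0..1}.
           dist (c s) (c' t) \<le> dist (x' + s *\<^sub>R (y' - x')) (x' + t *\<^sub>R (z' - x'))))"

text \<open>A ray is parametrised by arc length on \<open>{0..}\<close>; its values at negative times are
  irrelevant.\<close>

definition geodesic_ray :: "(real \<Rightarrow> 'a::metric_space) \<Rightarrow> bool" where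
  "geodesic_ray r \<longleftrightarrow> (\<forall>s\<ge>0. \<forall>t\<ge>0. dist (r s) (r t) = \<bar>s - t\<bar>)"

definition asymptotic :: "((real \<Rightarrow> 'a::metric_space) \<times> (real \<Rightarrow> 'a)) set" where
  "asymptotic = {(r, r'). geodesic_ray r \<and> geodesic_ray r' \<and>
                    (\<exists>C. \<forall>t\<ge>0. dist (r t) (r' t) \<le> C)}"

type_synonym 'a ideal_point = "(real \<Rightarrow> 'a) set"

definition endpoint :: "(real \<Rightarrow> 'a::metric_space) \<Rightarrow> 'a ideal_point" where
  "endpoint r = asymptotic `` {r}"

definition ideal_boundary :: "'a::metric_space set \<Rightarrow> 'a ideal_point set" where
  "ideal_boundary S = {endpoint r | r. geodesic_ray r \<and> r ` {0..} \<subseteq> S}"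


section \<open>The model flat\<close>

definition model_flat :: "(real^3) set" where
  "model_flat = {l. l$1 + l$2 + l$3 = 0}"

text \<open>The class \<open>[l]\<close> of \<open>l\<close> modulo \<open>(1,1,1)\<close>, as its representative in \<open>model_flat\<close>.\<close>

definition cls :: "real^3 \<Rightarrow> real^3" where
  "cls l = (\<chi> i. l$i - (l$1 + l$2 + l$3) / 3)"

definition \<epsilon> :: "3 \<Rightarrow> real^3" where
  "\<epsilon> i = axis i 1"

definition Weyl_group :: "(real^3 \<Rightarrow> real^3) set" where
  "Weyl_group = {(\<lambda>l. \<chi> i. l $ \<sigma> i) | \<sigma>. \<sigma> permutes (UNIV::3 set)}"

text \<open>All translations are allowed, so the building need not be discrete.\<close>

definition affine_Weyl_group :: "(real^3 \<Rightarrow> real^3) set" where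
  "affine_Weyl_group = {(\<lambda>l. w l + b) | w b. w \<in> Weyl_group \<and> b \<in> model_flat}"

definition model_chamber :: "(real^3) set" where
  "model_chamber = {l \<in> model_flat. l$1 > l$2 \<and> l$2 > l$3}"

text \<open>In the index type \<open>3\<close> one has \<open>3 + 1 = 1\<close>, so the third form is \<open>l$3 - l$1\<close>.\<close>

definition root_form :: "3 \<Rightarrow> real^3 \<Rightarrow> real" where
  "root_form m l = l $ m - l $ (m + 1)"

lemma root_form_simps:
  "root_form 1 l = l$1 - l$2" "root_form 2 l = l$2 - l$3" "root_form 3 l = l$3 - l$1"
proof -
  have "(3::3) = 0" by simp
  then have "(3::3) + 1 = 1" by (simp only: add_0)
  then show "root_form 3 l = l$3 - l$1" by (simp only: root_form_def)
qed (simp_all add: root_form_def)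


section \<open>Euclidean buildings of type A2\<close>

text \<open>Extensionality fixes the irrelevant values outside \<open>model_flat\<close>. The metric of the model
  flat is the one induced by the standard Euclidean metric of \<open>real^3\<close>.\<close>

definition isometric_embeddings :: "(real^3 \<Rightarrow> 'a::metric_space) set" where
  "isometric_embeddings =
     {f \<in> extensional model_flat. \<forall>a\<in>model_flat. \<forall>b\<in>model_flat. dist (f a) (f b) = dist a b}"

definition flat_system :: "(real^3 \<Rightarrow> 'a::metric_space) set \<Rightarrow> bool" where
  "flat_system \<F> \<longleftrightarrow>
     \<F> \<subseteq> isometric_embeddings \<and>
     (\<forall>f\<in>\<F>. \<forall>w\<in>affine_Weyl_group. restrict (f \<circ> w) model_flat \<in> \<F>) \<and>
     (\<forall>f\<in>\<F>. \<forall>f'\<in>\<F>. \<exists>w\<in>affine_Weyl_group. \<forall>b\<in>model_flat.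
        f' b \<in> f ` model_flat \<longrightarrow> inv_into model_flat f (f' b) = w b) \<and>
     (\<forall>r r'. geodesic_ray r \<and> geodesic_ray r' \<longrightarrow>
        (\<exists>f\<in>\<F>. \<exists>e>0. r ` {0..e} \<subseteq> f ` model_flat \<and> r' ` {0..e} \<subseteq> f ` model_flat))"

definition euclidean_building_A2 :: "(real^3 \<Rightarrow> 'a::metric_space) set \<Rightarrow> bool" where
  "euclidean_building_A2 \<F> \<longleftrightarrow>
     cat0_space TYPE('a) \<and> flat_system \<F> \<and>
     (\<forall>\<F>'. flat_system \<F>' \<and> \<F> \<subseteq> \<F>' \<longrightarrow> \<F>' = \<F>)"

definition flats :: "(real^3 \<Rightarrow> 'a) set \<Rightarrow> 'a set set" where
  "flats \<F> = (\<lambda>f. f ` model_flat) ` \<F>"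


section \<open>The projective plane at infinity\<close>

text \<open>The image under \<open>f\<close> of the unit speed ray from \<open>a\<close> in the direction of \<open>v \<noteq> 0\<close>.\<close>

definition flat_ray :: "(real^3 \<Rightarrow> 'a) \<Rightarrow> real^3 \<Rightarrow> real^3 \<Rightarrow> real \<Rightarrow> 'a" where
  "flat_ray f a v t = f (a + (t / norm v) *\<^sub>R v)"

definition ideal_points_of_type ::
    "(real^3 \<Rightarrow> 'a::metric_space) set \<Rightarrow> real^3 \<Rightarrow> 'a ideal_point set" where
  "ideal_points_of_type \<F> v =
     {endpoint (flat_ray f a (w v)) | f a w. f \<in> \<F> \<and> a \<in> model_flat \<and> w \<in> Weyl_group}"

definition proj_points :: "(real^3 \<Rightarrow> 'a::metric_space) set \<Rightarrow> 'a ideal_point set" where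
  "proj_points \<F> = ideal_points_of_type \<F> (cls (\<epsilon> 1))"

definition proj_lines :: "(real^3 \<Rightarrow> 'a::metric_space) set \<Rightarrow> 'a ideal_point set" where
  "proj_lines \<F> = ideal_points_of_type \<F> (cls (\<epsilon> 1 + \<epsilon> 2))"

text \<open>An ideal chamber is identified with the flag \<open>(p, D)\<close> of its two vertices.\<close>

definition sends_chamber_to ::
    "(real^3 \<Rightarrow> 'a::metric_space) set \<Rightarrow> (real^3 \<Rightarrow> 'a) \<Rightarrow> 'a ideal_point \<times> 'a ideal_point \<Rightarrow> bool" where
  "sends_chamber_to \<F> f = (\<lambda>(p, D). f \<in> \<F> \<and> p \<in> proj_points \<F> \<and> D \<in> proj_lines \<F> \<and>
     {p, D} \<subseteq> ideal_boundary (f ` model_chamber))"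

definition incident ::
    "(real^3 \<Rightarrow> 'a::metric_space) set \<Rightarrow> 'a ideal_point \<Rightarrow> 'a ideal_point \<Rightarrow> bool" where
  "incident \<F> p D \<longleftrightarrow> (\<exists>f. sends_chamber_to \<F> f (p, D))"

definition opposite_flags ::
    "(real^3 \<Rightarrow> 'a::metric_space) set \<Rightarrow> 'a ideal_point \<times> 'a ideal_point
      \<Rightarrow> 'a ideal_point \<times> 'a ideal_point \<Rightarrow> bool" where
  "opposite_flags \<F> = (\<lambda>(p, D) (p', D'). \<not> incident \<F> p D' \<and> \<not> incident \<F> p' D)"

definition generic_triple ::
    "(real^3 \<Rightarrow> 'a::metric_space) set \<Rightarrow> (3 \<Rightarrow> 'a ideal_point) \<Rightarrow> (3 \<Rightarrow> 'a ideal_point) \<Rightarrow> bool" where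
  "generic_triple \<F> p D \<longleftrightarrow>
     (\<forall>i. incident \<F> (p i) (D i)) \<and>
     (\<forall>i j. i \<noteq> j \<longrightarrow> opposite_flags \<F> (p i, D i) (p j, D j)) \<and>
     \<not> (\<exists>L. \<forall>i. incident \<F> (p i) L) \<and>
     \<not> (\<exists>q. \<forall>i. incident \<F> q (D i))"


section \<open>Flats, frames and sectors\<close>

text \<open>\<open>A\<close> is a flat with the given ideal points in its boundary. A flat contains an ideal
  chamber in its boundary iff it contains both vertices of the chamber.\<close>

definition flat_through ::
    "(real^3 \<Rightarrow> 'a::metric_space) set \<Rightarrow> 'a ideal_point set \<Rightarrow> 'a set \<Rightarrow> bool" where
  "flat_through \<F> S A \<longleftrightarrow> A \<in> flats \<F> \<and> S \<subseteq> ideal_boundary A"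

text \<open>\<open>y\<close> is common to the four flats determined by three of \<open>a, b, c, d\<close>; used both for four
  points and for four lines in general position.\<close>

definition frame_center ::
    "(real^3 \<Rightarrow> 'a::metric_space) set \<Rightarrow> 'a ideal_point \<Rightarrow> 'a ideal_point
      \<Rightarrow> 'a ideal_point \<Rightarrow> 'a ideal_point \<Rightarrow> 'a \<Rightarrow> bool" where
  "frame_center \<F> a b c d y \<longleftrightarrow>
     (\<forall>S \<in> {{a, b, c}, {a, b, d}, {a, c, d}, {b, c, d}}. \<exists>A. flat_through \<F> S A \<and> y \<in> A)"

text \<open>The closed convex cone of the flat \<open>A\<close> with apex \<open>y\<close> generated by the rays from \<open>y\<close>
  to \<open>\<xi>\<close> and \<open>\<eta>\<close>, computed in any marking of \<open>A\<close>.\<close>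

definition sector ::
    "(real^3 \<Rightarrow> 'a::metric_space) set \<Rightarrow> 'a set \<Rightarrow> 'a \<Rightarrow> 'a ideal_point \<Rightarrow> 'a ideal_point \<Rightarrow> 'a set" where
  "sector \<F> A y \<xi> \<eta> =
     {f (a + s *\<^sub>R u + t *\<^sub>R v) | f a u v s t.
        f \<in> \<F> \<and> f ` model_flat = A \<and> a \<in> model_flat \<and> f a = y \<and>
        u \<in> model_flat - {0} \<and> endpoint (flat_ray f a u) = \<xi> \<and>
        v \<in> model_flat - {0} \<and> endpoint (flat_ray f a v) = \<eta> \<and>
        s \<ge> 0 \<and> t \<ge> 0}"

definition \<phi> :: "(real^3 \<Rightarrow> 'a) \<Rightarrow> 3 \<Rightarrow> 'a \<Rightarrow> real" where
  "\<phi> f m x = root_form m (inv_into model_flat f x)"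

end

(*
For an ideal point xi let b(xi) be its Busemann function. On a flat with ideal vertices q1, q2, q3 of
one type (all points or all lines), b(q1) + b(q2) + b(q3) is constant, while b(p) + b(D) is minimal
on any flat with opposite vertices p and D in its boundary; a flat determined by two opposite flags
(p, D), (p', D') is exactly the set where b(p) + b(D') and b(p') + b(D) are both minimal, because a
point with these properties would project orthogonally to the flat in a direction orthogonal to
vectors of two different types, which the Weyl group does not allow.

The flat A_ij is the union of three sectors at y_k, each bounded by two of the rays to p_i, p_j,
p_ij. By convexity each of them lies in the flat through the two corresponding points and p_k, so
b(p_k) = max (b(p_i), b(p_j), b(p_ij)) on A_ij, all functions being normalised at y_k. This gives
A_ij Int A_p; together with the dual formula for b(D_k) and the description of A_jk and A_ki as
sets of minima it gives the other intersections.
*)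
theory Submission
  imports Defs
begin

section \<open>CAT(0) inequalities\<close>

text \<open>The axioms speak only of flats and of germs of rays, while the theorem is about
  infinity. So the incidence facts of the projective plane (two lines share only one point, ideal
  points have a type) and the uniqueness of flats have to be derived from the metric. Two mechanisms
  do this. Convexity: a convex function of sublinear growth on a half-line is bounded by its initial
  value, and one that is sublinear at both ends is constant; this turns limits at infinity into
  exact statements. Rigidity: two germs lie in a common flat, where directions are compared up to
  the finite group \<open>Weyl_group\<close>, so approximate information on directions becomes
  exact. Horofunctions are scaled so that on a flat they are coordinates up to sign. Points belong
  to the directions \<open>vtx m\<close>, lines to \<open>- vtx m\<close>, and vertices of equal
  index are opposite. Duality is then the change of a sign \<sigma>, and the sectors at a frame
  center are the regions where one given coordinate, multiplied by \<sigma>, is minimal.\<close>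

lemma comparison_triangle_exists:
  fixes x y z :: "'a::metric_space"
  shows "\<exists>x' y' z' :: real^2. dist x' y' = dist x y \<and> dist x' z' = dist x z \<and> dist y' z' = dist y z"
proof -
  define A B C where "A = dist x y" and "B = dist x z" and "C = dist y z"
  have pos: "0 \<le> A" "0 \<le> B" "0 \<le> C" by (simp_all add: A_def B_def C_def)
  have tri: "C \<le> A + B" "A \<le> B + C" "B \<le> A + C"
    using dist_triangle[of y z x] dist_triangle[of x y z] dist_triangle[of x z y]
    by (simp_all add: A_def B_def C_def dist_commute)
  have norm2: "norm v = sqrt ((v$1)\<^sup>2 + (v$2)\<^sup>2)" for v :: "real^2"
    by (simp add: norm_vec_def L2_set_def sum_2)
  show ?thesis
  proof (cases "A = 0")
    case True
    then have "B = C" using tri by linarith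
    with True pos have "dist (0::real^2) 0 = A \<and> dist 0 (vector [B, 0] :: real^2) = B
        \<and> dist 0 (vector [B, 0] :: real^2) = C"
      by (simp add: dist_norm norm2)
    then show ?thesis unfolding A_def B_def C_def by blast
  next
    case False
    with pos have A: "A > 0" by simp
    \<comment> \<open>Law of cosines: with \<open>x'\<close> at the origin and \<open>y'\<close> on
      the first axis, \<open>p\<close> is the first coordinate of \<open>z'\<close>. The triangle
      inequalities place \<open>p\<close> between \<open>- B\<close> and \<open>B\<close>, so the
      second coordinate is a real square root.\<close>
    define p where "p = (A\<^sup>2 + B\<^sup>2 - C\<^sup>2) / (2 * A)"
    have Ap: "2 * A * p = A\<^sup>2 + B\<^sup>2 - C\<^sup>2" using A by (simp add: p_def)
    have "(A - B)\<^sup>2 \<le> C\<^sup>2"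
      using tri by (intro abs_le_square_iff[THEN iffD1]) auto
    then have "2 * A * p \<le> 2 * A * B" unfolding Ap by (simp add: power2_diff)
    then have "p \<le> B" using A by simp
    moreover have "C\<^sup>2 \<le> (A + B)\<^sup>2" using tri pos by (intro power_mono) auto
    then have "2 * A * (- B) \<le> 2 * A * p" unfolding Ap by (simp add: power2_sum)
    then have "- B \<le> p" using A by (subst (asm) mult_le_cancel_left_pos) auto
    ultimately have "p\<^sup>2 \<le> B\<^sup>2" by (intro abs_le_square_iff[THEN iffD1]) auto
    then have q: "(sqrt (B\<^sup>2 - p\<^sup>2))\<^sup>2 = B\<^sup>2 - p\<^sup>2" by simp
    have "(A - p)\<^sup>2 + (B\<^sup>2 - p\<^sup>2) = C\<^sup>2"
      using Ap by (simp add: power2_eq_square algebra_simps)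
    then have "dist (0::real^2) (vector [A, 0]) = A
        \<and> dist (0::real^2) (vector [p, sqrt (B\<^sup>2 - p\<^sup>2)]) = B
        \<and> dist (vector [A, 0] :: real^2) (vector [p, sqrt (B\<^sup>2 - p\<^sup>2)]) = C"
      using pos q by (simp add: dist_norm norm2)
    then show ?thesis unfolding A_def B_def C_def by blast
  qed
qed

lemma geodesic_between_reverse:
  "geodesic_between x y c \<Longrightarrow> geodesic_between y x (\<lambda>t. c (1 - t))"
  unfolding geodesic_between_def by (auto simp: dist_commute)

text \<open>The Euclidean equality whose CAT(0) form is \<open>cn_inequality\<close>.\<close>

lemma stewart:
  fixes x y z :: "'a::real_inner"
  shows "(norm (y + t *\<^sub>R (z - y) - x))\<^sup>2
    = (1 - t) * (norm (x - y))\<^sup>2 + t * (norm (x - z))\<^sup>2 - t * (1 - t) * (norm (y - z))\<^sup>2"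
  unfolding power2_norm_eq_inner
  by (simp add: inner_commute algebra_simps)

section \<open>Rays of constant speed and their Busemann functions\<close>

definition speed_ray :: "real \<Rightarrow> (real \<Rightarrow> 'a::metric_space) \<Rightarrow> bool" where
  "speed_ray k R \<longleftrightarrow> 0 \<le> k \<and> (\<forall>s\<ge>0. \<forall>t\<ge>0. dist (R s) (R t) = k * \<bar>s - t\<bar>)"

text \<open>Working with squared distances gives \<open>k\<close> times the usual Busemann cocycle of a ray of speed
  \<open>k\<close>, and lets the CN inequality pass to the limit directly.\<close>

definition busemann :: "(real \<Rightarrow> 'a::metric_space) \<Rightarrow> 'a \<Rightarrow> 'a \<Rightarrow> real" where
  "busemann R x y = Lim at_top (\<lambda>T. ((dist x (R T))\<^sup>2 - (dist y (R T))\<^sup>2) / (2 * T))"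

lemma speed_ray_segment:
  assumes "speed_ray k R" "0 \<le> T"
  shows "geodesic_between (R 0) (R T) (\<lambda>s. R (s * T))"
  unfolding geodesic_between_def
proof (intro conjI ballI)
  fix s t :: real assume "s \<in> {0..1}" "t \<in> {0..1}"
  with assms show "dist (R (s * T)) (R (t * T)) = \<bar>s - t\<bar> * dist (R 0) (R T)"
    by (simp add: speed_ray_def left_diff_distrib[symmetric] abs_mult)
qed simp_all

lemma tendsto_const_over: "((\<lambda>T::real. c / (2 * T)) \<longlongrightarrow> 0) at_top"
proof -
  have "filterlim (\<lambda>T::real. 2 * T) at_top at_top"
    by (rule filterlim_tendsto_pos_mult_at_top[OF tendsto_const _ filterlim_ident]) simp
  then have "filterlim (\<lambda>T::real. 2 * T) at_infinity at_top"
    by (rule filterlim_at_top_imp_at_infinity)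
  with tendsto_const show ?thesis by (rule tendsto_divide_0)
qed

lemma busemann_eqI:
  assumes "((\<lambda>T. ((dist x (R T))\<^sup>2 - (dist y (R T))\<^sup>2) / (2 * T)) \<longlongrightarrow> b) at_top"
  shows "busemann R x y = b"
  unfolding busemann_def by (rule tendsto_Lim[OF trivial_limit_at_top_linorder assms])

text \<open>The function \<open>h x\<close> is nonincreasing and bounded below, so it converges.
  Substituting \<open>dist x (R T) = h x T + k * T\<close> splits the quotient into a term of order
  1/T and \<open>k * (h x T - h y T)\<close>.\<close>

lemma tendsto_busemann:
  assumes R: "speed_ray k R"
  shows "((\<lambda>T. ((dist x (R T))\<^sup>2 - (dist y (R T))\<^sup>2) / (2 * T)) \<longlongrightarrow> busemann R x y) at_top"
proof -
  define h where "h x T = dist x (R T) - k * T" for x T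
  have anti: "h x T \<le> h x S" if "0 \<le> S" "S \<le> T" for x S T
  proof -
    have "dist (R S) (R T) = k * (T - S)" using R that by (simp add: speed_ray_def)
    then show ?thesis using dist_triangle[of x "R T" "R S"] by (simp add: h_def algebra_simps)
  qed
  have bdd: "- dist x (R 0) \<le> h x T" if "0 \<le> T" for x T
  proof -
    have "dist (R 0) (R T) = k * T" using R that by (simp add: speed_ray_def)
    then show ?thesis using dist_triangle[of "R 0" "R T" x] by (simp add: h_def dist_commute)
  qed
  have "\<exists>L. (h x \<longlongrightarrow> L) at_top" for x
  proof
    let ?L = "Inf (h x ` {0..})"
    have B: "bdd_below (h x ` {0..})" using bdd[of _ x] by (auto simp: bdd_below_def)
    show "(h x \<longlongrightarrow> ?L) at_top"
    proof (rule order_tendstoI)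
      fix a assume "a < ?L"
      moreover have "?L \<le> h x T" if "0 \<le> T" for T using B that by (intro cINF_lower) auto
      ultimately show "eventually (\<lambda>T. a < h x T) at_top"
        by (intro eventually_at_top_linorderI[of 0]) force
    next
      fix a assume "?L < a"
      then obtain S where "0 \<le> S" "h x S < a" using B by (auto simp: cINF_less_iff)
      then show "eventually (\<lambda>T. h x T < a) at_top"
        using anti[of S _ x] by (intro eventually_at_top_linorderI[of S]) force
    qed
  qed
  then obtain L where L: "\<And>x. (h x \<longlongrightarrow> L x) at_top" by metis
  have "((\<lambda>T. ((h x T)\<^sup>2 - (h y T)\<^sup>2) * (1 / (2 * T)) + k * (h x T - h y T))
      \<longlongrightarrow> ((L x)\<^sup>2 - (L y)\<^sup>2) * 0 + k * (L x - L y)) at_top"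
    by (rule tendsto_add[OF tendsto_mult[OF tendsto_diff[OF tendsto_power[OF L] tendsto_power[OF L]]
        tendsto_const_over] tendsto_mult[OF tendsto_const tendsto_diff[OF L L]]])
  moreover have "eventually (\<lambda>T. ((h x T)\<^sup>2 - (h y T)\<^sup>2) * (1 / (2 * T)) + k * (h x T - h y T)
      = ((dist x (R T))\<^sup>2 - (dist y (R T))\<^sup>2) / (2 * T)) at_top"
    using eventually_gt_at_top[of 0]
    by eventually_elim (simp add: h_def field_simps power2_eq_square)
  ultimately have "((\<lambda>T. ((dist x (R T))\<^sup>2 - (dist y (R T))\<^sup>2) / (2 * T))
      \<longlongrightarrow> ((L x)\<^sup>2 - (L y)\<^sup>2) * 0 + k * (L x - L y)) at_top"
    by (rule Lim_transform_eventually)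
  from busemann_eqI[OF this] this show ?thesis by (rule ssubst)
qed

lemma busemann_trans:
  assumes R: "speed_ray k R"
  shows "busemann R x z = busemann R x y + busemann R y z"
proof (rule busemann_eqI)
  show "((\<lambda>T. ((dist x (R T))\<^sup>2 - (dist z (R T))\<^sup>2) / (2 * T))
      \<longlongrightarrow> busemann R x y + busemann R y z) at_top"
    using tendsto_add[OF tendsto_busemann[OF R, of x y] tendsto_busemann[OF R, of y z]]
    by (simp add: diff_divide_distrib)
qed

locale cat0 =
  fixes X :: "'a::metric_space itself"
  assumes cat0: "cat0_space X"
begin

lemma geodesic_exists: "\<exists>c. geodesic_between (x::'a) y c"
  using cat0 by (simp add: cat0_space_def)

lemma cat0_comparison:
  fixes x y z :: 'a and x' y' z' :: "real^2"
  assumes "geodesic_between x y c" "geodesic_between x z c'"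
    "dist x' y' = dist x y" "dist x' z' = dist x z" "dist y' z' = dist y z"
    "0 \<le> s" "s \<le> 1" "0 \<le> t" "t \<le> 1"
  shows "dist (c s) (c' t) \<le> dist (x' + s *\<^sub>R (y' - x')) (x' + t *\<^sub>R (z' - x'))"
proof -
  have "\<forall>(x::'a) y z c c' (x'::real^2) y' z'.
        geodesic_between x y c \<and> geodesic_between x z c' \<and>
        dist x' y' = dist x y \<and> dist x' z' = dist x z \<and> dist y' z' = dist y z \<longrightarrow>
        (\<forall>s\<in>{0..1}. \<forall>t\<in>{0..1}.
           dist (c s) (c' t) \<le> dist (x' + s *\<^sub>R (y' - x')) (x' + t *\<^sub>R (z' - x')))"
    using cat0 unfolding cat0_space_def by (rule conjunct2)
  from this[rule_format, of x y c z c' x' y' z' s t] assms show ?thesis by simp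
qed

text \<open>The Bruhat-Tits inequality. The comparison axiom needs both points on sides from one
  vertex; the choice of \<open>y\<close> as that vertex makes \<open>x\<close> the end
  \<open>c' 1\<close> of the second side.\<close>

lemma cn_inequality:
  fixes x y z :: 'a
  assumes c: "geodesic_between y z c" and t: "0 \<le> t" "t \<le> 1"
  shows "(dist x (c t))\<^sup>2 \<le> (1 - t) * (dist x y)\<^sup>2 + t * (dist x z)\<^sup>2 - t * (1 - t) * (dist y z)\<^sup>2"
proof -
  obtain x' y' z' :: "real^2"
    where tri: "dist x' y' = dist x y" "dist x' z' = dist x z" "dist y' z' = dist y z"
    using comparison_triangle_exists[of x y z] by blast
  obtain c' where c': "geodesic_between y x c'" using geodesic_exists by blast
  then have [simp]: "c' 1 = x" by (simp add: geodesic_between_def)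
  have "dist x (c t) = dist (c t) (c' 1)" by (simp add: dist_commute)
  also have "\<dots> \<le> dist (y' + t *\<^sub>R (z' - y')) (y' + 1 *\<^sub>R (x' - y'))"
    using tri t by (intro cat0_comparison[OF c c']) (simp_all add: dist_commute)
  also have "\<dots> = norm (y' + t *\<^sub>R (z' - y') - x')" by (simp add: dist_norm)
  finally have "(dist x (c t))\<^sup>2 \<le> (norm (y' + t *\<^sub>R (z' - y') - x'))\<^sup>2"
    by (intro power_mono) auto
  also have "\<dots> = (1 - t) * (dist x y)\<^sup>2 + t * (dist x z)\<^sup>2 - t * (1 - t) * (dist y z)\<^sup>2"
    unfolding stewart using tri by (simp add: dist_norm)
  finally show ?thesis .
qed

lemma hinge_contraction:
  fixes x y z :: 'a
  assumes "geodesic_between x y c" "geodesic_between x z c'" "0 \<le> s" "s \<le> 1"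
  shows "dist (c s) (c' s) \<le> s * dist y z"
proof -
  obtain x' y' z' :: "real^2"
    where tri: "dist x' y' = dist x y" "dist x' z' = dist x z" "dist y' z' = dist y z"
    using comparison_triangle_exists[of x y z] by blast
  have "dist (c s) (c' s) \<le> dist (x' + s *\<^sub>R (y' - x')) (x' + s *\<^sub>R (z' - x'))"
    using assms tri by (intro cat0_comparison[of x y c z c'])
  also have "\<dots> = norm (s *\<^sub>R (y' - z'))" by (simp add: dist_norm scaleR_diff_right)
  also have "\<dots> = s * dist y z" using tri assms by (simp add: dist_norm)
  finally show ?thesis .
qed

lemma geodesic_unique:
  fixes x y :: 'a
  assumes "geodesic_between x y c" "geodesic_between x y c'" "0 \<le> s" "s \<le> 1"
  shows "c s = c' s"
  using hinge_contraction[OF assms] by simp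

lemma dist_convex:
  fixes x y x' y' :: 'a
  assumes c: "geodesic_between x y c" and c': "geodesic_between x' y' c'" and s: "0 \<le> s" "s \<le> 1"
  shows "dist (c s) (c' s) \<le> (1 - s) * dist x x' + s * dist y y'"
proof -
  \<comment> \<open>The diagonal \<open>d\<close> cuts the quadrilateral into hinges at
    \<open>x\<close> and at \<open>y'\<close>.\<close>
  obtain d where d: "geodesic_between x y' d" using geodesic_exists by blast
  have "dist (c s) (d s) \<le> s * dist y y'" using hinge_contraction[OF c d s] .
  moreover have "dist (d s) (c' s) \<le> (1 - s) * dist x x'"
    using hinge_contraction[OF geodesic_between_reverse[OF d] geodesic_between_reverse[OF c'], of "1 - s"] s
    by simp
  ultimately show ?thesis using dist_triangle[of "c s" "c' s" "d s"] by linarith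
qed

lemma rays_convex:
  fixes R R' :: "real \<Rightarrow> 'a"
  assumes "speed_ray k R" "speed_ray k' R'" "0 \<le> t" "t \<le> T" "0 < T"
  shows "dist (R t) (R' t) \<le> (1 - t / T) * dist (R 0) (R' 0) + t / T * dist (R T) (R' T)"
  using dist_convex[OF speed_ray_segment[OF assms(1), of T] speed_ray_segment[OF assms(2), of T], of "t / T"]
    assms by simp

text \<open>By convexity the distance at \<open>t\<close> is at most the interpolation between its
  values at 0 and \<open>T\<close>, and the contribution of \<open>T\<close> is
  \<open>t * (dist (R T) (R' T) / T)\<close>, which tends to 0.\<close>

lemma sublinear_rays_bounded:
  fixes R R' :: "real \<Rightarrow> 'a"
  assumes R: "speed_ray k R" "speed_ray k' R'"
    and lim: "((\<lambda>T. dist (R T) (R' T) / T) \<longlongrightarrow> 0) at_top" and t: "0 \<le> t"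
  shows "dist (R t) (R' t) \<le> dist (R 0) (R' 0)"
proof (rule tendsto_lowerbound)
  show "((\<lambda>T. (1 - t * inverse T) * dist (R 0) (R' 0) + t * (dist (R T) (R' T) / T))
      \<longlongrightarrow> dist (R 0) (R' 0)) at_top"
    by (rule tendsto_eq_intros lim tendsto_inverse_0_at_top filterlim_ident refl | simp)+
  show "eventually (\<lambda>T. dist (R t) (R' t)
      \<le> (1 - t * inverse T) * dist (R 0) (R' 0) + t * (dist (R T) (R' T) / T)) at_top"
    using eventually_gt_at_top[of t]
    by eventually_elim (use rays_convex[OF R] t in \<open>simp add: divide_inverse algebra_simps\<close>)
qed simp

lemma asymptotic_same_origin:
  fixes R R' :: "real \<Rightarrow> 'a"
  assumes R: "speed_ray k R" "speed_ray k' R'" and "R 0 = R' 0"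
    and C: "\<And>t. 0 \<le> t \<Longrightarrow> dist (R t) (R' t) \<le> C" and t: "0 \<le> t"
  shows "R t = R' t"
proof -
  have "((\<lambda>T. dist (R T) (R' T) / T) \<longlongrightarrow> 0) at_top"
  proof (rule tendsto_sandwich[OF _ _ tendsto_const])
    show "((\<lambda>T. (2 * C) / (2 * T)) \<longlongrightarrow> 0) at_top" by (rule tendsto_const_over)
    show "eventually (\<lambda>T. 0 \<le> dist (R T) (R' T) / T) at_top"
      using eventually_gt_at_top[of 0] by eventually_elim simp
    show "eventually (\<lambda>T. dist (R T) (R' T) / T \<le> (2 * C) / (2 * T)) at_top"
      using eventually_gt_at_top[of 0] by eventually_elim (simp add: C divide_right_mono)
  qed
  from sublinear_rays_bounded[OF R this t] assms show ?thesis by simp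
qed

text \<open>Two applications of \<open>cn_inequality\<close> to the midpoint of the diagonal from
  \<open>a\<close> to \<open>c\<close>, combined with the triangle inequality for the other
  diagonal. It is the comparison of squared distances behind
  \<open>busemann_asymptotic\<close>.\<close>

lemma quadrilateral_inequality:
  fixes a b c d :: 'a
  shows "(dist a c)\<^sup>2 + (dist b d)\<^sup>2
    \<le> (dist a b)\<^sup>2 + (dist b c)\<^sup>2 + (dist c d)\<^sup>2 + (dist d a)\<^sup>2"
proof -
  obtain g where g: "geodesic_between a c g" using geodesic_exists by blast
  let ?m = "g (1/2)"
  have "(dist b ?m)\<^sup>2 \<le> (dist a b)\<^sup>2 / 2 + (dist b c)\<^sup>2 / 2 - (dist a c)\<^sup>2 / 4"
    using cn_inequality[OF g, of "1/2" b] by (simp add: field_simps dist_commute)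
  moreover have "(dist d ?m)\<^sup>2 \<le> (dist d a)\<^sup>2 / 2 + (dist c d)\<^sup>2 / 2 - (dist a c)\<^sup>2 / 4"
    using cn_inequality[OF g, of "1/2" d] by (simp add: field_simps dist_commute)
  moreover have "(dist b d)\<^sup>2 \<le> (dist b ?m + dist d ?m)\<^sup>2"
    by (intro power_mono dist_triangle2) auto
  moreover have "(dist b ?m + dist d ?m)\<^sup>2 \<le> 2 * (dist b ?m)\<^sup>2 + 2 * (dist d ?m)\<^sup>2"
    using zero_le_power2[of "dist b ?m - dist d ?m"] by (simp add: power2_eq_square algebra_simps)
  ultimately show ?thesis by linarith
qed

lemma busemann_asymptotic:
  fixes R R' :: "real \<Rightarrow> 'a"
  assumes R: "speed_ray k R" "speed_ray k' R'"
    and C: "\<And>t. 0 \<le> t \<Longrightarrow> dist (R t) (R' t) \<le> C"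
  shows "busemann R x y = busemann R' x y"
proof (rule antisym)
  have le: "busemann R x y \<le> busemann R' x y"
    if R: "speed_ray k R" "speed_ray k' R'"
      and C: "\<And>t. 0 \<le> t \<Longrightarrow> dist (R t) (R' t) \<le> C" for R R' :: "real \<Rightarrow> 'a" and k k'
  proof (rule tendsto_le)
    show "((\<lambda>T. ((dist x (R T))\<^sup>2 - (dist y (R T))\<^sup>2) / (2 * T)) \<longlongrightarrow> busemann R x y) at_top"
      by (rule tendsto_busemann[OF R(1)])
    show "((\<lambda>T. ((dist x (R' T))\<^sup>2 - (dist y (R' T))\<^sup>2) / (2 * T)
        + ((dist x y)\<^sup>2 + C\<^sup>2) / (2 * T)) \<longlongrightarrow> busemann R' x y) at_top"
      using tendsto_add[OF tendsto_busemann[OF R(2)] tendsto_const_over] by simp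
    show "eventually (\<lambda>T. ((dist x (R T))\<^sup>2 - (dist y (R T))\<^sup>2) / (2 * T)
      \<le> ((dist x (R' T))\<^sup>2 - (dist y (R' T))\<^sup>2) / (2 * T) + ((dist x y)\<^sup>2 + C\<^sup>2) / (2 * T)) at_top"
      using eventually_gt_at_top[of 0]
    proof eventually_elim
      case (elim T)
      have "(dist (R T) (R' T))\<^sup>2 \<le> C\<^sup>2" using C[of T] elim by (intro power_mono) auto
      \<comment> \<open>The quadrilateral is \<open>x\<close>, \<open>y\<close>, \<open>R T\<close>,
        \<open>R' T\<close> in this cyclic order: the diagonals join \<open>x\<close> to
        \<open>R T\<close> and \<open>y\<close> to \<open>R' T\<close>, and two opposite sides are
        bounded independently of \<open>T\<close>.\<close>
      then have "(dist x (R T))\<^sup>2 - (dist y (R T))\<^sup>2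
          \<le> (dist x (R' T))\<^sup>2 - (dist y (R' T))\<^sup>2 + ((dist x y)\<^sup>2 + C\<^sup>2)"
        using quadrilateral_inequality[of x "R T" y "R' T"] by (simp add: dist_commute)
      then show ?case using elim by (simp add: add_divide_distrib[symmetric] divide_right_mono)
    qed
  qed simp
  show "busemann R x y \<le> busemann R' x y" using le[OF R C] .
  show "busemann R' x y \<le> busemann R x y" using le[OF R(2,1)] C by (simp add: dist_commute)
qed

end


section \<open>The model flat and its Weyl group\<close>

lemma model_flat_closed [simp]:
  "0 \<in> model_flat"
  "a \<in> model_flat \<Longrightarrow> b \<in> model_flat \<Longrightarrow> a + b \<in> model_flat"
  "a \<in> model_flat \<Longrightarrow> b \<in> model_flat \<Longrightarrow> a - b \<in> model_flat"
  "a \<in> model_flat \<Longrightarrow> - a \<in> model_flat"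
  "a \<in> model_flat \<Longrightarrow> c *\<^sub>R a \<in> model_flat"
  by (simp_all add: model_flat_def flip: distrib_left)

lemma Weyl_group_properties:
  assumes "w \<in> Weyl_group"
  shows Weyl_linear: "linear w" and Weyl_norm: "norm (w x) = norm x"
    and Weyl_model_flat: "x \<in> model_flat \<Longrightarrow> w x \<in> model_flat"
proof -
  obtain \<sigma> where \<sigma>: "\<sigma> permutes (UNIV::3 set)" and w: "w = (\<lambda>l. \<chi> i. l $ \<sigma> i)"
    using assms by (auto simp: Weyl_group_def)
  show "linear w" unfolding w by (rule linearI) (simp_all add: vec_eq_iff)
  have "(\<Sum>i\<in>UNIV. (x $ \<sigma> i)\<^sup>2) = (\<Sum>i\<in>UNIV. (x $ i)\<^sup>2)"
    using sum.permute[OF \<sigma>, of "\<lambda>i. (x $ i)\<^sup>2"] by (simp add: comp_def)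
  then show "norm (w x) = norm x" by (simp add: w norm_vec_def L2_set_def)
  have "(\<Sum>i\<in>UNIV. x $ \<sigma> i) = (\<Sum>i\<in>UNIV. x $ i)"
    using sum.permute[OF \<sigma>, of "\<lambda>i. x $ i"] by (simp add: comp_def)
  then show "w x \<in> model_flat" if "x \<in> model_flat"
    using that by (simp add: w model_flat_def sum_3)
qed

lemma Weyl_compose:
  assumes "w \<in> Weyl_group" "w' \<in> Weyl_group"
  shows "(\<lambda>x. w (w' x)) \<in> Weyl_group"
proof -
  obtain \<sigma> \<tau> where s: "\<sigma> permutes (UNIV::3 set)" "w = (\<lambda>l. \<chi> i. l $ \<sigma> i)"
    and t: "\<tau> permutes (UNIV::3 set)" "w' = (\<lambda>l. \<chi> i. l $ \<tau> i)"
    using assms by (auto simp: Weyl_group_def)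
  have "(\<lambda>x. w (w' x)) = (\<lambda>l. \<chi> i. l $ (\<tau> \<circ> \<sigma>) i)" by (simp add: s t)
  then show ?thesis using permutes_compose[OF s(1) t(1)] unfolding Weyl_group_def by blast
qed

lemma Weyl_inverse:
  assumes "w \<in> Weyl_group"
  obtains w' where "w' \<in> Weyl_group" "\<And>x. w (w' x) = x" "\<And>x. w' (w x) = x"
proof -
  obtain \<sigma> where s: "\<sigma> permutes (UNIV::3 set)" "w = (\<lambda>l. \<chi> i. l $ \<sigma> i)"
    using assms by (auto simp: Weyl_group_def)
  show ?thesis
  proof
    show "(\<lambda>l. \<chi> i. l $ inv \<sigma> i) \<in> Weyl_group"
      using permutes_inv[OF s(1)] unfolding Weyl_group_def by blast
  qed (simp_all add: s(2) vec_eq_iff permutes_inverses[OF s(1)])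
qed

lemma finite_Weyl_group: "finite Weyl_group"
proof -
  have "Weyl_group = (\<lambda>\<sigma> l. \<chi> i. l $ \<sigma> i) ` {\<sigma>. \<sigma> permutes (UNIV::3 set)}"
    by (auto simp: Weyl_group_def)
  then show ?thesis using finite_imageI[OF finite_permutations[OF finite[of "UNIV::3 set"]]] by (rule ssubst)
qed

lemma id_Weyl_group: "(\<lambda>x. x) \<in> Weyl_group"
proof -
  have "(\<lambda>x. x) = (\<lambda>l::real^3. \<chi> i. l $ id i)" by (simp add: vec_eq_iff fun_eq_iff)
  then show ?thesis unfolding Weyl_group_def using permutes_id by blast
qed

text \<open>The directions of the three points of the projective plane in the boundary of a flat.
  They sum to zero, so \<open>- vtx m\<close> is the direction of a line: the one through the other
  two points, opposite to the \<open>m\<close>-th point.\<close>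

definition vtx :: "3 \<Rightarrow> real^3" where
  "vtx m = cls (\<epsilon> m)"

lemma vtx_nth: "vtx m $ i = (if i = m then 2/3 else -1/3)"
  using exhaust_3[of m] by (auto simp: vtx_def cls_def \<epsilon>_def axis_def)

lemma vtx_model_flat [simp]: "vtx m \<in> model_flat"
  using exhaust_3[of m] by (auto simp: model_flat_def vtx_nth)

text \<open>The vector \<open>vtx m\<close> differs from \<open>\<epsilon> m\<close> by a multiple
  of (1,1,1), which is orthogonal to \<open>model_flat\<close>.\<close>

lemma inner_vtx:
  assumes "l \<in> model_flat"
  shows "l \<bullet> vtx m = l $ m"
proof -
  have "l $ 3 = - l $ 1 - l $ 2" using assms by (simp add: model_flat_def)
  then show ?thesis
    using exhaust_3[of m] by (auto simp: inner_vec_def sum_3 vtx_nth field_simps)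
qed

lemma norm_vtx: "norm (vtx m) = sqrt (2/3)"
proof -
  have "vtx m \<bullet> vtx m = 2/3" by (simp add: inner_vtx) (simp add: vtx_nth)
  then show ?thesis by (simp add: norm_eq_sqrt_inner)
qed

lemma vtx_nonzero [simp]: "vtx m \<noteq> 0"
  using norm_vtx[of m] by auto

lemma Weyl_vtx:
  assumes "w \<in> Weyl_group"
  obtains \<pi> where "inj \<pi>" "\<And>m. w (vtx m) = vtx (\<pi> m)"
proof -
  obtain \<sigma> where s: "\<sigma> permutes (UNIV::3 set)" "w = (\<lambda>l. \<chi> i. l $ \<sigma> i)"
    using assms by (auto simp: Weyl_group_def)
  show ?thesis
  proof
    show "inj (inv \<sigma>)" using permutes_inj[OF permutes_inv[OF s(1)]] .
    show "w (vtx m) = vtx (inv \<sigma> m)" for m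
      using permutes_inverses[OF s(1)] by (auto simp: s(2) vec_eq_iff vtx_nth)
  qed
qed

lemma Weyl_vtx_exists:
  assumes "inj (\<pi> :: 3 \<Rightarrow> 3)"
  obtains w where "w \<in> Weyl_group" "\<And>m. w (vtx m) = vtx (\<pi> m)"
proof
  have b: "bij \<pi>" using assms by (simp add: bij_def finite_UNIV_inj_surj)
  then have p: "\<pi> permutes UNIV" by (simp add: permutes_univ bij_iff)
  show "(\<lambda>l. \<chi> i. l $ inv \<pi> i) \<in> Weyl_group"
    using permutes_inv[OF p] unfolding Weyl_group_def by blast
  show "(\<chi> i. vtx m $ inv \<pi> i) = vtx (\<pi> m)" for m
    using permutes_inverses[OF p] by (auto simp: vec_eq_iff vtx_nth)
qed

text \<open>Not normalised to unit speed, unlike \<open>flat_ray\<close>: directions can then be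
  added, scaled and set to zero.\<close>

definition flat_line :: "(real^3 \<Rightarrow> 'a) \<Rightarrow> real^3 \<Rightarrow> real^3 \<Rightarrow> real \<Rightarrow> 'a" where
  "flat_line f a v t = f (a + t *\<^sub>R v)"

text \<open>A convex function whose asymptotic slopes at both ends are zero cannot vary. The
  quotients by \<open>2 * T\<close> have the form in which Busemann limits are given.\<close>

lemma convex_sublinear_const:
  fixes E :: "real \<Rightarrow> real"
  assumes conv: "\<And>\<theta> s t. 0 \<le> \<theta> \<Longrightarrow> \<theta> \<le> 1 \<Longrightarrow> E ((1 - \<theta>) * s + \<theta> * t) \<le> (1 - \<theta>) * E s + \<theta> * E t"
    and lim: "((\<lambda>T. E T / (2 * T)) \<longlongrightarrow> 0) at_top" "((\<lambda>T. E (- T) / (2 * T)) \<longlongrightarrow> 0) at_top"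
    and \<sigma>: "0 < \<sigma>"
  shows "E \<sigma> = E 0"
proof (rule antisym)
  show "E \<sigma> \<le> E 0"
  proof (rule tendsto_lowerbound)
    show "((\<lambda>T. E 0 - (2 * \<sigma> * E 0) / (2 * T) + 2 * \<sigma> * (E T / (2 * T))) \<longlongrightarrow> E 0) at_top"
      by (rule tendsto_eq_rhs[OF tendsto_add[OF tendsto_diff[OF tendsto_const tendsto_const_over]
          tendsto_mult[OF tendsto_const lim(1)]]]) simp
    show "eventually (\<lambda>T. E \<sigma> \<le> E 0 - (2 * \<sigma> * E 0) / (2 * T) + 2 * \<sigma> * (E T / (2 * T))) at_top"
      using eventually_gt_at_top[of \<sigma>]
    proof eventually_elim
      case (elim T)
      have "E \<sigma> \<le> (1 - \<sigma> / T) * E 0 + \<sigma> / T * E T"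
        using conv[of "\<sigma> / T" 0 T] elim \<sigma> by simp
      then show ?case using elim \<sigma> by (simp add: left_diff_distrib)
    qed
  qed simp
  show "E 0 \<le> E \<sigma>"
  proof (rule tendsto_lowerbound)
    show "((\<lambda>T. E \<sigma> - (2 * \<sigma> * E 0) / (2 * T) + 2 * \<sigma> * (E (- T) / (2 * T))) \<longlongrightarrow> E \<sigma>) at_top"
      by (rule tendsto_eq_rhs[OF tendsto_add[OF tendsto_diff[OF tendsto_const tendsto_const_over]
          tendsto_mult[OF tendsto_const lim(2)]]]) simp
    show "eventually (\<lambda>T. E 0 \<le> E \<sigma> - (2 * \<sigma> * E 0) / (2 * T) + 2 * \<sigma> * (E (- T) / (2 * T))) at_top"
      using eventually_gt_at_top[of 0]
    proof eventually_elim
      case (elim T)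
      \<comment> \<open>The weight makes 0 a convex combination of \<sigma> and - T; convexity then
        bounds \<open>E 0\<close> by \<open>E \<sigma>\<close> up to terms that vanish as
        \<open>T\<close> grows.\<close>
      have "(1 - \<sigma> / (T + \<sigma>)) * \<sigma> + \<sigma> / (T + \<sigma>) * (- T) = 0"
        using elim \<sigma> by (simp add: field_simps)
      then have "E 0 \<le> (1 - \<sigma> / (T + \<sigma>)) * E \<sigma> + \<sigma> / (T + \<sigma>) * E (- T)"
        using conv[of "\<sigma> / (T + \<sigma>)" \<sigma> "- T"] elim \<sigma> by simp
      then have "(T + \<sigma>) * E 0 \<le> (T + \<sigma>) * ((1 - \<sigma> / (T + \<sigma>)) * E \<sigma> + \<sigma> / (T + \<sigma>) * E (- T))"
        using elim \<sigma> by (intro mult_left_mono) auto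
      also have "\<dots> = ((T + \<sigma>) * (1 - \<sigma> / (T + \<sigma>))) * E \<sigma> + ((T + \<sigma>) * (\<sigma> / (T + \<sigma>))) * E (- T)"
        by (simp add: distrib_left)
      also have "\<dots> = T * E \<sigma> + \<sigma> * E (- T)"
        using elim \<sigma> by (simp add: right_diff_distrib)
      finally show ?case using elim by (simp add: field_simps)
    qed
  qed simp
qed


section \<open>Flats in a building\<close>

locale A2_flats = cat0 "TYPE('a::metric_space)" +
  fixes \<F> :: "(real^3 \<Rightarrow> 'a::metric_space) set"
  assumes flats: "flat_system \<F>"
begin

lemma dist_flat:
  assumes "f \<in> \<F>" "a \<in> model_flat" "b \<in> model_flat"
  shows "dist (f a) (f b) = dist a b"
proof -
  have "\<F> \<subseteq> isometric_embeddings" using flats unfolding flat_system_def by (rule conjunct1)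
  with assms show ?thesis unfolding isometric_embeddings_def by auto
qed

lemma flat_inj:
  assumes "f \<in> \<F>" "a \<in> model_flat" "b \<in> model_flat" "f a = f b"
  shows "a = b"
  using dist_flat[OF assms(1-3)] assms(4) by simp

lemma speed_ray_flat_line:
  assumes "f \<in> \<F>" "a \<in> model_flat" "v \<in> model_flat"
  shows "speed_ray (norm v) (flat_line f a v)"
  using assms unfolding speed_ray_def flat_line_def
  by (simp add: dist_flat dist_norm scaleR_diff_left[symmetric] mult.commute)

lemma geodesic_flat:
  assumes "f \<in> \<F>" "a \<in> model_flat" "b \<in> model_flat"
  shows "geodesic_between (f a) (f b) (\<lambda>s. f (a + s *\<^sub>R (b - a)))"
  using assms unfolding geodesic_between_def
  by (simp add: dist_flat dist_norm scaleR_diff_left[symmetric] norm_minus_commute)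

lemma flat_segments_eq:
  assumes "f \<in> \<F>" "a \<in> model_flat" "b \<in> model_flat" "g \<in> \<F>" "c \<in> model_flat" "d \<in> model_flat"
    and "f a = g c" "f b = g d" "0 \<le> s" "s \<le> 1"
  shows "f (a + s *\<^sub>R (b - a)) = g (c + s *\<^sub>R (d - c))"
  using geodesic_unique[OF geodesic_flat[OF assms(1-3)], OF _ assms(9,10)] geodesic_flat[OF assms(4-6)] assms(7,8)
  by metis

lemma transition:
  assumes "f \<in> \<F>" "g \<in> \<F>"
  obtains w c where "w \<in> Weyl_group" "c \<in> model_flat"
    "\<And>b. b \<in> model_flat \<Longrightarrow> g b \<in> f ` model_flat \<Longrightarrow> g b = f (w b + c)"
proof -
  have "\<forall>f\<in>\<F>. \<forall>f'\<in>\<F>. \<exists>w\<in>affine_Weyl_group. \<forall>b\<in>model_flat.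
        f' b \<in> f ` model_flat \<longrightarrow> inv_into model_flat f (f' b) = w b"
    using flats unfolding flat_system_def by (elim conjE)
  then obtain u where "u \<in> affine_Weyl_group"
    and u: "\<And>b. b \<in> model_flat \<Longrightarrow> g b \<in> f ` model_flat \<Longrightarrow> inv_into model_flat f (g b) = u b"
    using assms by metis
  then obtain w c where w: "w \<in> Weyl_group" "c \<in> model_flat" "u = (\<lambda>l. w l + c)"
    by (auto simp: affine_Weyl_group_def)
  show ?thesis
  proof (rule that[OF w(1,2)])
    fix b assume b: "b \<in> model_flat" "g b \<in> f ` model_flat"
    then have "f (inv_into model_flat f (g b)) = g b" by (simp add: f_inv_into_f)
    then show "g b = f (w b + c)" using u[OF b] w(3) by simp
  qed
qed

lemma remark:
  assumes f: "f \<in> \<F>" and w: "w \<in> Weyl_group"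
  obtains g where "g \<in> \<F>" "g ` model_flat = f ` model_flat" "\<And>a. a \<in> model_flat \<Longrightarrow> g a = f (w a)"
proof
  have "(\<lambda>l. w l + 0) \<in> affine_Weyl_group"
    unfolding affine_Weyl_group_def using w model_flat_closed(1) by blast
  then show "restrict (f \<circ> w) model_flat \<in> \<F>"
    using flats f unfolding flat_system_def by simp
  obtain w' where w': "w' \<in> Weyl_group" "\<And>x. w (w' x) = x" using Weyl_inverse[OF w] by metis
  have "w ` model_flat = model_flat"
  proof (intro subset_antisym subsetI)
    fix x assume "x \<in> model_flat"
    then have "w (w' x) \<in> w ` model_flat" using Weyl_model_flat[OF w'(1)] by blast
    then show "x \<in> w ` model_flat" by (simp add: w'(2))
  qed (use Weyl_model_flat[OF w] in blast)
  then have "f ` w ` model_flat = f ` model_flat" by simp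
  then show "restrict (f \<circ> w) model_flat ` model_flat = f ` model_flat"
    by (simp add: image_comp)
qed auto

lemma geodesic_ray_flat_ray:
  assumes "f \<in> \<F>" "a \<in> model_flat" "v \<in> model_flat" "v \<noteq> 0"
  shows "geodesic_ray (flat_ray f a v)"
  using assms unfolding geodesic_ray_def flat_ray_def
  by (simp add: dist_flat dist_norm scaleR_diff_left[symmetric] diff_divide_distrib[symmetric])

lemma germ_in_flat:
  assumes "f \<in> \<F>" "a \<in> model_flat" "u \<in> model_flat" "g \<in> \<F>" "b \<in> model_flat" "v \<in> model_flat"
  obtains k \<delta> where "k \<in> \<F>" "0 < \<delta>"
    "\<And>t. 0 \<le> t \<Longrightarrow> t \<le> \<delta> \<Longrightarrow> f (a + t *\<^sub>R u) \<in> k ` model_flat"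
    "\<And>t. 0 \<le> t \<Longrightarrow> t \<le> \<delta> \<Longrightarrow> g (b + t *\<^sub>R v) \<in> k ` model_flat"
proof -
  \<comment> \<open>The axiom on germs needs genuine rays, so a zero direction is replaced by an
    arbitrary one, and only the base point of that ray is used. With both directions zero the lemma
    puts two points into a common flat.\<close>
  define u' v' where "u' = (if u = 0 then vtx 1 else u)" and "v' = (if v = 0 then vtx 1 else v)"
  have u': "u' \<in> model_flat" "u' \<noteq> 0" and v': "v' \<in> model_flat" "v' \<noteq> 0"
    using assms by (auto simp: u'_def v'_def)
  obtain k e where k: "k \<in> \<F>" "0 < e" "flat_ray f a u' ` {0..e} \<subseteq> k ` model_flat"
    "flat_ray g b v' ` {0..e} \<subseteq> k ` model_flat"
    using flats geodesic_ray_flat_ray[OF assms(1,2) u'] geodesic_ray_flat_ray[OF assms(4,5) v']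
    unfolding flat_system_def by meson
  define \<delta> where "\<delta> = min (e / norm u') (e / norm v')"
  have sub: "h (c + t *\<^sub>R z) \<in> k ` model_flat"
    if h: "flat_ray h c z' ` {0..e} \<subseteq> k ` model_flat" and z: "z' = (if z = 0 then vtx 1 else z)"
      and t: "0 \<le> t" "t \<le> e / norm z'" for h c z z' t
  proof (cases "z = 0")
    case True
    have "flat_ray h c z' 0 \<in> k ` model_flat" using h k(2) by force
    then show ?thesis using True by (simp add: flat_ray_def)
  next
    case False
    then have "t * norm z' \<in> {0..e}" using t z by (simp add: pos_le_divide_eq)
    with h have "flat_ray h c z' (t * norm z') \<in> k ` model_flat" by blast
    then show ?thesis using False z by (simp add: flat_ray_def)
  qed
  show ?thesis
  proof
    show "k \<in> \<F>" by fact
    show "0 < \<delta>" using k(2) u' v' by (simp add: \<delta>_def)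
  qed (use sub[OF k(3) u'_def] sub[OF k(4) v'_def] in \<open>auto simp: \<delta>_def\<close>)
qed

lemma germs_coordinates:
  assumes "f \<in> \<F>" "a \<in> model_flat" "u \<in> model_flat" "g \<in> \<F>" "b \<in> model_flat" "v \<in> model_flat"
  obtains k \<delta> w w' \<alpha> \<beta> where "k \<in> \<F>" "0 < \<delta>" "w \<in> Weyl_group" "w' \<in> Weyl_group"
    "\<alpha> \<in> model_flat" "\<beta> \<in> model_flat"
    "\<And>t. 0 \<le> t \<Longrightarrow> t \<le> \<delta> \<Longrightarrow> f (a + t *\<^sub>R u) = k (\<alpha> + t *\<^sub>R w u)"
    "\<And>t. 0 \<le> t \<Longrightarrow> t \<le> \<delta> \<Longrightarrow> g (b + t *\<^sub>R v) = k (\<beta> + t *\<^sub>R w' v)"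
proof -
  obtain k \<delta> where k: "k \<in> \<F>" "0 < \<delta>"
    "\<And>t. 0 \<le> t \<Longrightarrow> t \<le> \<delta> \<Longrightarrow> f (a + t *\<^sub>R u) \<in> k ` model_flat"
    "\<And>t. 0 \<le> t \<Longrightarrow> t \<le> \<delta> \<Longrightarrow> g (b + t *\<^sub>R v) \<in> k ` model_flat"
    using germ_in_flat[OF assms] by metis
  obtain w c where w: "w \<in> Weyl_group" "c \<in> model_flat"
    "\<And>b. b \<in> model_flat \<Longrightarrow> f b \<in> k ` model_flat \<Longrightarrow> f b = k (w b + c)"
    using transition[OF k(1) assms(1)] by metis
  obtain w' c' where w': "w' \<in> Weyl_group" "c' \<in> model_flat"
    "\<And>b. b \<in> model_flat \<Longrightarrow> g b \<in> k ` model_flat \<Longrightarrow> g b = k (w' b + c')"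
    using transition[OF k(1) assms(4)] by metis
  show ?thesis
  proof (rule that[OF k(1,2) w(1) w'(1)])
    show "w a + c \<in> model_flat" "w' b + c' \<in> model_flat"
      using assms w w' by (simp_all add: Weyl_model_flat)
    show "f (a + t *\<^sub>R u) = k (w a + c + t *\<^sub>R w u)" if "0 \<le> t" "t \<le> \<delta>" for t
      using w(3)[OF _ k(3)[OF that]] assms linear_add[OF Weyl_linear[OF w(1)]]
        linear_scale[OF Weyl_linear[OF w(1)]] by (simp add: algebra_simps)
    show "g (b + t *\<^sub>R v) = k (w' b + c' + t *\<^sub>R w' v)" if "0 \<le> t" "t \<le> \<delta>" for t
      using w'(3)[OF _ k(4)[OF that]] assms linear_add[OF Weyl_linear[OF w'(1)]]
        linear_scale[OF Weyl_linear[OF w'(1)]] by (simp add: algebra_simps)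
  qed
qed

lemma common_flat:
  assumes "x \<in> f ` model_flat" "f \<in> \<F>" "y \<in> g ` model_flat" "g \<in> \<F>"
  obtains k \<alpha> \<beta> where "k \<in> \<F>" "\<alpha> \<in> model_flat" "\<beta> \<in> model_flat" "x = k \<alpha>" "y = k \<beta>"
proof -
  obtain a b where ab: "a \<in> model_flat" "b \<in> model_flat" "x = f a" "y = g b" using assms by blast
  obtain k \<delta> where k: "k \<in> \<F>" "0 < (\<delta>::real)"
    "\<And>t. 0 \<le> t \<Longrightarrow> t \<le> \<delta> \<Longrightarrow> f (a + t *\<^sub>R 0) \<in> k ` model_flat"
    "\<And>t. 0 \<le> t \<Longrightarrow> t \<le> \<delta> \<Longrightarrow> g (b + t *\<^sub>R 0) \<in> k ` model_flat"
    using germ_in_flat[OF assms(2) ab(1) model_flat_closed(1) assms(4) ab(2) model_flat_closed(1)] by metis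
  from k(3)[of 0] k(4)[of 0] k(2) have "x \<in> k ` model_flat" "y \<in> k ` model_flat"
    by (simp_all add: ab)
  with k(1) that show ?thesis by blast
qed

text \<open>The angle between two directions at a point, realised in a common flat, is at most the
  comparison angle.\<close>

lemma hinge_direction:
  assumes f: "f \<in> \<F>" "a \<in> model_flat" "u \<in> model_flat" and g: "g \<in> \<F>" "b \<in> model_flat" "v \<in> model_flat"
    and eq: "f a = g b"
  obtains w where "w \<in> Weyl_group" "norm (u - w v) \<le> dist (f (a + u)) (g (b + v))"
proof -
  obtain k \<delta> w w' \<alpha> \<beta> where k: "k \<in> \<F>" "0 < \<delta>" and w: "w \<in> Weyl_group" "w' \<in> Weyl_group"
    and ab: "\<alpha> \<in> model_flat" "\<beta> \<in> model_flat"
    and kf: "\<And>t. 0 \<le> t \<Longrightarrow> t \<le> \<delta> \<Longrightarrow> f (a + t *\<^sub>R u) = k (\<alpha> + t *\<^sub>R w u)"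
    and kg: "\<And>t. 0 \<le> t \<Longrightarrow> t \<le> \<delta> \<Longrightarrow> g (b + t *\<^sub>R v) = k (\<beta> + t *\<^sub>R w' v)"
    using germs_coordinates[OF f g] by metis
  have "\<alpha> = \<beta>" using kf[of 0] kg[of 0] k eq ab by (auto intro: flat_inj)
  define t where "t = min \<delta> 1"
  have t: "0 < t" "t \<le> \<delta>" "t \<le> 1" using k by (auto simp: t_def)
  have mf: "w u \<in> model_flat" "w' v \<in> model_flat" using w f g by (simp_all add: Weyl_model_flat)
  have "t * norm (w u - w' v) = dist (f (a + t *\<^sub>R u)) (g (b + t *\<^sub>R v))"
    using t mf ab k \<open>\<alpha> = \<beta>\<close> by (simp add: kf kg dist_flat dist_norm scaleR_diff_right[symmetric])
  also have "\<dots> \<le> t * dist (f (a + u)) (g (b + v))"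
    using hinge_contraction[OF geodesic_flat[OF f(1,2), of "a + u"], of "g (b + v)"
        "\<lambda>s. g (b + s *\<^sub>R (b + v - b))" t] geodesic_flat[OF g(1,2), of "b + v"] f g eq t by simp
  finally have le: "norm (w u - w' v) \<le> dist (f (a + u)) (g (b + v))" using t by simp
  obtain w1 where w1: "w1 \<in> Weyl_group" "\<And>x. w1 (w x) = x" using Weyl_inverse[OF w(1)] by metis
  have "u - w1 (w' v) = w1 (w u - w' v)"
    using linear_diff[OF Weyl_linear[OF w1(1)]] w1(2) by simp
  then have "norm (u - w1 (w' v)) = norm (w u - w' v)" by (simp add: Weyl_norm[OF w1(1)])
  with le that[OF Weyl_compose[OF w1(1) w(2)]] show ?thesis by simp
qed

text \<open>Both hinges, at \<open>f (a + t *\<^sub>R u)\<close> and at \<open>g b\<close>, have opposite side of bounded length, so the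
  directions of the segment joining these two points are within \<open>O(1/t)\<close> of both \<open>u\<close> and \<open>v\<close>
  modulo the finite Weyl group.\<close>

lemma asymptotic_flat_lines_type:
  assumes f: "f \<in> \<F>" "a \<in> model_flat" "u \<in> model_flat" and g: "g \<in> \<F>" "b \<in> model_flat" "v \<in> model_flat"
    and C: "\<And>t. 0 \<le> t \<Longrightarrow> dist (flat_line f a u t) (flat_line g b v t) \<le> C"
  obtains w where "w \<in> Weyl_group" "u = w v"
proof -
  define D where "D = dist (f a) (g b)"
  have close: "\<exists>w\<in>Weyl_group. t * norm (u - w v) \<le> D + C" if t: "0 < t" for t
  proof -
    have "f (a + t *\<^sub>R u) \<in> f ` model_flat" "g b \<in> g ` model_flat" using f g by auto
    then obtain k \<alpha> \<beta> where k: "k \<in> \<F>" "\<alpha> \<in> model_flat" "\<beta> \<in> model_flat"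
      "f (a + t *\<^sub>R u) = k \<alpha>" "g b = k \<beta>"
      using common_flat[OF _ f(1) _ g(1)] by metis
    obtain w1 where w1: "w1 \<in> Weyl_group"
      "norm (- (t *\<^sub>R u) - w1 (\<beta> - \<alpha>)) \<le> dist (f (a + t *\<^sub>R u + - (t *\<^sub>R u))) (k (\<alpha> + (\<beta> - \<alpha>)))"
      using hinge_direction[of f "a + t *\<^sub>R u" "- (t *\<^sub>R u)" k \<alpha> "\<beta> - \<alpha>"] f k by auto
    obtain w2 where w2: "w2 \<in> Weyl_group"
      "norm ((\<alpha> - \<beta>) - w2 (t *\<^sub>R v)) \<le> dist (k (\<beta> + (\<alpha> - \<beta>))) (g (b + t *\<^sub>R v))"
      using hinge_direction[of k \<beta> "\<alpha> - \<beta>" g b "t *\<^sub>R v"] g k by auto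
    note lin = linear_diff[OF Weyl_linear[OF w1(1)]] linear_add[OF Weyl_linear[OF w1(1)]]
      linear_scale[OF Weyl_linear[OF w1(1)]]
      linear_scale[OF Weyl_linear[OF w2(1)]]
    have "norm (- (t *\<^sub>R u) - w1 (\<beta> - \<alpha>)) \<le> D" using w1(2) k by (simp add: D_def)
    moreover have "norm (w1 (\<alpha> - \<beta> - w2 (t *\<^sub>R v))) \<le> C"
      using w2(2) C[of t] t k by (simp add: flat_line_def Weyl_norm[OF w1(1)])
    moreover have "t *\<^sub>R (u - w1 (w2 v))
        = - (- (t *\<^sub>R u) - w1 (\<beta> - \<alpha>)) + w1 (\<alpha> - \<beta> - w2 (t *\<^sub>R v))"
      by (simp add: lin algebra_simps)
    then have "norm (t *\<^sub>R (u - w1 (w2 v)))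
        \<le> norm (- (t *\<^sub>R u) - w1 (\<beta> - \<alpha>)) + norm (w1 (\<alpha> - \<beta> - w2 (t *\<^sub>R v)))"
      by (metis norm_triangle_ineq norm_minus_cancel)
    ultimately have "t * norm (u - w1 (w2 v)) \<le> D + C" using t by simp
    then show ?thesis by (rule bexI[OF _ Weyl_compose[OF w1(1) w2(1)]])
  qed
  have "\<exists>w\<in>Weyl_group. u = w v"
  proof (rule ccontr)
    assume neg: "\<not> ?thesis"
    define d where "d = Min ((\<lambda>w. norm (u - w v)) ` Weyl_group)"
    have ne: "Weyl_group \<noteq> {}" using id_Weyl_group by blast
    have "d \<in> (\<lambda>w. norm (u - w v)) ` Weyl_group"
      unfolding d_def by (intro Min_in) (use finite_Weyl_group ne in auto)
    with neg have d: "0 < d" by auto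
    have "0 \<le> C" using C[of 0] zero_le_dist order_trans by blast
    then have DC: "0 \<le> D + C" by (simp add: D_def)
    \<comment> \<open>As \<open>Weyl_group\<close> is finite, \<open>u\<close> has positive distance
      \<open>d\<close> from the orbit of \<open>v\<close>; for this \<open>t\<close> the product
      \<open>t * d\<close> exceeds the bound \<open>D + C\<close>.\<close>
    define t where "t = (D + C + 1) / d"
    have t: "0 < t" using d DC by (simp add: t_def)
    obtain w where w: "w \<in> Weyl_group" "t * norm (u - w v) \<le> D + C" using close[OF t] by blast
    have "d \<le> norm (u - w v)" unfolding d_def using w finite_Weyl_group by (intro Min_le) auto
    then have "t * d \<le> D + C" using w t by (meson mult_left_mono order_trans less_imp_le)
    then show False using d by (simp add: t_def)
  qed
  then show ?thesis using that by blast
qed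

lemma busemann_flat:
  assumes "f \<in> \<F>" "a \<in> model_flat" "v \<in> model_flat" "l \<in> model_flat" "m \<in> model_flat"
  shows "busemann (flat_line f a v) (f l) (f m) = - ((l - m) \<bullet> v)"
proof (rule busemann_eqI, rule Lim_transform_eventually)
  show "((\<lambda>T. ((norm (l - a))\<^sup>2 - (norm (m - a))\<^sup>2) / (2 * T) - (l - m) \<bullet> v)
      \<longlongrightarrow> - ((l - m) \<bullet> v)) at_top"
    using tendsto_diff[OF tendsto_const_over tendsto_const] by simp
  show "eventually (\<lambda>T. ((norm (l - a))\<^sup>2 - (norm (m - a))\<^sup>2) / (2 * T) - (l - m) \<bullet> v
      = ((dist (f l) (flat_line f a v T))\<^sup>2 - (dist (f m) (flat_line f a v T))\<^sup>2) / (2 * T)) at_top"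
    using eventually_gt_at_top[of 0]
  proof eventually_elim
    case (elim T)
    have "(dist (f l) (flat_line f a v T))\<^sup>2 - (dist (f m) (flat_line f a v T))\<^sup>2
        = ((norm (l - a))\<^sup>2 - (norm (m - a))\<^sup>2) - 2 * T * ((l - m) \<bullet> v)"
      using assms unfolding flat_line_def power2_norm_eq_inner
      by (simp add: dist_flat dist_norm power2_norm_eq_inner inner_commute algebra_simps)
    then show ?case using elim by (simp add: diff_divide_distrib)
  qed
qed

lemma busemann_zero: "busemann (flat_line f a 0) x y = 0"
  by (rule busemann_eqI) (simp add: flat_line_def tendsto_const_over)

text \<open>\<open>f (a + T *\<^sub>R (u + v))\<close> is the midpoint of \<open>f (a + (2 * T) *\<^sub>R u)\<close> and
  \<open>f (a + (2 * T) *\<^sub>R v)\<close>.\<close>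

lemma busemann_subadditive:
  assumes f: "f \<in> \<F>" "a \<in> model_flat" and u: "u \<in> model_flat" and v: "v \<in> model_flat"
  shows "busemann (flat_line f a (u + v)) x (f a)
    \<le> busemann (flat_line f a u) x (f a) + busemann (flat_line f a v) x (f a)"
proof (rule tendsto_le)
  let ?G = "\<lambda>u T. ((dist x (flat_line f a u T))\<^sup>2 - (dist (f a) (flat_line f a u T))\<^sup>2) / (2 * T)"
  have G: "(?G u \<longlongrightarrow> busemann (flat_line f a u) x (f a)) at_top" if "u \<in> model_flat" for u
    using tendsto_busemann[OF speed_ray_flat_line[OF f that]] .
  have F: "filterlim (\<lambda>T::real. 2 * T) at_top at_top"
    by (rule filterlim_tendsto_pos_mult_at_top[OF tendsto_const _ filterlim_ident]) simp
  show "(?G (u + v) \<longlongrightarrow> busemann (flat_line f a (u + v)) x (f a)) at_top" using G u v by simp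
  show "((\<lambda>T. ?G u (2 * T) + ?G v (2 * T))
      \<longlongrightarrow> busemann (flat_line f a u) x (f a) + busemann (flat_line f a v) x (f a)) at_top"
    by (intro tendsto_add filterlim_compose[OF G[OF u] F] filterlim_compose[OF G[OF v] F])
  show "eventually (\<lambda>T. ?G (u + v) T \<le> ?G u (2 * T) + ?G v (2 * T)) at_top"
    using eventually_gt_at_top[of 0]
  proof eventually_elim
    case (elim T)
    have mid: "(dist x (flat_line f a (u + v) T))\<^sup>2 \<le> (dist x (flat_line f a u (2 * T)))\<^sup>2 / 2
        + (dist x (flat_line f a v (2 * T)))\<^sup>2 / 2 - T\<^sup>2 * (norm (u - v))\<^sup>2"
    proof -
      have 1: "a + (2 * T) *\<^sub>R u + (1/2) *\<^sub>R ((a + (2 * T) *\<^sub>R v) - (a + (2 * T) *\<^sub>R u)) = a + T *\<^sub>R (u + v)"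
        by (simp add: vec_eq_iff algebra_simps)
      have "(dist (f (a + (2 * T) *\<^sub>R u)) (f (a + (2 * T) *\<^sub>R v)))\<^sup>2 = 4 * T\<^sup>2 * (norm (u - v))\<^sup>2"
        using f u v by (simp add: dist_flat dist_norm scaleR_diff_right[symmetric] power_mult_distrib)
      with cn_inequality[OF geodesic_flat[OF f(1), of "a + (2 * T) *\<^sub>R u" "a + (2 * T) *\<^sub>R v"], of "1/2" x]
      show ?thesis using f u v unfolding 1 flat_line_def by simp
    qed
    have "dist (f a) (flat_line f a z S) = \<bar>S\<bar> * norm z" if "z \<in> model_flat" for z S
      using f that by (simp add: flat_line_def dist_flat dist_norm)
    then have "(dist (f a) (flat_line f a z S))\<^sup>2 = S\<^sup>2 * (norm z)\<^sup>2" if "z \<in> model_flat" for z S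
      using that by (simp add: power_mult_distrib)
    \<comment> \<open>The parallelogram law cancels the explicit terms that are quadratic in
      \<open>T\<close>.\<close>
    moreover have "(norm (u + v))\<^sup>2 + (norm (u - v))\<^sup>2 = 2 * (norm u)\<^sup>2 + 2 * (norm v)\<^sup>2"
      unfolding power2_norm_eq_inner by (simp add: inner_commute algebra_simps)
    then have "T\<^sup>2 * (norm (u + v))\<^sup>2 + T\<^sup>2 * (norm (u - v))\<^sup>2 = T\<^sup>2 * (2 * (norm u)\<^sup>2 + 2 * (norm v)\<^sup>2)"
      by (metis distrib_left)
    ultimately have "(dist x (flat_line f a (u + v) T))\<^sup>2 - (dist (f a) (flat_line f a (u + v) T))\<^sup>2
      \<le> ((dist x (flat_line f a u (2 * T)))\<^sup>2 - (dist (f a) (flat_line f a u (2 * T)))\<^sup>2) / 2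
        + ((dist x (flat_line f a v (2 * T)))\<^sup>2 - (dist (f a) (flat_line f a v (2 * T)))\<^sup>2) / 2"
      using mid u v by (simp add: power_mult_distrib diff_divide_distrib algebra_simps)
    then show ?case
      by (rule order_trans[OF divide_right_mono]) (use elim in \<open>simp_all add: add_divide_distrib\<close>)
  qed
qed simp

text \<open>Pythagoras for a line to which \<open>x\<close> projects at \<open>g \<alpha>\<close>.
  The function \<open>E\<close> is convex, because the correction term of
  \<open>cn_inequality\<close> is that of the subtracted quadratic, and its growth at both ends is
  given by the two vanishing Busemann values; so \<open>convex_sublinear_const\<close>
  applies.\<close>

lemma busemann_orthogonal:
  assumes g: "g \<in> \<F>" "\<alpha> \<in> model_flat" "u \<in> model_flat"
    and zero: "busemann (flat_line g \<alpha> u) x (g \<alpha>) = 0" "busemann (flat_line g \<alpha> (- u)) x (g \<alpha>) = 0"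
    and t: "0 < t"
  shows "(dist x (g (\<alpha> + t *\<^sub>R u)))\<^sup>2 = (dist x (g \<alpha>))\<^sup>2 + t\<^sup>2 * (norm u)\<^sup>2"
proof -
  define E where "E t = (dist x (g (\<alpha> + t *\<^sub>R u)))\<^sup>2 - t\<^sup>2 * (norm u)\<^sup>2" for t
  have "E t = E 0"
  proof (rule convex_sublinear_const[OF _ _ _ t])
    fix \<theta> s t :: real assume \<theta>: "0 \<le> \<theta>" "\<theta> \<le> 1"
    have 1: "\<alpha> + s *\<^sub>R u + \<theta> *\<^sub>R ((\<alpha> + t *\<^sub>R u) - (\<alpha> + s *\<^sub>R u)) = \<alpha> + ((1 - \<theta>) * s + \<theta> * t) *\<^sub>R u"
      by (simp add: algebra_simps)
    have "(dist (g (\<alpha> + s *\<^sub>R u)) (g (\<alpha> + t *\<^sub>R u)))\<^sup>2 = (s - t)\<^sup>2 * (norm u)\<^sup>2"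
      using g by (simp add: dist_flat dist_norm scaleR_diff_left[symmetric] power_mult_distrib)
    then have "(dist x (g (\<alpha> + ((1 - \<theta>) * s + \<theta> * t) *\<^sub>R u)))\<^sup>2
      \<le> (1 - \<theta>) * (dist x (g (\<alpha> + s *\<^sub>R u)))\<^sup>2 + \<theta> * (dist x (g (\<alpha> + t *\<^sub>R u)))\<^sup>2
        - \<theta> * (1 - \<theta>) * ((s - t)\<^sup>2 * (norm u)\<^sup>2)"
      using cn_inequality[OF geodesic_flat[OF g(1), of "\<alpha> + s *\<^sub>R u" "\<alpha> + t *\<^sub>R u"] \<theta>, of x] g
      unfolding 1 by simp
    moreover have "((1 - \<theta>) * s + \<theta> * t)\<^sup>2 * (norm u)\<^sup>2
      = (1 - \<theta>) * (s\<^sup>2 * (norm u)\<^sup>2) + \<theta> * (t\<^sup>2 * (norm u)\<^sup>2) - \<theta> * (1 - \<theta>) * ((s - t)\<^sup>2 * (norm u)\<^sup>2)"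
      by (simp add: power2_eq_square algebra_simps)
    ultimately show "E ((1 - \<theta>) * s + \<theta> * t) \<le> (1 - \<theta>) * E s + \<theta> * E t"
      by (simp add: E_def right_diff_distrib)
  next
    have "(dist (g \<alpha>) (g (\<alpha> + t *\<^sub>R u)))\<^sup>2 = t\<^sup>2 * (norm u)\<^sup>2"
      "(dist (g \<alpha>) (g (\<alpha> + t *\<^sub>R - u)))\<^sup>2 = t\<^sup>2 * (norm u)\<^sup>2" for t
      using g by (simp_all add: dist_flat dist_norm power_mult_distrib)
    then show "((\<lambda>T. E T / (2 * T)) \<longlongrightarrow> 0) at_top" "((\<lambda>T. E (- T) / (2 * T)) \<longlongrightarrow> 0) at_top"
      using tendsto_busemann[OF speed_ray_flat_line[OF g], of x "g \<alpha>"]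
        tendsto_busemann[OF speed_ray_flat_line[OF g(1,2), of "- u"], of x "g \<alpha>"] g
      by (simp_all add: zero E_def flat_line_def)
  qed
  then show ?thesis by (simp add: E_def)
qed

end


section \<open>Asymptotic rays and their endpoints\<close>

lemma asymptotic_refl: "geodesic_ray r \<Longrightarrow> (r, r) \<in> asymptotic"
  unfolding asymptotic_def by (auto intro!: exI[of _ 0])

lemma asymptotic_sym: "(r, s) \<in> asymptotic \<Longrightarrow> (s, r) \<in> asymptotic"
  unfolding asymptotic_def by (auto simp: dist_commute)

lemma asymptotic_trans:
  assumes "(r, s) \<in> asymptotic" "(s, q) \<in> asymptotic"
  shows "(r, q) \<in> asymptotic"
proof -
  obtain C where C: "\<And>t. 0 \<le> t \<Longrightarrow> dist (r t) (s t) \<le> C" using assms(1) by (auto simp: asymptotic_def)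
  obtain D where D: "\<And>t. 0 \<le> t \<Longrightarrow> dist (s t) (q t) \<le> D" using assms(2) by (auto simp: asymptotic_def)
  have "dist (r t) (q t) \<le> C + D" if "0 \<le> t" for t
    using dist_triangle[of "r t" "q t" "s t"] C[OF that] D[OF that] by linarith
  then show ?thesis using assms by (auto simp: asymptotic_def)
qed

lemma endpoint_eq_iff:
  assumes "geodesic_ray r" "geodesic_ray s"
  shows "endpoint r = endpoint s \<longleftrightarrow> (r, s) \<in> asymptotic"
proof
  assume eq: "endpoint r = endpoint s"
  have "s \<in> endpoint s" using asymptotic_refl[OF assms(2)] by (simp add: endpoint_def)
  then have "s \<in> endpoint r" unfolding eq .
  then show "(r, s) \<in> asymptotic" by (simp add: endpoint_def)
next
  assume "(r, s) \<in> asymptotic"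
  then show "endpoint r = endpoint s"
    unfolding endpoint_def by (auto intro: asymptotic_trans asymptotic_sym)
qed

text \<open>The distances between the values at 0, 1 and \<open>t\<close> give
  \<open>a \<bullet> b = t\<close> by polarisation, hence \<open>a = t *\<^sub>R b\<close>.\<close>

lemma isometric_ray_straight:
  fixes \<rho> :: "real \<Rightarrow> 'b::real_inner"
  assumes "\<And>s t. 0 \<le> s \<Longrightarrow> 0 \<le> t \<Longrightarrow> norm (\<rho> s - \<rho> t) = \<bar>s - t\<bar>" and t: "0 \<le> t"
  shows "\<rho> t = \<rho> 0 + t *\<^sub>R (\<rho> 1 - \<rho> 0)"
proof -
  define a b where "a = \<rho> t - \<rho> 0" and "b = \<rho> 1 - \<rho> 0"
  have "norm a = t" "norm b = 1" "norm (a - b) = \<bar>t - 1\<bar>"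
    using assms(1)[of t 0] assms(1)[of 1 0] assms(1)[of t 1] t by (simp_all add: a_def b_def)
  then have n: "a \<bullet> a = t\<^sup>2" "b \<bullet> b = 1" "(a - b) \<bullet> (a - b) = (t - 1)\<^sup>2"
    by (simp_all add: power2_norm_eq_inner[symmetric])
  then have ab: "a \<bullet> b = t"
    by (simp add: inner_diff_left inner_diff_right inner_commute power2_eq_square algebra_simps)
  have "(a - t *\<^sub>R b) \<bullet> (a - t *\<^sub>R b) = 0"
    using n ab by (simp add: inner_diff_left inner_diff_right inner_commute power2_eq_square)
  then have "a = t *\<^sub>R b" by (simp only: inner_eq_zero_iff right_minus_eq)
  then show ?thesis by (simp add: a_def b_def algebra_simps)
qed

context A2_flats
begin

lemma flat_ray_eq_flat_line: "flat_ray f a v t = flat_line f a v (t / norm v)"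
  by (simp add: flat_ray_def flat_line_def)

lemma endpoint_flat_ray_eq_iff:
  assumes f: "f \<in> \<F>" "a \<in> model_flat" "u \<in> model_flat" "u \<noteq> 0"
    and g: "g \<in> \<F>" "b \<in> model_flat" "v \<in> model_flat" "v \<noteq> 0"
    and n: "norm u = norm v"
  shows "endpoint (flat_ray f a u) = endpoint (flat_ray g b v)
    \<longleftrightarrow> (\<exists>C. \<forall>t\<ge>0. dist (flat_line f a u t) (flat_line g b v t) \<le> C)"
proof -
  have r: "geodesic_ray (flat_ray f a u)" "geodesic_ray (flat_ray g b v)"
    using geodesic_ray_flat_ray f g by blast+
  have pos: "0 < norm v" using g by simp
  have "(\<forall>t\<ge>0. dist (flat_ray f a u t) (flat_ray g b v t) \<le> C)
      \<longleftrightarrow> (\<forall>t\<ge>0. dist (flat_line f a u t) (flat_line g b v t) \<le> C)" for C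
  proof (intro iffI allI impI)
    fix t :: real assume *: "\<forall>t\<ge>0. dist (flat_ray f a u t) (flat_ray g b v t) \<le> C" and t: "0 \<le> t"
    show "dist (flat_line f a u t) (flat_line g b v t) \<le> C"
      using *[rule_format, of "t * norm v"] t pos n by (simp add: flat_ray_eq_flat_line)
  qed (use pos n in \<open>simp add: flat_ray_eq_flat_line\<close>)
  then show ?thesis unfolding endpoint_eq_iff[OF r] using r by (simp add: asymptotic_def)
qed

lemma flat_ray_scale: "0 < c \<Longrightarrow> flat_ray f a (c *\<^sub>R v) = flat_ray f a v"
  by (rule ext) (simp add: flat_ray_def)

lemma endpoint_flat_ray_base:
  assumes "f \<in> \<F>" "a \<in> model_flat" "b \<in> model_flat" "v \<in> model_flat" "v \<noteq> 0"
  shows "endpoint (flat_ray f a v) = endpoint (flat_ray f b v)"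
  using assms
  by (subst endpoint_flat_ray_eq_iff) (auto simp: flat_line_def dist_flat dist_norm intro!: exI[of _ "norm (a - b)"])

lemma flat_rays_same_origin:
  assumes f: "f \<in> \<F>" "a \<in> model_flat" "u \<in> model_flat" "u \<noteq> 0"
    and g: "g \<in> \<F>" "b \<in> model_flat" "v \<in> model_flat" "v \<noteq> 0"
    and eq: "endpoint (flat_ray f a u) = endpoint (flat_ray g b v)" "f a = g b" and t: "0 \<le> t"
  shows "f (a + t *\<^sub>R u) = g (b + (t * (norm u / norm v)) *\<^sub>R v)"
proof -
  define c where "c = norm u / norm v"
  have c: "0 < c" "norm u = norm (c *\<^sub>R v)" "c *\<^sub>R v \<in> model_flat" "c *\<^sub>R v \<noteq> 0"
    using f g by (auto simp: c_def)
  have "endpoint (flat_ray f a u) = endpoint (flat_ray g b (c *\<^sub>R v))"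
    using eq c by (simp add: flat_ray_scale)
  then obtain C where C: "\<And>t. 0 \<le> t \<Longrightarrow> dist (flat_line f a u t) (flat_line g b (c *\<^sub>R v) t) \<le> C"
    unfolding endpoint_flat_ray_eq_iff[OF f g(1,2) c(3,4,2)] by blast
  have "flat_line f a u t = flat_line g b (c *\<^sub>R v) t"
    by (rule asymptotic_same_origin[OF speed_ray_flat_line[OF f(1-3)] speed_ray_flat_line[OF g(1,2) c(3)] _ C t])
      (simp_all add: flat_line_def eq)
  then show ?thesis by (simp add: flat_line_def c_def)
qed

text \<open>The point \<open>x\<close> would project orthogonally to \<open>g \<alpha>\<close>. In a flat containing \<open>x\<close> and \<open>g \<alpha>\<close>
  its direction at \<open>g \<alpha>\<close> is orthogonal both to a Weyl image of \<open>vtx m\<close> and to a Weyl image of the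
  root \<open>vtx m - vtx n\<close>; the first makes one coordinate vanish, the second makes two coordinates
  equal, which forces the direction to be zero.\<close>

lemma horocycle_point_unique:
  assumes h: "h \<in> \<F>" "x \<in> h ` model_flat" and g: "g \<in> \<F>" "\<alpha> \<in> model_flat" and mn: "m \<noteq> n"
    and zero1: "busemann (flat_line g \<alpha> (vtx m)) x (g \<alpha>) = 0"
      "busemann (flat_line g \<alpha> (- vtx m)) x (g \<alpha>) = 0"
    and zero2: "busemann (flat_line g \<alpha> (vtx m - vtx n)) x (g \<alpha>) = 0"
      "busemann (flat_line g \<alpha> (- (vtx m - vtx n))) x (g \<alpha>) = 0"
  shows "x = g \<alpha>"
proof -
  obtain b where b: "b \<in> model_flat" "x = h b" using h by blast
  have orth: "\<exists>k\<in>\<F>. \<exists>\<beta>\<in>model_flat. \<exists>V\<in>model_flat. \<exists>w\<in>Weyl_group.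
      x = k (\<beta> + V) \<and> g \<alpha> = k \<beta> \<and> V \<bullet> w u = 0"
    if u: "u \<in> model_flat" and z: "busemann (flat_line g \<alpha> u) x (g \<alpha>) = 0"
      "busemann (flat_line g \<alpha> (- u)) x (g \<alpha>) = 0" for u
  proof -
    obtain k \<delta> w w' \<beta>' \<beta> where k: "k \<in> \<F>" "0 < \<delta>" "w \<in> Weyl_group" "w' \<in> Weyl_group"
      "\<beta>' \<in> model_flat" "\<beta> \<in> model_flat"
      "\<And>t. 0 \<le> t \<Longrightarrow> t \<le> \<delta> \<Longrightarrow> h (b + t *\<^sub>R 0) = k (\<beta>' + t *\<^sub>R w 0)"
      "\<And>t. 0 \<le> t \<Longrightarrow> t \<le> \<delta> \<Longrightarrow> g (\<alpha> + t *\<^sub>R u) = k (\<beta> + t *\<^sub>R w' u)"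
      using germs_coordinates[OF h(1) b(1) model_flat_closed(1) g u] by metis
    define V where "V = \<beta>' - \<beta>"
    have x: "x = k (\<beta> + V)" using k(7)[of 0] k(2) b by (simp add: V_def)
    have y: "g \<alpha> = k \<beta>" using k(8)[of 0] k(2) by simp
    have wu: "w' u \<in> model_flat" using k(4) u by (simp add: Weyl_model_flat)
    have V: "V \<in> model_flat" using k by (simp add: V_def)
    \<comment> \<open>At time \<delta> the line is still in \<open>k\<close>, so
      \<open>busemann_orthogonal\<close> can be read in Euclidean coordinates, where it is an
      orthogonality of vectors.\<close>
    have "(norm (V - \<delta> *\<^sub>R w' u))\<^sup>2 = (norm V)\<^sup>2 + \<delta>\<^sup>2 * (norm u)\<^sup>2"
      using busemann_orthogonal[OF g u z k(2)] k x y wu V by (simp add: dist_flat dist_norm)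
    moreover have "(norm (V - \<delta> *\<^sub>R w' u))\<^sup>2 = (norm V)\<^sup>2 - 2 * \<delta> * (V \<bullet> w' u) + \<delta>\<^sup>2 * (norm (w' u))\<^sup>2"
      unfolding power2_norm_eq_inner
      by (simp add: inner_diff_left inner_diff_right inner_commute power2_eq_square algebra_simps)
    ultimately have "V \<bullet> w' u = 0" using k(2) by (simp add: Weyl_norm[OF k(4)])
    then show ?thesis using k x y V by blast
  qed
  obtain k \<beta> V w where 1: "k \<in> \<F>" "\<beta> \<in> model_flat" "V \<in> model_flat" "w \<in> Weyl_group"
    "x = k (\<beta> + V)" "g \<alpha> = k \<beta>" "V \<bullet> w (vtx m) = 0"
    using orth[OF _ zero1] by auto
  obtain k' \<beta>' V' w' where 2: "k' \<in> \<F>" "\<beta>' \<in> model_flat" "V' \<in> model_flat" "w' \<in> Weyl_group"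
    "x = k' (\<beta>' + V')" "g \<alpha> = k' \<beta>'" "V' \<bullet> w' (vtx m - vtx n) = 0"
    using orth[OF _ zero2] by auto
  \<comment> \<open>Both \<open>k\<close> and \<open>k'\<close> contain \<open>x\<close> and
    \<open>g \<alpha>\<close>; a hinge whose opposite side has length zero shows that the two
    coordinate vectors of the segment agree up to \<open>Weyl_group\<close>.\<close>
  obtain w'' where w'': "w'' \<in> Weyl_group" "V = w'' V'"
    using hinge_direction[OF 1(1-3) 2(1-3)] 1(5,6) 2(5,6) by auto
  obtain \<pi> where \<pi>: "\<And>m. w (vtx m) = vtx (\<pi> m)" using Weyl_vtx[OF 1(4)] by metis
  obtain \<pi>' where \<pi>': "inj \<pi>'" "\<And>m. w' (vtx m) = vtx (\<pi>' m)" using Weyl_vtx[OF 2(4)] by metis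
  obtain \<sigma> where \<sigma>: "w'' = (\<lambda>l. \<chi> i. l $ \<sigma> i)" using w''(1) by (auto simp: Weyl_group_def)
  have "V $ \<pi> m = 0" using 1 \<pi> by (simp add: inner_vtx)
  then have a: "V' $ \<sigma> (\<pi> m) = 0" by (simp add: w''(2) \<sigma>)
  have b: "V' $ \<pi>' m = V' $ \<pi>' n"
    using 2 \<pi>' linear_diff[OF Weyl_linear[OF 2(4)]] by (simp add: inner_diff_right inner_vtx)
  have ne: "\<pi>' m \<noteq> \<pi>' n" using \<pi>'(1) mn by (simp add: inj_eq)
  have "V' $ 1 + V' $ 2 + V' $ 3 = 0" using 2 by (simp add: model_flat_def)
  then have "V' $ i = 0" for i
    using a b ne exhaust_3[of "\<pi>' m"] exhaust_3[of "\<pi>' n"] exhaust_3[of "\<sigma> (\<pi> m)"] exhaust_3[of i]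
    by auto
  then have "V' = 0" by (simp add: vec_eq_iff)
  then show ?thesis using 2 by simp
qed


section \<open>Vertices at infinity\<close>

text \<open>\<open>vertex 1 f m\<close> ranges over the points, \<open>vertex (-1) f m\<close> over the lines at infinity; the
  sign is kept as a parameter so that dual statements are instances of the same lemma.\<close>

definition vertex :: "real \<Rightarrow> (real^3 \<Rightarrow> 'a) \<Rightarrow> 3 \<Rightarrow> 'a ideal_point" where
  "vertex \<sigma> f m = endpoint (flat_ray f 0 (\<sigma> *\<^sub>R vtx m))"

definition vertices :: "real \<Rightarrow> 'a ideal_point set" where
  "vertices \<sigma> = {vertex \<sigma> f m | f m. f \<in> \<F>}"

text \<open>Incidence, written symmetrically in points and lines;
  \<open>incident_iff_adjacent\<close> links it to \<open>incident\<close>. In one flat, vertices of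
  different sign span an ideal chamber when their indices differ and are opposite when the indices
  agree.\<close>

definition adjacent :: "real \<Rightarrow> 'a ideal_point \<Rightarrow> 'a ideal_point \<Rightarrow> bool" where
  "adjacent \<sigma> \<xi> \<eta> \<longleftrightarrow> (\<exists>g\<in>\<F>. \<exists>m n. m \<noteq> n \<and> \<xi> = vertex \<sigma> g m \<and> \<eta> = vertex (- \<sigma>) g n)"

lemma vertex_base:
  assumes "f \<in> \<F>" "a \<in> model_flat" "\<bar>\<sigma>\<bar> = 1"
  shows "endpoint (flat_ray f a (\<sigma> *\<^sub>R vtx m)) = vertex \<sigma> f m"
  unfolding vertex_def using assms by (intro endpoint_flat_ray_base) auto

lemma vertex_in_vertices: "f \<in> \<F> \<Longrightarrow> vertex \<sigma> f m \<in> vertices \<sigma>"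
  unfolding vertices_def by blast

lemma adjacent_vertex:
  assumes "f \<in> \<F>" "m \<noteq> n"
  shows "adjacent \<sigma> (vertex \<sigma> f m) (vertex (- \<sigma>) f n)"
  unfolding adjacent_def using assms by blast

lemma adjacent_commute: "adjacent \<sigma> \<xi> \<eta> \<Longrightarrow> adjacent (- \<sigma>) \<eta> \<xi>"
  unfolding adjacent_def minus_minus by metis

lemma norm_vertex_direction: "\<bar>\<sigma>\<bar> = 1 \<Longrightarrow> norm (\<sigma> *\<^sub>R vtx m) = sqrt (2/3)"
  by (simp add: norm_vtx)

lemma vertex_eq_iff:
  assumes "f \<in> \<F>" "g \<in> \<F>" "\<bar>\<sigma>\<bar> = 1" "\<bar>\<tau>\<bar> = 1" "a \<in> model_flat" "b \<in> model_flat"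
  shows "vertex \<sigma> f m = vertex \<tau> g n
    \<longleftrightarrow> (\<exists>C. \<forall>t\<ge>0. dist (flat_line f a (\<sigma> *\<^sub>R vtx m) t) (flat_line g b (\<tau> *\<^sub>R vtx n) t) \<le> C)"
  using assms endpoint_flat_ray_eq_iff[of f a "\<sigma> *\<^sub>R vtx m" g b "\<tau> *\<^sub>R vtx n"]
  by (auto simp: vertex_base norm_vtx)

lemma vertex_remark:
  assumes f: "f \<in> \<F>" and \<pi>: "inj \<pi>"
  obtains g where "g \<in> \<F>" "g ` model_flat = f ` model_flat" "\<And>\<sigma> m. vertex \<sigma> g m = vertex \<sigma> f (\<pi> m)"
proof -
  obtain w where w: "w \<in> Weyl_group" "\<And>m. w (vtx m) = vtx (\<pi> m)" using Weyl_vtx_exists[OF \<pi>] by metis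
  obtain g where g: "g \<in> \<F>" "g ` model_flat = f ` model_flat" "\<And>a. a \<in> model_flat \<Longrightarrow> g a = f (w a)"
    using remark[OF f w(1)] by metis
  have "flat_ray g 0 (\<sigma> *\<^sub>R vtx m) = flat_ray f 0 (\<sigma> *\<^sub>R vtx (\<pi> m))" for \<sigma> m
    using linear_scale[OF Weyl_linear[OF w(1)]]
    by (intro ext) (simp add: flat_ray_def g w norm_vtx)
  then show ?thesis using that[OF g(1,2)] by (simp add: vertex_def)
qed

lemma vertex_in_ideal_boundary:
  assumes f: "f \<in> \<F>" and a: "a \<in> model_flat" and \<sigma>: "\<bar>\<sigma>\<bar> = 1"
    and S: "\<And>t. 0 \<le> t \<Longrightarrow> a + t *\<^sub>R (\<sigma> *\<^sub>R vtx m) \<in> S"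
  shows "vertex \<sigma> f m \<in> ideal_boundary (f ` S)"
proof -
  let ?r = "flat_ray f a (\<sigma> *\<^sub>R vtx m)"
  have "geodesic_ray ?r" using f a \<sigma> by (intro geodesic_ray_flat_ray) auto
  moreover have "?r ` {0..} \<subseteq> f ` S"
    using S \<sigma> by (auto simp: flat_ray_def simp del: scaleR_scaleR intro!: imageI)
  ultimately show ?thesis unfolding ideal_boundary_def vertex_base[OF f a \<sigma>, symmetric] by blast
qed

text \<open>A ray in a marked flat is straight in its coordinates, and here it is asymptotic to a
  ray of direction \<open>\<sigma> *\<^sub>R vtx n\<close> in some other flat. By
  \<open>asymptotic_flat_lines_type\<close> its direction, suitably scaled, lies in the same Weyl
  orbit. So the type of an ideal vertex can be read off in any flat that has it in its
  boundary.\<close>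

lemma ideal_boundary_vertex:
  assumes f: "f \<in> \<F>" and S: "S \<subseteq> model_flat" and \<sigma>: "\<bar>\<sigma>\<bar> = 1"
    and \<xi>: "\<xi> \<in> vertices \<sigma>" "\<xi> \<in> ideal_boundary (f ` S)"
  obtains a m where "a \<in> model_flat" "\<xi> = vertex \<sigma> f m"
    "\<And>t. 0 \<le> t \<Longrightarrow> a + t *\<^sub>R (\<sigma> *\<^sub>R vtx m) \<in> S"
proof -
  obtain r where r: "geodesic_ray r" "r ` {0..} \<subseteq> f ` S" "\<xi> = endpoint r"
    using \<xi>(2) by (auto simp: ideal_boundary_def)
  have "\<forall>t. \<exists>b. 0 \<le> t \<longrightarrow> b \<in> S \<and> r t = f b" using r(2) by force
  then obtain \<rho> where \<rho>: "\<And>t. 0 \<le> t \<Longrightarrow> \<rho> t \<in> S" "\<And>t. 0 \<le> t \<Longrightarrow> r t = f (\<rho> t)"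
    by metis
  have "norm (\<rho> s - \<rho> t) = \<bar>s - t\<bar>" if "0 \<le> s" "0 \<le> t" for s t
  proof -
    have "dist (f (\<rho> s)) (f (\<rho> t)) = \<bar>s - t\<bar>"
      using r(1) that \<rho>(2)[OF that(1)] \<rho>(2)[OF that(2)] unfolding geodesic_ray_def by metis
    moreover have "\<rho> s \<in> model_flat" "\<rho> t \<in> model_flat" using \<rho>(1) S that by auto
    ultimately show ?thesis using f by (simp add: dist_flat dist_norm)
  qed
  note iso = this
  define a v where "a = \<rho> 0" and "v = \<rho> 1 - \<rho> 0"
  have line: "\<rho> t = a + t *\<^sub>R v" if "0 \<le> t" for t
    using isometric_ray_straight[of \<rho>, OF iso that] by (simp add: a_def v_def)
  have a: "a \<in> model_flat" using \<rho>(1)[of 0] S by (auto simp: a_def)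
  have "\<rho> 1 \<in> model_flat" using \<rho>(1)[of 1] S by auto
  then have v: "v \<in> model_flat" using a by (simp add: v_def a_def)
  have nv: "norm v = 1" using iso[of 1 0] by (simp add: v_def)
  obtain g n where g: "g \<in> \<F>" "\<xi> = vertex \<sigma> g n" using \<xi>(1) by (auto simp: vertices_def)
  define k where "k = sqrt (2/3::real)"
  have k: "0 < k" by (simp add: k_def)
  have gf: "geodesic_ray (flat_ray f a v)" using geodesic_ray_flat_ray[OF f a v] nv by force
  then have "(r, flat_ray f a v) \<in> asymptotic"
    using r(1) nv \<rho>(2) line by (auto simp: asymptotic_def flat_ray_def intro!: exI[of _ 0])
  then have "\<xi> = endpoint (flat_ray f a v)" using r endpoint_eq_iff[OF r(1) gf] by simp
  then have \<xi>v: "\<xi> = endpoint (flat_ray f a (k *\<^sub>R v))" using k by (simp add: flat_ray_scale)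
  have nkv: "norm (k *\<^sub>R v) = norm (\<sigma> *\<^sub>R vtx n)" using nv k \<sigma> by (simp add: norm_vtx k_def)
  have kv: "k *\<^sub>R v \<in> model_flat" "k *\<^sub>R v \<noteq> 0" using v nv k by auto
  have sv: "\<sigma> *\<^sub>R vtx n \<in> model_flat" "\<sigma> *\<^sub>R vtx n \<noteq> 0" using \<sigma> by auto
  have "endpoint (flat_ray f a (k *\<^sub>R v)) = endpoint (flat_ray g 0 (\<sigma> *\<^sub>R vtx n))"
    using \<xi>v g(2) by (simp add: vertex_def)
  then obtain C where "\<And>t. 0 \<le> t \<Longrightarrow> dist (flat_line f a (k *\<^sub>R v) t) (flat_line g 0 (\<sigma> *\<^sub>R vtx n) t) \<le> C"
    unfolding endpoint_flat_ray_eq_iff[OF f a kv g(1) model_flat_closed(1) sv nkv] by blast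
  then obtain w where w: "w \<in> Weyl_group" "k *\<^sub>R v = w (\<sigma> *\<^sub>R vtx n)"
    using asymptotic_flat_lines_type[OF f a kv(1) g(1) model_flat_closed(1) sv(1)] by metis
  obtain \<pi> where \<pi>: "\<And>m. w (vtx m) = vtx (\<pi> m)" using Weyl_vtx[OF w(1)] by metis
  have kv': "k *\<^sub>R v = \<sigma> *\<^sub>R vtx (\<pi> n)"
    using w(2) linear_scale[OF Weyl_linear[OF w(1)]] \<pi> by simp
  show ?thesis
  proof (rule that[OF a])
    show "\<xi> = vertex \<sigma> f (\<pi> n)" using \<xi>v unfolding kv' vertex_base[OF f a \<sigma>] .
    fix t :: real assume t: "0 \<le> t"
    have "a + t *\<^sub>R (\<sigma> *\<^sub>R vtx (\<pi> n)) = \<rho> (t * k)" using line[of "t * k"] t k by (simp add: kv'[symmetric])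
    then show "a + t *\<^sub>R (\<sigma> *\<^sub>R vtx (\<pi> n)) \<in> S" using \<rho>(1)[of "t * k"] t k by simp
  qed
qed

end


lemma vtx_sum: "l \<noteq> m \<Longrightarrow> l \<noteq> n \<Longrightarrow> m \<noteq> n \<Longrightarrow> vtx l = - vtx m - vtx n"
  using exhaust_3[of l] exhaust_3[of m] exhaust_3[of n]
  by (auto simp: vec_eq_iff forall_3 vtx_nth)

lemma norm_vtx_diff: "m \<noteq> n \<Longrightarrow> norm (vtx m - vtx n) = sqrt 2"
proof -
  assume "m \<noteq> n"
  then have "(vtx m - vtx n) \<bullet> (vtx m - vtx n) = 2"
    by (simp add: inner_diff_right inner_vtx) (simp add: vtx_nth)
  then show ?thesis by (simp add: norm_eq_sqrt_inner)
qed

lemma norm_vtx_add_twice: "m \<noteq> n \<Longrightarrow> norm (vtx m + 2 *\<^sub>R vtx n) = sqrt 2"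
proof -
  assume "m \<noteq> n"
  then have "(vtx m + 2 *\<^sub>R vtx n) \<bullet> (vtx m + 2 *\<^sub>R vtx n) = 2"
    by (simp add: inner_add_right inner_vtx) (simp add: vtx_nth)
  then show ?thesis by (simp add: norm_eq_sqrt_inner)
qed

lemma third_index:
  fixes m n :: 3
  obtains l where "l \<noteq> m" "l \<noteq> n"
proof -
  have "(1::3) \<noteq> 2" "(1::3) \<noteq> 3" "(2::3) \<noteq> 3" by simp_all
  then show ?thesis
    using that[of 1] that[of 2] that[of 3] exhaust_3[of m] exhaust_3[of n] by metis
qed

lemma inj_3_extend:
  fixes m n a b :: 3
  assumes "m \<noteq> n" "a \<noteq> b"
  obtains \<pi> where "inj \<pi>" "\<pi> m = a" "\<pi> n = b"
proof -
  obtain c where c: "c \<noteq> a" "c \<noteq> b" by (rule third_index)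
  obtain l where l: "l \<noteq> m" "l \<noteq> n" by (rule third_index)
  have cover: "x = m \<or> x = n \<or> x = l" for x
    using assms(1) l exhaust_3[of x] exhaust_3[of m] exhaust_3[of n] exhaust_3[of l] by auto
  define \<pi> where "\<pi> x = (if x = m then a else if x = n then b else c)" for x
  have "inj \<pi>"
  proof (rule injI)
    fix x y assume "\<pi> x = \<pi> y"
    then show "x = y" using cover[of x] cover[of y] assms c l by (auto simp: \<pi>_def split: if_splits)
  qed
  then show ?thesis by (rule that) (use assms in \<open>simp_all add: \<pi>_def\<close>)
qed

lemma model_flat_decompose:
  assumes "l \<in> model_flat" "m \<noteq> n" "k \<noteq> m" "k \<noteq> n"
  shows "l = (l $ m - l $ k) *\<^sub>R vtx m + (l $ n - l $ k) *\<^sub>R vtx n"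
proof -
  have "l $ 3 = - l $ 1 - l $ 2" using assms(1) by (simp add: model_flat_def)
  then show ?thesis using assms(2-) exhaust_3[of k] exhaust_3[of m] exhaust_3[of n]
    by (auto simp: vec_eq_iff forall_3 vtx_nth field_simps)
qed

text \<open>The coefficients in \<open>model_flat_decompose\<close> are differences with the
  \<open>k\<close>-th coordinate, hence nonnegative after multiplication by \<sigma> when that
  coordinate is minimal. This is how sectors become coordinate conditions.\<close>

lemma cone_decompose:
  assumes "l \<in> model_flat" "\<mu> \<in> model_flat" "m \<noteq> n" "k \<noteq> m" "k \<noteq> n" and \<sigma>: "\<bar>\<sigma>\<bar> = 1"
    and min: "\<And>i. \<sigma> * (l - \<mu>) $ k \<le> \<sigma> * (l - \<mu>) $ i"
  obtains s t where "0 \<le> s" "0 \<le> t" "l = \<mu> + s *\<^sub>R (\<sigma> *\<^sub>R vtx m) + t *\<^sub>R (\<sigma> *\<^sub>R vtx n)"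
proof
  define s t where "s = \<sigma> * ((l - \<mu>) $ m - (l - \<mu>) $ k)" and "t = \<sigma> * ((l - \<mu>) $ n - (l - \<mu>) $ k)"
  show "0 \<le> s" "0 \<le> t" using min[of m] min[of n] by (simp_all add: s_def t_def right_diff_distrib)
  have "\<sigma> * \<sigma> = 1" using \<sigma> by (auto simp: abs_if split: if_splits)
  then have \<sigma>2: "\<sigma> * r * \<sigma> = r" for r by (simp add: mult.commute mult.left_commute)
  have "s *\<^sub>R (\<sigma> *\<^sub>R vtx m) + t *\<^sub>R (\<sigma> *\<^sub>R vtx n) = (s * \<sigma>) *\<^sub>R vtx m + (t * \<sigma>) *\<^sub>R vtx n" by simp
  also have "\<dots> = l - \<mu>"
    unfolding s_def t_def \<sigma>2 by (rule model_flat_decompose[symmetric]) (use assms in simp_all)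
  finally have "s *\<^sub>R (\<sigma> *\<^sub>R vtx m) + t *\<^sub>R (\<sigma> *\<^sub>R vtx n) = l - \<mu>" .
  then show "l = \<mu> + s *\<^sub>R (\<sigma> *\<^sub>R vtx m) + t *\<^sub>R (\<sigma> *\<^sub>R vtx n)" by (simp add: add.assoc)
qed

context A2_flats
begin

lemma vertex_inj:
  assumes f: "f \<in> \<F>" and \<sigma>: "\<bar>\<sigma>\<bar> = 1" and eq: "vertex \<sigma> f m = vertex \<sigma> f n"
  shows "m = n"
proof (rule ccontr)
  assume mn: "m \<noteq> n"
  obtain C where C: "\<And>t. 0 \<le> t \<Longrightarrow> dist (flat_line f 0 (\<sigma> *\<^sub>R vtx m) t) (flat_line f 0 (\<sigma> *\<^sub>R vtx n) t) \<le> C"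
    using eq vertex_eq_iff[OF f f \<sigma> \<sigma> model_flat_closed(1) model_flat_closed(1)] by blast
  have "t * sqrt 2 \<le> C" if t: "0 \<le> t" for t
  proof -
    have "dist (flat_line f 0 (\<sigma> *\<^sub>R vtx m) t) (flat_line f 0 (\<sigma> *\<^sub>R vtx n) t)
        = norm ((t * \<sigma>) *\<^sub>R (vtx m - vtx n))"
      using f by (simp add: flat_line_def dist_flat dist_norm scaleR_diff_right)
    also have "\<dots> = t * sqrt 2" using t \<sigma> norm_vtx_diff[OF mn] by (simp add: abs_mult)
    finally show ?thesis using C[OF t] by simp
  qed
  from this[of "(\<bar>C\<bar> + 1) / sqrt 2"] show False by simp
qed

text \<open>In the flat, the direction of \<open>vertex \<sigma> f l\<close> is the bisector of those of the two given
  vertices. The distance from a ray to \<open>\<xi>\<close> to this bisecting ray is \<open>O(sqrt T)\<close> by the CN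
  inequality, hence bounded by convexity.\<close>

lemma adjacent_two_unique:
  assumes f: "f \<in> \<F>" and \<sigma>: "\<bar>\<sigma>\<bar> = 1" and l: "l \<noteq> m" "l \<noteq> n" "m \<noteq> n"
    and adj: "adjacent \<sigma> \<xi> (vertex (- \<sigma>) f m)" "adjacent \<sigma> \<xi> (vertex (- \<sigma>) f n)"
  shows "\<xi> = vertex \<sigma> f l"
proof -
  obtain g a b where g: "g \<in> \<F>" "a \<noteq> b" "\<xi> = vertex \<sigma> g a" "vertex (- \<sigma>) f m = vertex (- \<sigma>) g b"
    using adj(1) unfolding adjacent_def by blast
  obtain g' a' b' where g': "g' \<in> \<F>" "a' \<noteq> b'" "\<xi> = vertex \<sigma> g' a'"
      "vertex (- \<sigma>) f n = vertex (- \<sigma>) g' b'"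
    using adj(2) unfolding adjacent_def by blast
  have \<sigma>': "\<bar>- \<sigma>\<bar> = 1" using \<sigma> by simp
  note zero = model_flat_closed(1)
  obtain C1 where C1: "\<And>t. 0 \<le> t \<Longrightarrow> dist (flat_line f 0 (- \<sigma> *\<^sub>R vtx m) t) (flat_line g 0 (- \<sigma> *\<^sub>R vtx b) t) \<le> C1"
    using g(4) unfolding vertex_eq_iff[OF f g(1) \<sigma>' \<sigma>' zero zero] by blast
  obtain C2 where C2: "\<And>t. 0 \<le> t \<Longrightarrow> dist (flat_line f 0 (- \<sigma> *\<^sub>R vtx n) t) (flat_line g' 0 (- \<sigma> *\<^sub>R vtx b') t) \<le> C2"
    using g'(4) unfolding vertex_eq_iff[OF f g'(1) \<sigma>' \<sigma>' zero zero] by blast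
  have "vertex \<sigma> g a = vertex \<sigma> g' a'" using g(3) g'(3) by simp
  then obtain C3 where C3: "\<And>t. 0 \<le> t \<Longrightarrow> dist (flat_line g 0 (\<sigma> *\<^sub>R vtx a) t) (flat_line g' 0 (\<sigma> *\<^sub>R vtx a') t) \<le> C3"
    unfolding vertex_eq_iff[OF g(1) g'(1) \<sigma> \<sigma> zero zero] by blast
  have Cpos: "0 \<le> C1" "0 \<le> C2" "0 \<le> C3"
    using C1[of 0] C2[of 0] C3[of 0] order_trans[OF zero_le_dist] by blast+
  define C where "C = C1 + C2 + C3"
  define R R' where "R = flat_line g 0 (\<sigma> *\<^sub>R vtx a)" and "R' = flat_line f 0 (\<sigma> *\<^sub>R vtx l)"
  have across: "dist (flat_line h 0 (\<sigma> *\<^sub>R vtx c) T) (flat_line h 0 (- \<sigma> *\<^sub>R vtx d) (2 * T)) = T * sqrt 2"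
    if h: "h \<in> \<F>" and cd: "c \<noteq> d" and T: "0 \<le> T" for h c d T
  proof -
    have "dist (flat_line h 0 (\<sigma> *\<^sub>R vtx c) T) (flat_line h 0 (- \<sigma> *\<^sub>R vtx d) (2 * T))
        = norm ((T * \<sigma>) *\<^sub>R (vtx c + 2 *\<^sub>R vtx d))"
      using h by (simp add: flat_line_def dist_flat dist_norm algebra_simps)
    also have "\<dots> = T * sqrt 2" using T \<sigma> norm_vtx_add_twice[OF cd] by (simp add: abs_mult)
    finally show ?thesis .
  qed
  \<comment> \<open>Both \<open>?P\<close> and \<open>?Q\<close> are within
    \<open>T * sqrt 2 + C\<close> of \<open>R T\<close>, and they are \<open>2 * T * sqrt 2\<close>
    apart; so \<open>R T\<close> is nearly their midpoint. The parameter \<open>2 * T\<close> makes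
    this midpoint equal to \<open>R' T\<close>.\<close>
  have bound: "(dist (R T) (R' T))\<^sup>2 \<le> 2 * sqrt 2 * T * C + C\<^sup>2" if T: "0 \<le> T" for T
  proof -
    let ?P = "flat_line f 0 (- \<sigma> *\<^sub>R vtx m) (2 * T)" and ?Q = "flat_line f 0 (- \<sigma> *\<^sub>R vtx n) (2 * T)"
    have "dist (R T) ?P \<le> T * sqrt 2 + C1"
      using dist_triangle[of "R T" ?P "flat_line g 0 (- \<sigma> *\<^sub>R vtx b) (2 * T)"]
        across[OF g(1,2) T] C1[of "2 * T"] T by (simp add: R_def dist_commute)
    then have P: "dist (R T) ?P \<le> T * sqrt 2 + C" using Cpos by (simp add: C_def)
    have "dist (R T) ?Q \<le> C3 + (T * sqrt 2 + C2)"
      using dist_triangle[of "R T" ?Q "flat_line g' 0 (\<sigma> *\<^sub>R vtx a') T"] C3[OF T]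
        dist_triangle[of "flat_line g' 0 (\<sigma> *\<^sub>R vtx a') T" ?Q "flat_line g' 0 (- \<sigma> *\<^sub>R vtx b') (2 * T)"]
        across[OF g'(1,2) T] C2[of "2 * T"] T by (simp add: R_def dist_commute)
    then have Q: "dist (R T) ?Q \<le> T * sqrt 2 + C" using Cpos by (simp add: C_def)
    have "dist ?P ?Q = norm ((2 * T * \<sigma>) *\<^sub>R (vtx n - vtx m))"
      using f by (simp add: flat_line_def dist_flat dist_norm algebra_simps)
    also have "\<dots> = 2 * T * sqrt 2" using T \<sigma> norm_vtx_diff[of n m] l by (simp add: abs_mult)
    finally have PQ: "(dist ?P ?Q)\<^sup>2 = 8 * T\<^sup>2" by (simp add: power_mult_distrib)
    have "- ((2 * T) *\<^sub>R \<sigma> *\<^sub>R vtx m) + (1/2) *\<^sub>R (- ((2 * T) *\<^sub>R \<sigma> *\<^sub>R vtx n) - - ((2 * T) *\<^sub>R \<sigma> *\<^sub>R vtx m))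
        = T *\<^sub>R \<sigma> *\<^sub>R vtx l"
      unfolding vtx_sum[OF l] by (simp add: vec_eq_iff algebra_simps)
    then have "(dist (R T) (R' T))\<^sup>2 \<le> (dist (R T) ?P)\<^sup>2 / 2 + (dist (R T) ?Q)\<^sup>2 / 2 - (dist ?P ?Q)\<^sup>2 / 4"
      using cn_inequality[OF geodesic_flat[OF f, of "- ((2 * T) *\<^sub>R \<sigma> *\<^sub>R vtx m)" "- ((2 * T) *\<^sub>R \<sigma> *\<^sub>R vtx n)"],
          of "1/2" "R T"]
      by (simp add: flat_line_def R'_def del: scaleR_scaleR)
    also have "\<dots> \<le> (T * sqrt 2 + C)\<^sup>2 / 2 + (T * sqrt 2 + C)\<^sup>2 / 2 - 2 * T\<^sup>2"
      using power_mono[OF P zero_le_dist, of 2] power_mono[OF Q zero_le_dist, of 2] PQ by linarith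
    also have "\<dots> = 2 * sqrt 2 * T * C + C\<^sup>2"
      by (simp add: power2_sum power_mult_distrib)
    finally show ?thesis .
  qed
  have rays: "speed_ray (norm (\<sigma> *\<^sub>R vtx a)) R" "speed_ray (norm (\<sigma> *\<^sub>R vtx l)) R'"
    unfolding R_def R'_def using f g by (intro speed_ray_flat_line; simp)+
  have "((\<lambda>T. dist (R T) (R' T) / T) \<longlongrightarrow> 0) at_top"
  proof (rule tendsto_sandwich[OF _ _ tendsto_const])
    show "((\<lambda>T. sqrt ((2 * (2 * sqrt 2 * C + C\<^sup>2)) / (2 * T))) \<longlongrightarrow> 0) at_top"
      by (rule tendsto_eq_rhs[OF tendsto_real_sqrt[OF tendsto_const_over]]) simp
    show "eventually (\<lambda>T. 0 \<le> dist (R T) (R' T) / T) at_top"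
      using eventually_gt_at_top[of 0] by eventually_elim simp
    show "eventually (\<lambda>T. dist (R T) (R' T) / T \<le> sqrt ((2 * (2 * sqrt 2 * C + C\<^sup>2)) / (2 * T))) at_top"
      using eventually_gt_at_top[of 1]
    proof eventually_elim
      case (elim T)
      have "C\<^sup>2 \<le> T * C\<^sup>2" using elim mult_right_mono[of 1 T "C\<^sup>2"] by simp
      then have "(dist (R T) (R' T))\<^sup>2 \<le> T * (2 * sqrt 2 * C + C\<^sup>2)"
        using bound[of T] elim by (simp add: algebra_simps)
      then have "(dist (R T) (R' T))\<^sup>2 / T\<^sup>2 \<le> T * (2 * sqrt 2 * C + C\<^sup>2) / T\<^sup>2"
        by (rule divide_right_mono) simp
      also have "T * K / T\<^sup>2 = (2 * K) / (2 * T)" for K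
        using elim by (simp add: power2_eq_square)
      finally show ?case by (intro real_le_rsqrt) (simp add: power_divide)
    qed
  qed
  then have "dist (R t) (R' t) \<le> dist (R 0) (R' 0)" if "0 \<le> t" for t
    using sublinear_rays_bounded[OF rays _ that] by blast
  then have "vertex \<sigma> g a = vertex \<sigma> f l"
    unfolding vertex_eq_iff[OF g(1) f \<sigma> \<sigma> zero zero] R_def R'_def by blast
  then show ?thesis using g by simp
qed


section \<open>Horofunctions\<close>

text \<open>The representing ray is run at the speed of \<open>vtx m\<close>, so that no normalising factor appears
  in the lemma \<open>horo_flat\<close> below.\<close>

definition horo :: "'a ideal_point \<Rightarrow> 'a \<Rightarrow> 'a \<Rightarrow> real" where
  "horo \<xi> = busemann (\<lambda>t. (SOME r. r \<in> \<xi>) (sqrt (2/3) * t))"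

lemma speed_ray_vertex:
  assumes "f \<in> \<F>" "a \<in> model_flat" "\<bar>\<sigma>\<bar> = 1"
  shows "speed_ray (sqrt (2/3)) (flat_line f a (\<sigma> *\<^sub>R vtx m))"
  using speed_ray_flat_line[of f a "\<sigma> *\<^sub>R vtx m"] assms norm_vertex_direction[OF assms(3)] by simp

text \<open>Asymptotic rays have equal Busemann functions, so \<open>horo\<close> of a vertex can be
  computed along its ray in any flat and from any base point.\<close>

lemma horo_vertex:
  assumes f: "f \<in> \<F>" "a \<in> model_flat" "\<bar>\<sigma>\<bar> = 1"
  shows "horo (vertex \<sigma> f m) x y = busemann (flat_line f a (\<sigma> *\<^sub>R vtx m)) x y"
proof -
  define k where "k = sqrt (2/3::real)"
  have k: "0 < k" "norm (\<sigma> *\<^sub>R vtx m) = k" using norm_vertex_direction[OF f(3)] by (simp_all add: k_def)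
  define r where "r = (SOME r. r \<in> vertex \<sigma> f m)"
  let ?s = "flat_ray f a (\<sigma> *\<^sub>R vtx m)"
  have "geodesic_ray ?s" using f by (intro geodesic_ray_flat_ray) auto
  then have "?s \<in> vertex \<sigma> f m"
    unfolding vertex_base[OF f, symmetric] endpoint_def by (simp add: asymptotic_refl)
  then have "r \<in> vertex \<sigma> f m" unfolding r_def by (rule someI[of "\<lambda>r. r \<in> vertex \<sigma> f m"])
  then have "(?s, r) \<in> asymptotic"
    unfolding vertex_base[OF f, symmetric] endpoint_def by simp
  then obtain C where r: "geodesic_ray r" and C: "\<And>t. 0 \<le> t \<Longrightarrow> dist (?s t) (r t) \<le> C"
    by (auto simp: asymptotic_def)
  have "speed_ray k (\<lambda>t. r (k * t))"
    using r k by (auto simp: speed_ray_def geodesic_ray_def right_diff_distrib[symmetric] abs_mult)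
  moreover have "dist (r (k * t)) (flat_line f a (\<sigma> *\<^sub>R vtx m) t) \<le> C" if "0 \<le> t" for t
    using C[of "k * t"] k that by (simp add: flat_ray_eq_flat_line dist_commute)
  ultimately have "busemann (\<lambda>t. r (k * t)) x y = busemann (flat_line f a (\<sigma> *\<^sub>R vtx m)) x y"
    using speed_ray_vertex[OF f] by (intro busemann_asymptotic)
  then show ?thesis by (simp add: horo_def r_def k_def)
qed

lemma horo_trans:
  assumes "\<xi> \<in> vertices \<sigma>" "\<bar>\<sigma>\<bar> = 1"
  shows "horo \<xi> x z = horo \<xi> x y + horo \<xi> y z"
proof -
  obtain f m where f: "f \<in> \<F>" "\<xi> = vertex \<sigma> f m" using assms by (auto simp: vertices_def)
  show ?thesis unfolding f(2) horo_vertex[OF f(1) model_flat_closed(1) assms(2)]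
    by (rule busemann_trans[OF speed_ray_vertex[OF f(1) model_flat_closed(1) assms(2)]])
qed

lemma horo_antisym:
  assumes "\<xi> \<in> vertices \<sigma>" "\<bar>\<sigma>\<bar> = 1"
  shows "horo \<xi> y x = - horo \<xi> x y"
proof -
  have "horo \<xi> x x = horo \<xi> x x + horo \<xi> x x" by (rule horo_trans[OF assms])
  moreover have "horo \<xi> x x = horo \<xi> x y + horo \<xi> y x" by (rule horo_trans[OF assms])
  ultimately show ?thesis by simp
qed

lemma horo_flat:
  assumes "f \<in> \<F>" "l \<in> model_flat" "k \<in> model_flat" "\<bar>\<sigma>\<bar> = 1"
  shows "horo (vertex \<sigma> f m) (f l) (f k) = - \<sigma> * (l - k) $ m"
  using assms by (simp add: horo_vertex[of f 0] busemann_flat inner_vtx)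

text \<open>Subadditivity for a direction and its negative: their sum is the zero direction, whose
  Busemann function vanishes.\<close>

lemma horo_opposite_nonneg:
  assumes f: "f \<in> \<F>" and y: "y \<in> f ` model_flat" and \<sigma>: "\<bar>\<sigma>\<bar> = 1"
  shows "0 \<le> horo (vertex \<sigma> f m) x y + horo (vertex (- \<sigma>) f m) x y"
proof -
  obtain a where a: "a \<in> model_flat" "y = f a" using y by blast
  have "busemann (flat_line f a (\<sigma> *\<^sub>R vtx m + - \<sigma> *\<^sub>R vtx m)) x (f a)
    \<le> busemann (flat_line f a (\<sigma> *\<^sub>R vtx m)) x (f a) + busemann (flat_line f a (- \<sigma> *\<^sub>R vtx m)) x (f a)"
    using a f by (intro busemann_subadditive) auto
  then show ?thesis
    using a horo_vertex[OF f a(1) \<sigma>] horo_vertex[OF f a(1), of "- \<sigma>"] \<sigma> by (simp add: busemann_zero)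
qed

text \<open>Both \<open>y\<close> and \<open>z\<close> minimise the same sum, by
  \<open>horo_opposite_nonneg\<close> in either flat. So the base point can be moved between flats
  that share an opposite pair.\<close>

lemma horo_opposite_base:
  assumes f: "f \<in> \<F>" "y \<in> f ` model_flat" and g: "g \<in> \<F>" "z \<in> g ` model_flat" and \<sigma>: "\<bar>\<sigma>\<bar> = 1"
    and eq: "vertex \<sigma> f m = vertex \<sigma> g n" "vertex (- \<sigma>) f m = vertex (- \<sigma>) g n"
  shows "horo (vertex \<sigma> f m) x y + horo (vertex (- \<sigma>) f m) x y
    = horo (vertex \<sigma> f m) x z + horo (vertex (- \<sigma>) f m) x z"
proof -
  let ?p = "vertex \<sigma> f m" and ?q = "vertex (- \<sigma>) f m"
  have \<sigma>': "\<bar>- \<sigma>\<bar> = 1" using \<sigma> by simp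
  note p = vertex_in_vertices[OF f(1), of \<sigma> m] and q = vertex_in_vertices[OF f(1), of "- \<sigma>" m]
  have "0 \<le> horo ?p z y + horo ?q z y" by (rule horo_opposite_nonneg[OF f \<sigma>])
  moreover have "0 \<le> horo ?p y z + horo ?q y z" unfolding eq by (rule horo_opposite_nonneg[OF g \<sigma>])
  ultimately have "horo ?p z y + horo ?q z y = 0"
    using horo_antisym[OF p \<sigma>, of z y] horo_antisym[OF q \<sigma>', of z y] by linarith
  then show ?thesis using horo_trans[OF p \<sigma>, of x y z] horo_trans[OF q \<sigma>', of x y z] by linarith
qed

lemma mem_flat_iff_horo:
  assumes g: "g \<in> \<F>" "y \<in> g ` model_flat" and h: "h \<in> \<F>" "x \<in> h ` model_flat"
    and \<sigma>: "\<bar>\<sigma>\<bar> = 1" and mn: "m \<noteq> n"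
  shows "x \<in> g ` model_flat \<longleftrightarrow>
    horo (vertex \<sigma> g m) x y + horo (vertex (- \<sigma>) g m) x y = 0 \<and>
    horo (vertex \<sigma> g n) x y + horo (vertex (- \<sigma>) g n) x y = 0" (is "?L \<longleftrightarrow> ?R")
proof
  assume ?L
  then show ?R using g \<sigma> by (auto simp: horo_flat)
next
  assume R: ?R
  obtain c where c: "c \<in> model_flat" "y = g c" using g by blast
  have one: "\<bar>1::real\<bar> = 1" "\<bar>- 1::real\<bar> = 1" by simp_all
  \<comment> \<open>Each sum is unchanged when \<sigma> is replaced by - \<sigma>, so the sign can
    be taken to be 1.\<close>
  have R: "horo (vertex 1 g m) x y + horo (vertex (- 1) g m) x y = 0"
    "horo (vertex 1 g n) x y + horo (vertex (- 1) g n) x y = 0"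
    using R \<sigma> by (auto simp: abs_if split: if_splits)
  define B1 B2 where "B1 = horo (vertex 1 g m) x y" and "B2 = horo (vertex 1 g n) x y"
  \<comment> \<open>The vector of \<open>model_flat\<close> with \<open>m\<close>-th coordinate
    \<open>- B1\<close> and \<open>n\<close>-th coordinate \<open>- B2\<close>, written as in
    \<open>model_flat_decompose\<close>. It makes \<open>g \<alpha>\<close> the point of the flat
    with the same two horofunction values as \<open>x\<close>.\<close>
  define d where "d = - ((2 * B1 + B2) *\<^sub>R vtx m + (B1 + 2 * B2) *\<^sub>R vtx n)"
  have d: "d \<in> model_flat" "d $ m = - B1" "d $ n = - B2"
    using mn by (auto simp: d_def vtx_nth field_simps)
  define \<alpha> where "\<alpha> = c + d"
  have \<alpha>: "\<alpha> \<in> model_flat" using c d by (simp add: \<alpha>_def)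
  let ?B = "\<lambda>v. busemann (flat_line g \<alpha> v) x (g \<alpha>)"
  have B: "?B (\<sigma> *\<^sub>R vtx i) = horo (vertex \<sigma> g i) x y + \<sigma> * d $ i" if "\<bar>\<sigma>\<bar> = 1" for \<sigma> i
    using horo_trans[OF vertex_in_vertices[OF g(1)] that, of i x "g \<alpha>" y] horo_flat[OF g(1) c(1) \<alpha> that, of i]
    unfolding horo_vertex[OF g(1) \<alpha> that, of i x "g \<alpha>", symmetric] by (simp add: c \<alpha>_def)
  have z: "?B (vtx m) = 0" "?B (- vtx m) = 0" "?B (vtx n) = 0" "?B (- vtx n) = 0"
    using B[OF one(1), of m] B[OF one(2), of m] B[OF one(1), of n] B[OF one(2), of n] R d
    by (simp_all add: B1_def B2_def)
  have sub: "?B (u + v) \<le> ?B u + ?B v" if "u \<in> model_flat" "v \<in> model_flat" for u v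
    using busemann_subadditive[OF g(1) \<alpha> that] .
  \<comment> \<open>The vanishing passes to the root direction: both values are nonpositive and
    their sum is nonnegative.\<close>
  have "?B (vtx m - vtx n) \<le> 0" using sub[of "vtx m" "- vtx n"] z by simp
  moreover have "?B (- (vtx m - vtx n)) \<le> 0" using sub[of "- vtx m" "vtx n"] z by (simp add: add.commute)
  moreover have "0 \<le> ?B (vtx m - vtx n) + ?B (- (vtx m - vtx n))"
    using sub[of "vtx m - vtx n" "- (vtx m - vtx n)"] by (simp add: busemann_zero)
  ultimately have "?B (vtx m - vtx n) = 0" "?B (- (vtx m - vtx n)) = 0" by linarith+
  then have "x = g \<alpha>" using horocycle_point_unique[OF h g(1) \<alpha> mn] z by blast
  then show ?L using \<alpha> by simp
qed

section \<open>Flats determined by their vertices of one type\<close>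

text \<open>The vertex opposite to the \<open>m\<close>-th one is joined to the two remaining
  vertices of type \<sigma>, and \<open>adjacent_two_unique\<close> leaves only one such
  vertex.\<close>

lemma opposite_vertex_eq:
  assumes f: "f \<in> \<F>" and g: "g \<in> \<F>" and \<sigma>: "\<bar>\<sigma>\<bar> = 1"
    and eq: "\<And>n. n \<noteq> m \<Longrightarrow> vertex \<sigma> g n = vertex \<sigma> f n"
  shows "vertex (- \<sigma>) g m = vertex (- \<sigma>) f m"
proof -
  obtain n where n: "n \<noteq> m" using third_index by metis
  obtain l where l: "l \<noteq> m" "l \<noteq> n" by (rule third_index)
  have adj: "adjacent (- \<sigma>) (vertex (- \<sigma>) g m) (vertex \<sigma> f i)" if "i \<noteq> m" for i
    using adjacent_vertex[OF g, of m i "- \<sigma>"] eq[OF that] that by simp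
  show ?thesis
    using adjacent_two_unique[OF f, of "- \<sigma>" m n l "vertex (- \<sigma>) g m"] \<sigma> n l adj[OF n] adj[OF l(1)]
    by simp
qed

text \<open>The opposite vertices agree as well, so the criterion \<open>mem_flat_iff_horo\<close>
  concerns the same opposite pairs in both flats, and \<open>horo_opposite_base\<close> moves its
  base point from one flat to the other.\<close>

lemma flat_unique:
  assumes f: "f \<in> \<F>" and g: "g \<in> \<F>" and \<sigma>: "\<bar>\<sigma>\<bar> = 1"
    and eq: "\<And>n. vertex \<sigma> g n = vertex \<sigma> f n"
  shows "g ` model_flat = f ` model_flat"
proof -
  have sub: "g ` model_flat \<subseteq> f ` model_flat"
    if f: "f \<in> \<F>" and g: "g \<in> \<F>" and eq: "\<And>n. vertex \<sigma> g n = vertex \<sigma> f n" for f g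
  proof
    fix x assume x: "x \<in> g ` model_flat"
    have y: "f 0 \<in> f ` model_flat" by simp
    have eq': "vertex (- \<sigma>) g n = vertex (- \<sigma>) f n" for n
      by (rule opposite_vertex_eq[OF f g \<sigma> eq])
    have 12: "(1::3) \<noteq> 2" by simp
    have "horo (vertex \<sigma> f m) x (f 0) + horo (vertex (- \<sigma>) f m) x (f 0) = 0" for m
      using horo_opposite_base[OF f y g x \<sigma>, of m m x] eq eq' mem_flat_iff_horo[OF g x g x \<sigma> 12]
        x mem_flat_iff_horo[OF g x g x \<sigma>, of m] third_index[of m m]
      by metis
    then show "x \<in> f ` model_flat" using mem_flat_iff_horo[OF f y g x \<sigma> 12] by blast
  qed
  show ?thesis using sub[OF f g eq] sub[OF g f] eq by (metis subset_antisym)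
qed

lemma flat_marking_vertices:
  assumes G: "G \<in> flats \<F>" and \<sigma>: "\<bar>\<sigma>\<bar> = 1" and q: "inj q"
    and mem: "\<And>m. q m \<in> vertices \<sigma>" "\<And>m. q m \<in> ideal_boundary G"
  obtains g where "g \<in> \<F>" "g ` model_flat = G" "\<And>m. vertex \<sigma> g m = q m"
proof -
  obtain f where f: "f \<in> \<F>" "G = f ` model_flat" using G by (auto simp: flats_def)
  have "\<exists>n. q m = vertex \<sigma> f n" for m
    using ideal_boundary_vertex[OF f(1) order_refl \<sigma> mem(1)] mem(2) f(2) by metis
  then obtain \<pi> where \<pi>: "\<And>m. q m = vertex \<sigma> f (\<pi> m)" by metis
  have "inj \<pi>" using q \<pi> by (metis injD injI)
  then obtain g where "g \<in> \<F>" "g ` model_flat = f ` model_flat" "\<And>\<sigma> m. vertex \<sigma> g m = vertex \<sigma> f (\<pi> m)"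
    using vertex_remark[OF f(1)] by metis
  with that \<pi> f show ?thesis by simp
qed

lemma vertex_cone_in_flat:
  assumes f: "f \<in> \<F>" "\<mu> \<in> model_flat" and h: "h \<in> \<F>" "f \<mu> \<in> h ` model_flat" and \<sigma>: "\<bar>\<sigma>\<bar> = 1"
    and eq: "vertex \<sigma> f m = vertex \<sigma> h m'" "vertex \<sigma> f n = vertex \<sigma> h n'" and st: "0 \<le> s" "0 \<le> t"
  shows "f (\<mu> + s *\<^sub>R (\<sigma> *\<^sub>R vtx m) + t *\<^sub>R (\<sigma> *\<^sub>R vtx n)) \<in> h ` model_flat"
proof -
  obtain \<nu> where \<nu>: "\<nu> \<in> model_flat" "f \<mu> = h \<nu>" using h by blast
  have nz: "\<sigma> *\<^sub>R vtx i \<in> model_flat" "\<sigma> *\<^sub>R vtx i \<noteq> 0" for i using \<sigma> by auto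
  have ray: "f (\<mu> + r *\<^sub>R (\<sigma> *\<^sub>R vtx i)) = h (\<nu> + r *\<^sub>R (\<sigma> *\<^sub>R vtx i'))"
    if "vertex \<sigma> f i = vertex \<sigma> h i'" "0 \<le> r" for r i i'
    using flat_rays_same_origin[OF f nz h(1) \<nu>(1) nz _ \<nu>(2) that(2), of i i'] that(1) \<sigma>
    by (simp add: vertex_base f h \<nu> norm_vtx)
  \<comment> \<open>A point of the cone is the midpoint of points at doubled parameters on the two
    bounding rays, and these rays are common to both flats.\<close>
  have mid: "x + s *\<^sub>R u + t *\<^sub>R v = x + (2 * s) *\<^sub>R u + (1/2) *\<^sub>R (x + (2 * t) *\<^sub>R v - (x + (2 * s) *\<^sub>R u))"
    for x u v :: "real^3" by (simp add: vec_eq_iff algebra_simps)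
  have "f (\<mu> + s *\<^sub>R (\<sigma> *\<^sub>R vtx m) + t *\<^sub>R (\<sigma> *\<^sub>R vtx n)) = h (\<nu> + s *\<^sub>R (\<sigma> *\<^sub>R vtx m') + t *\<^sub>R (\<sigma> *\<^sub>R vtx n'))"
    unfolding mid by (rule flat_segments_eq) (use f h \<nu> nz ray[OF eq(1)] ray[OF eq(2)] st in auto)
  then show ?thesis using \<nu> nz by simp
qed

text \<open>The markings in \<open>sector\<close> are arbitrary, but apex and endpoints fix the
  bounding rays and hence the cone, which can therefore be computed in \<open>f\<close>. The index
  \<open>k\<close> is the one missing from the two rays.\<close>

lemma sector_eq:
  assumes f: "f \<in> \<F>" "\<mu> \<in> model_flat" and \<sigma>: "\<bar>\<sigma>\<bar> = 1" and kmn: "m \<noteq> n" "k \<noteq> m" "k \<noteq> n"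
  shows "sector \<F> (f ` model_flat) (f \<mu>) (vertex \<sigma> f m) (vertex \<sigma> f n)
    = f ` {l \<in> model_flat. \<forall>i. \<sigma> * (l - \<mu>) $ k \<le> \<sigma> * (l - \<mu>) $ i}" (is "?S = ?T")
proof (intro subset_antisym subsetI)
  have nz: "\<sigma> *\<^sub>R vtx i \<in> model_flat" "\<sigma> *\<^sub>R vtx i \<noteq> 0" for i using \<sigma> by auto
  fix x assume "x \<in> ?S"
  then obtain g a u v s t where g: "g \<in> \<F>" "g ` model_flat = f ` model_flat" "a \<in> model_flat" "g a = f \<mu>"
    and u: "u \<in> model_flat" "u \<noteq> 0" "endpoint (flat_ray g a u) = vertex \<sigma> f m"
    and v: "v \<in> model_flat" "v \<noteq> 0" "endpoint (flat_ray g a v) = vertex \<sigma> f n"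
    and st: "0 \<le> s" "0 \<le> t" and x: "x = g (a + s *\<^sub>R u + t *\<^sub>R v)"
    unfolding sector_def by blast
  \<comment> \<open>The parameters along the rays of \<open>f\<close>, rescaled because
    \<open>u\<close> and \<open>v\<close> may have any length.\<close>
  define c d where "c = s * (norm u / sqrt (2/3))" and "d = t * (norm v / sqrt (2/3))"
  have cd: "0 \<le> c" "0 \<le> d" using st by (simp_all add: c_def d_def)
  have mid: "x + s *\<^sub>R u + t *\<^sub>R v = x + (2 * s) *\<^sub>R u + (1/2) *\<^sub>R (x + (2 * t) *\<^sub>R v - (x + (2 * s) *\<^sub>R u))"
    for x u v :: "real^3" and s t by (simp add: vec_eq_iff algebra_simps)
  have "g (a + (2 * s) *\<^sub>R u) = f (\<mu> + (2 * s * (norm u / norm (\<sigma> *\<^sub>R vtx m))) *\<^sub>R (\<sigma> *\<^sub>R vtx m))"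
    by (rule flat_rays_same_origin[OF g(1,3) u(1,2) f nz _ g(4)])
      (use u(3) st vertex_base[OF f \<sigma>] in simp_all)
  also have "2 * s * (norm u / norm (\<sigma> *\<^sub>R vtx m)) = 2 * c"
    unfolding norm_vertex_direction[OF \<sigma>] c_def by (rule mult.assoc)
  finally have su: "g (a + (2 * s) *\<^sub>R u) = f (\<mu> + (2 * c) *\<^sub>R (\<sigma> *\<^sub>R vtx m))" .
  have "g (a + (2 * t) *\<^sub>R v) = f (\<mu> + (2 * t * (norm v / norm (\<sigma> *\<^sub>R vtx n))) *\<^sub>R (\<sigma> *\<^sub>R vtx n))"
    by (rule flat_rays_same_origin[OF g(1,3) v(1,2) f nz _ g(4)])
      (use v(3) st vertex_base[OF f \<sigma>] in simp_all)
  also have "2 * t * (norm v / norm (\<sigma> *\<^sub>R vtx n)) = 2 * d"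
    unfolding norm_vertex_direction[OF \<sigma>] d_def by (rule mult.assoc)
  finally have tv: "g (a + (2 * t) *\<^sub>R v) = f (\<mu> + (2 * d) *\<^sub>R (\<sigma> *\<^sub>R vtx n))" .
  have "x = f (\<mu> + c *\<^sub>R (\<sigma> *\<^sub>R vtx m) + d *\<^sub>R (\<sigma> *\<^sub>R vtx n))"
    unfolding x mid[of a s u t v] mid[of \<mu> c "\<sigma> *\<^sub>R vtx m" d "\<sigma> *\<^sub>R vtx n"]
    by (rule flat_segments_eq[OF g(1) _ _ f(1) _ _ su tv]) (use f g u v nz in auto)
  moreover have "\<mu> + c *\<^sub>R (\<sigma> *\<^sub>R vtx m) + d *\<^sub>R (\<sigma> *\<^sub>R vtx n) \<in> model_flat" using f nz by simp
  moreover have "\<sigma> * (c *\<^sub>R (\<sigma> *\<^sub>R vtx m) + d *\<^sub>R (\<sigma> *\<^sub>R vtx n)) $ k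
      \<le> \<sigma> * (c *\<^sub>R (\<sigma> *\<^sub>R vtx m) + d *\<^sub>R (\<sigma> *\<^sub>R vtx n)) $ i" for i
  proof -
    have "\<sigma> * \<sigma> = 1" using \<sigma> by (auto simp: abs_if split: if_splits)
    moreover have assoc: "\<sigma> * (c * \<sigma> * p + d * \<sigma> * q) = (\<sigma> * \<sigma>) * (c * p + d * q)" for p q
      by (simp add: algebra_simps)
    ultimately have coord: "\<sigma> * (c *\<^sub>R (\<sigma> *\<^sub>R vtx m) + d *\<^sub>R (\<sigma> *\<^sub>R vtx n)) $ i = c * vtx m $ i + d * vtx n $ i" for i
      using assoc[of "vtx m $ i" "vtx n $ i" for i] by simp
    show ?thesis unfolding coord using kmn cd by (auto simp: vtx_nth)
  qed
  then have "\<sigma> * (\<mu> + c *\<^sub>R (\<sigma> *\<^sub>R vtx m) + d *\<^sub>R (\<sigma> *\<^sub>R vtx n) - \<mu>) $ k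
      \<le> \<sigma> * (\<mu> + c *\<^sub>R (\<sigma> *\<^sub>R vtx m) + d *\<^sub>R (\<sigma> *\<^sub>R vtx n) - \<mu>) $ i" for i
    by (simp add: add.assoc)
  ultimately show "x \<in> ?T" by blast
next
  have nz: "\<sigma> *\<^sub>R vtx i \<in> model_flat" "\<sigma> *\<^sub>R vtx i \<noteq> 0" for i using \<sigma> by auto
  fix x assume "x \<in> ?T"
  then obtain l where l: "l \<in> model_flat" "x = f l" "\<And>i. \<sigma> * (l - \<mu>) $ k \<le> \<sigma> * (l - \<mu>) $ i" by blast
  obtain s t where st: "0 \<le> s" "0 \<le> t" and l_eq: "l = \<mu> + s *\<^sub>R (\<sigma> *\<^sub>R vtx m) + t *\<^sub>R (\<sigma> *\<^sub>R vtx n)"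
    using cone_decompose[OF l(1) f(2) kmn \<sigma> l(3)] by metis
  have "x = f (\<mu> + s *\<^sub>R (\<sigma> *\<^sub>R vtx m) + t *\<^sub>R (\<sigma> *\<^sub>R vtx n))" using l(2) l_eq by simp
  then show "x \<in> ?S"
    unfolding sector_def using f nz st vertex_base[OF f \<sigma>] by blast
qed

end


lemma model_flat_sum:
  assumes "l \<in> model_flat" "m \<noteq> n" "k \<noteq> m" "k \<noteq> n"
  shows "l $ m + l $ n + l $ k = 0"
  using assms exhaust_3[of k] exhaust_3[of m] exhaust_3[of n] by (auto simp: model_flat_def)

lemma cls_type_lines: "cls (\<epsilon> 1 + \<epsilon> 2) = - 1 *\<^sub>R vtx 3"
  by (simp add: vec_eq_iff forall_3 vtx_nth cls_def \<epsilon>_def axis_def)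

lemma real_all_nonneg_slope:
  fixes b c :: real
  assumes "\<And>t. 0 \<le> t \<Longrightarrow> 0 < b + t * c"
  shows "0 \<le> c"
proof (rule ccontr)
  assume "\<not> 0 \<le> c"
  then have "b + (\<bar>b\<bar> / - c) * c \<le> 0" "0 \<le> \<bar>b\<bar> / - c"
    by (simp, intro divide_nonneg_pos) simp_all
  with assms[of "\<bar>b\<bar> / - c"] show False by simp
qed

lemma min_index_3:
  fixes g :: "3 \<Rightarrow> real"
  obtains m where "\<And>l. g m \<le> g l"
proof -
  have "Min (range g) \<in> range g" by (intro Min_in) auto
  then obtain m where "Min (range g) = g m" by (rule rangeE)
  then have "g m \<le> g l" for l using Min_le[of "range g" "g l"] by simp
  then show ?thesis using that by blast
qed

context A2_flats
begin

section \<open>Incidence\<close>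

lemma ideal_points_of_type_vtx:
  assumes \<sigma>: "\<bar>\<sigma>\<bar> = 1"
  shows "ideal_points_of_type \<F> (\<sigma> *\<^sub>R vtx m) = vertices \<sigma>"
proof (intro subset_antisym subsetI)
  fix \<xi> assume "\<xi> \<in> ideal_points_of_type \<F> (\<sigma> *\<^sub>R vtx m)"
  then obtain f a w where f: "\<xi> = endpoint (flat_ray f a (w (\<sigma> *\<^sub>R vtx m)))" "f \<in> \<F>" "a \<in> model_flat" "w \<in> Weyl_group"
    unfolding ideal_points_of_type_def by blast
  obtain \<pi> where "\<And>m. w (vtx m) = vtx (\<pi> m)" using Weyl_vtx[OF f(4)] by metis
  then have "\<xi> = vertex \<sigma> f (\<pi> m)"
    using f linear_scale[OF Weyl_linear[OF f(4)]] vertex_base[OF f(2,3) \<sigma>] by simp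
  then show "\<xi> \<in> vertices \<sigma>" using f by (simp add: vertex_in_vertices)
next
  fix \<xi> assume "\<xi> \<in> vertices \<sigma>"
  then obtain f n where f: "f \<in> \<F>" "\<xi> = vertex \<sigma> f n" by (auto simp: vertices_def)
  obtain l where l: "l \<noteq> m" by (rule third_index[of m m])
  obtain l' where l': "l' \<noteq> n" by (rule third_index[of n n])
  obtain \<pi> where \<pi>: "inj \<pi>" "\<pi> m = n" using inj_3_extend[OF l l'] by metis
  obtain w where w: "w \<in> Weyl_group" "\<And>m. w (vtx m) = vtx (\<pi> m)" using Weyl_vtx_exists[OF \<pi>(1)] by metis
  have "\<xi> = endpoint (flat_ray f 0 (w (\<sigma> *\<^sub>R vtx m)))"
    using f w linear_scale[OF Weyl_linear[OF w(1)]] \<pi> by (simp add: vertex_def)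
  then show "\<xi> \<in> ideal_points_of_type \<F> (\<sigma> *\<^sub>R vtx m)"
    unfolding ideal_points_of_type_def using f(1) w(1) model_flat_closed(1) by blast
qed

lemma proj_points_eq: "proj_points \<F> = vertices 1"
  using ideal_points_of_type_vtx[of 1 1] by (simp add: proj_points_def vtx_def)

lemma proj_lines_eq: "proj_lines \<F> = vertices (- 1)"
  using ideal_points_of_type_vtx[of "- 1" 3] unfolding proj_lines_def cls_type_lines by simp

text \<open>The differences of consecutive coordinates are positive along a ray in the open chamber,
  so those of its direction are nonnegative; among the directions \<open>vtx m\<close> and
  \<open>- vtx n\<close> only \<open>vtx 1\<close> and \<open>- vtx 3\<close> qualify.\<close>

lemma sends_chamber_to_iff:
  "sends_chamber_to \<F> f (p, D) \<longleftrightarrow> f \<in> \<F> \<and> p = vertex 1 f 1 \<and> D = vertex (- 1) f 3"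
proof
  assume "sends_chamber_to \<F> f (p, D)"
  then have f: "f \<in> \<F>" and p: "p \<in> vertices 1" "p \<in> ideal_boundary (f ` model_chamber)"
    and D: "D \<in> vertices (- 1)" "D \<in> ideal_boundary (f ` model_chamber)"
    by (auto simp: sends_chamber_to_def proj_points_eq proj_lines_eq)
  have sub: "model_chamber \<subseteq> model_flat" by (auto simp: model_chamber_def)
  have dominant: "(\<sigma> *\<^sub>R vtx m) $ 2 \<le> (\<sigma> *\<^sub>R vtx m) $ 1 \<and> (\<sigma> *\<^sub>R vtx m) $ 3 \<le> (\<sigma> *\<^sub>R vtx m) $ 2"
    if C: "\<And>t. 0 \<le> t \<Longrightarrow> a + t *\<^sub>R (\<sigma> *\<^sub>R vtx m) \<in> model_chamber" for a \<sigma> m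
  proof -
    have "0 \<le> (\<sigma> *\<^sub>R vtx m) $ 1 - (\<sigma> *\<^sub>R vtx m) $ 2"
      using C by (intro real_all_nonneg_slope[of "a $ 1 - a $ 2"]) (simp add: model_chamber_def algebra_simps)
    moreover have "0 \<le> (\<sigma> *\<^sub>R vtx m) $ 2 - (\<sigma> *\<^sub>R vtx m) $ 3"
      using C by (intro real_all_nonneg_slope[of "a $ 2 - a $ 3"]) (simp add: model_chamber_def algebra_simps)
    ultimately show ?thesis by simp
  qed
  have one: "\<bar>1::real\<bar> = 1" "\<bar>- 1::real\<bar> = 1" by simp_all
  obtain a m where m: "p = vertex 1 f m" "\<And>t. 0 \<le> t \<Longrightarrow> a + t *\<^sub>R (1 *\<^sub>R vtx m) \<in> model_chamber"
    using ideal_boundary_vertex[OF f sub one(1) p] by metis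
  have "m = 1" using dominant[OF m(2)] exhaust_3[of m] by (auto simp: vtx_nth)
  moreover obtain b n where n: "D = vertex (- 1) f n" "\<And>t. 0 \<le> t \<Longrightarrow> b + t *\<^sub>R (- 1 *\<^sub>R vtx n) \<in> model_chamber"
    using ideal_boundary_vertex[OF f sub one(2) D] by metis
  have "n = 3" using dominant[OF n(2)] exhaust_3[of n] by (auto simp: vtx_nth)
  ultimately show "f \<in> \<F> \<and> p = vertex 1 f 1 \<and> D = vertex (- 1) f 3" using f m n by simp
next
  assume f: "f \<in> \<F> \<and> p = vertex 1 f 1 \<and> D = vertex (- 1) f 3"
  \<comment> \<open>The vector (1,0,-1) is inside the open chamber, and so are the rays from it in
    the directions \<open>vtx 1\<close> and \<open>- vtx 3\<close>.\<close>
  define a where "a = vtx 1 - vtx 3"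
  have a: "a \<in> model_flat" by (simp add: a_def)
  have "a + t *\<^sub>R (1 *\<^sub>R vtx 1) \<in> model_chamber" "a + t *\<^sub>R (- 1 *\<^sub>R vtx 3) \<in> model_chamber" if "0 \<le> t" for t
    using that by (simp_all add: model_chamber_def a_def vtx_nth)
  then have "vertex 1 f 1 \<in> ideal_boundary (f ` model_chamber)"
    "vertex (- 1) f 3 \<in> ideal_boundary (f ` model_chamber)"
    using f a by (auto intro!: vertex_in_ideal_boundary[of f a])
  then show "sends_chamber_to \<F> f (p, D)"
    using f by (simp add: sends_chamber_to_def proj_points_eq proj_lines_eq vertex_in_vertices)
qed

lemma incident_iff_adjacent: "incident \<F> p D \<longleftrightarrow> adjacent 1 p D"
proof
  assume "incident \<F> p D"
  then obtain f where "f \<in> \<F>" "p = vertex 1 f 1" "D = vertex (- 1) f 3"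
    by (auto simp: incident_def sends_chamber_to_iff)
  then show "adjacent 1 p D" using adjacent_vertex[of f 1 3 1] by simp
next
  assume "adjacent 1 p D"
  then obtain g m n where g: "g \<in> \<F>" "m \<noteq> n" "p = vertex 1 g m" "D = vertex (- 1) g n"
    unfolding adjacent_def by blast
  have 13: "(1::3) \<noteq> 3" by simp
  obtain \<pi> :: "3 \<Rightarrow> 3" where \<pi>: "inj \<pi>" "\<pi> 1 = m" "\<pi> 3 = n" using inj_3_extend[OF 13 g(2)] by metis
  obtain f where "f \<in> \<F>" "\<And>\<sigma> m. vertex \<sigma> f m = vertex \<sigma> g (\<pi> m)" using vertex_remark[OF g(1) \<pi>(1)] by metis
  then show "incident \<F> p D" using g \<pi> by (auto simp: incident_def sends_chamber_to_iff)
qed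

lemma adjacent_vertices:
  assumes "adjacent \<sigma> \<xi> \<eta>"
  shows "\<xi> \<in> vertices \<sigma>" "\<eta> \<in> vertices (- \<sigma>)"
  using assms by (auto simp: adjacent_def vertices_def)

text \<open>In a flat, vertices of different sign and different index are adjacent. So the
  non-incidence of \<open>p'\<close> and \<open>D\<close> gives \<open>D\<close> the index of
  \<open>p'\<close>, and likewise \<open>D'\<close> gets that of \<open>p\<close>.\<close>

lemma opposite_flags_marking:
  assumes G: "G \<in> flats \<F>" and bd: "p \<in> ideal_boundary G" "D \<in> ideal_boundary G"
      "p' \<in> ideal_boundary G" "D' \<in> ideal_boundary G"
    and inc: "adjacent 1 p D" "adjacent 1 p' D'" and opp: "\<not> adjacent 1 p D'" "\<not> adjacent 1 p' D"
    and mn: "m \<noteq> n"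
  obtains g where "g \<in> \<F>" "g ` model_flat = G" "vertex 1 g m = p" "vertex (- 1) g n = D"
    "vertex 1 g n = p'" "vertex (- 1) g m = D'"
proof -
  have one: "\<bar>1::real\<bar> = 1" "\<bar>- 1::real\<bar> = 1" by simp_all
  obtain f where f: "f \<in> \<F>" "G = f ` model_flat" using G by (auto simp: flats_def)
  note bd = bd[unfolded f(2)]
  obtain a where a: "p = vertex 1 f a"
    using ideal_boundary_vertex[OF f(1) order_refl one(1) adjacent_vertices(1)[OF inc(1)] bd(1)] by metis
  obtain b where b: "p' = vertex 1 f b"
    using ideal_boundary_vertex[OF f(1) order_refl one(1) adjacent_vertices(1)[OF inc(2)] bd(3)] by metis
  have "a \<noteq> b" using inc opp a b by auto
  then obtain \<pi> where \<pi>: "inj \<pi>" "\<pi> m = a" "\<pi> n = b" using inj_3_extend[OF mn] by metis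
  obtain g where g: "g \<in> \<F>" "g ` model_flat = f ` model_flat" "\<And>\<sigma> m. vertex \<sigma> g m = vertex \<sigma> f (\<pi> m)"
    using vertex_remark[OF f(1) \<pi>(1)] by metis
  have p: "vertex 1 g m = p" "vertex 1 g n = p'" using g(3) \<pi> a b by simp_all
  note bd' = bd[folded g(2)]
  obtain c where c: "D = vertex (- 1) g c"
    using ideal_boundary_vertex[OF g(1) order_refl one(2) adjacent_vertices(2)[OF inc(1)] bd'(2)] by metis
  obtain d where d: "D' = vertex (- 1) g d"
    using ideal_boundary_vertex[OF g(1) order_refl one(2) adjacent_vertices(2)[OF inc(2)] bd'(4)] by metis
  have "c = n" using adjacent_vertex[OF g(1), of n c 1] opp(2) p c by auto
  moreover have "d = m" using adjacent_vertex[OF g(1), of m d 1] opp(1) p d by auto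
  ultimately show ?thesis using that[OF g(1)] g(2) f(2) p c d by simp
qed


section \<open>Projection of an ideal vertex to a flat\<close>

text \<open>The point \<open>f \<mu>\<close> is the centre of the frame formed by the three vertices of \<open>f\<close> and \<open>\<xi>\<close>.\<close>

definition frame_flats ::
    "real \<Rightarrow> (real^3 \<Rightarrow> 'a) \<Rightarrow> 'a ideal_point \<Rightarrow> real^3 \<Rightarrow> (3 \<Rightarrow> real^3 \<Rightarrow> 'a) \<Rightarrow> bool" where
  "frame_flats \<sigma> f \<xi> \<mu> h \<longleftrightarrow> \<bar>\<sigma>\<bar> = 1 \<and> f \<in> \<F> \<and> \<xi> \<in> vertices \<sigma> \<and> \<mu> \<in> model_flat \<and>
    (\<forall>m. \<xi> \<noteq> vertex \<sigma> f m) \<and>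
    (\<forall>m. h m \<in> \<F> \<and> f \<mu> \<in> h m ` model_flat \<and>
      (\<forall>l. vertex \<sigma> (h m) l = (if l = m then \<xi> else vertex \<sigma> f l)))"

lemma replaced_vertices_inj:
  assumes "\<bar>\<sigma>\<bar> = 1" "f \<in> \<F>" "\<And>m. \<xi> \<noteq> vertex \<sigma> f m"
  shows "inj (\<lambda>l. if l = m then \<xi> else vertex \<sigma> f l)"
proof (rule injI)
  fix x y assume "(if x = m then \<xi> else vertex \<sigma> f x) = (if y = m then \<xi> else vertex \<sigma> f y)"
  then show "x = y"
    using assms(3)[of x] assms(3)[of y, symmetric] vertex_inj[OF assms(2,1), of x y]
    by (cases "x = m"; cases "y = m") simp_all
qed

text \<open>The flats of the frame are given only through their boundaries.
  \<open>flat_unique\<close> identifies one of them with the flat of \<open>f\<close>, and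
  \<open>flat_marking_vertices\<close> marks the others so that \<open>h m\<close> has \<xi> in
  place of the \<open>m\<close>-th vertex.\<close>

lemma frame_flats_exist:
  assumes \<sigma>: "\<bar>\<sigma>\<bar> = 1" and f: "f \<in> \<F>" and \<xi>: "\<xi> \<in> vertices \<sigma>" "\<And>m. \<xi> \<noteq> vertex \<sigma> f m"
    and A0: "\<exists>A. A \<in> flats \<F> \<and> y \<in> A \<and> (\<forall>l. vertex \<sigma> f l \<in> ideal_boundary A)"
    and A: "\<And>m. \<exists>A. A \<in> flats \<F> \<and> y \<in> A \<and> \<xi> \<in> ideal_boundary A \<and>
      (\<forall>l. l \<noteq> m \<longrightarrow> vertex \<sigma> f l \<in> ideal_boundary A)"
  obtains \<mu> h where "y = f \<mu>" "frame_flats \<sigma> f \<xi> \<mu> h"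
proof -
  obtain B where B: "B \<in> flats \<F>" "y \<in> B" "\<And>l. vertex \<sigma> f l \<in> ideal_boundary B" using A0 by blast
  have inj: "inj (vertex \<sigma> f)" using vertex_inj[OF f \<sigma>] by (rule injI)
  obtain g where g: "g \<in> \<F>" "g ` model_flat = B" "\<And>m. vertex \<sigma> g m = vertex \<sigma> f m"
    by (rule flat_marking_vertices[OF B(1) \<sigma> inj vertex_in_vertices[OF f] B(3)]) blast
  have "y \<in> f ` model_flat" using flat_unique[OF f g(1) \<sigma> g(3)] g(2) B(2) by simp
  then obtain \<mu> where \<mu>: "\<mu> \<in> model_flat" "y = f \<mu>" by blast
  have "\<exists>k. k \<in> \<F> \<and> y \<in> k ` model_flat \<and> (\<forall>l. vertex \<sigma> k l = (if l = m then \<xi> else vertex \<sigma> f l))" for m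
  proof -
    obtain A where A: "A \<in> flats \<F>" "y \<in> A" "\<xi> \<in> ideal_boundary A"
      "\<And>l. l \<noteq> m \<Longrightarrow> vertex \<sigma> f l \<in> ideal_boundary A" using A[of m] by blast
    obtain k where "k \<in> \<F>" "k ` model_flat = A" "\<And>l. vertex \<sigma> k l = (if l = m then \<xi> else vertex \<sigma> f l)"
      by (rule flat_marking_vertices[OF A(1) \<sigma> replaced_vertices_inj[OF \<sigma> f \<xi>(2), of m]])
        (use A \<xi> vertex_in_vertices[OF f] in auto)
    then show ?thesis using A(2) by blast
  qed
  then have "\<forall>m. \<exists>k. k \<in> \<F> \<and> y \<in> k ` model_flat \<and>
      (\<forall>l. vertex \<sigma> k l = (if l = m then \<xi> else vertex \<sigma> f l))" ..
  from choice[OF this] obtain h where "\<forall>m. h m \<in> \<F> \<and> y \<in> h m ` model_flat \<and>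
      (\<forall>l. vertex \<sigma> (h m) l = (if l = m then \<xi> else vertex \<sigma> f l))" ..
  then show ?thesis using that[of \<mu> h] \<sigma> f \<xi> \<mu> by (simp add: frame_flats_def)
qed

context
  fixes \<sigma> f \<xi> \<mu> h
  assumes ff: "frame_flats \<sigma> f \<xi> \<mu> h"
begin

lemma frame_flatsD:
  "\<bar>\<sigma>\<bar> = 1" "f \<in> \<F>" "\<xi> \<in> vertices \<sigma>" "\<mu> \<in> model_flat" "h m \<in> \<F>" "f \<mu> \<in> h m ` model_flat"
  "vertex \<sigma> (h m) m = \<xi>" "l \<noteq> m \<Longrightarrow> vertex \<sigma> (h m) l = vertex \<sigma> f l" "\<xi> \<noteq> vertex \<sigma> f m"
  using ff unfolding frame_flats_def by simp_all

text \<open>Hence \<xi> is opposite to \<open>vertex (- \<sigma>) f m\<close> inside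
  \<open>h m\<close>, as needed for \<open>horo_opposite_base\<close>.\<close>

lemma frame_flats_opposite: "vertex (- \<sigma>) (h m) m = vertex (- \<sigma>) f m"
  by (rule opposite_vertex_eq[OF frame_flatsD(2) frame_flatsD(5) frame_flatsD(1) frame_flatsD(8)])

lemma frame_flats_unique:
  assumes G: "G \<in> flats \<F>" and bd: "\<xi> \<in> ideal_boundary G"
    "\<And>l. l \<noteq> m \<Longrightarrow> vertex \<sigma> f l \<in> ideal_boundary G"
  shows "G = h m ` model_flat"
proof -
  obtain k where k: "k \<in> \<F>" "k ` model_flat = G" "\<And>l. vertex \<sigma> k l = (if l = m then \<xi> else vertex \<sigma> f l)"
    by (rule flat_marking_vertices[OF G frame_flatsD(1)
          replaced_vertices_inj[OF frame_flatsD(1,2) frame_flatsD(9), of m]])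
      (use bd frame_flatsD(3) vertex_in_vertices[OF frame_flatsD(2)] in auto)
  have "vertex \<sigma> k l = vertex \<sigma> (h m) l" for l
    using k(3) frame_flatsD(7)[of m] frame_flatsD(8)[of l m] by (cases "l = m") simp_all
  with flat_unique[OF frame_flatsD(5) k(1) frame_flatsD(1)] k(2) show ?thesis by simp
qed

text \<open>In \<open>h m\<close> the other two horofunctions are those of \<open>f\<close>, and on
  either flat the three values sum to zero; so \<xi> takes the value of the vertex that it
  replaces.\<close>

lemma horo_in_frame_flat:
  assumes l: "l \<in> model_flat" and mem: "f l \<in> h m ` model_flat"
  shows "horo \<xi> (f l) (f \<mu>) = - \<sigma> * (l - \<mu>) $ m"
proof -
  note fD = frame_flatsD
  obtain n where n: "m \<noteq> n" using third_index[of m m] by metis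
  obtain k where k: "k \<noteq> m" "k \<noteq> n" by (rule third_index)
  obtain \<alpha> \<beta> where \<alpha>\<beta>: "\<alpha> \<in> model_flat" "\<beta> \<in> model_flat" "f l = h m \<alpha>" "f \<mu> = h m \<beta>"
    using mem fD(6)[of m] by blast
  have "horo (vertex \<sigma> (h m) i) (f l) (f \<mu>) = - \<sigma> * (\<alpha> - \<beta>) $ i" for i
    unfolding \<alpha>\<beta>(3,4) by (rule horo_flat[OF fD(5) \<alpha>\<beta>(1,2) fD(1)])
  from this[of m] this[of n] this[of k]
  have 1: "horo \<xi> (f l) (f \<mu>) = - \<sigma> * (\<alpha> - \<beta>) $ m"
    "- \<sigma> * (l - \<mu>) $ n = - \<sigma> * (\<alpha> - \<beta>) $ n" "- \<sigma> * (l - \<mu>) $ k = - \<sigma> * (\<alpha> - \<beta>) $ k"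
    using fD(7)[of m] fD(8)[of n m] fD(8)[of k m] n k horo_flat[OF fD(2) l fD(4,1)] by simp_all
  have 2: "(l - \<mu>) $ m = - (l - \<mu>) $ n - (l - \<mu>) $ k" "(\<alpha> - \<beta>) $ m = - (\<alpha> - \<beta>) $ n - (\<alpha> - \<beta>) $ k"
    using model_flat_sum[of "l - \<mu>", OF _ n k] model_flat_sum[of "\<alpha> - \<beta>", OF _ n k] l fD(4) \<alpha>\<beta>(1,2) by simp_all
  have "horo \<xi> (f l) (f \<mu>) = - (- \<sigma> * (\<alpha> - \<beta>) $ n) - (- \<sigma> * (\<alpha> - \<beta>) $ k)"
    unfolding 1(1) 2(2) by (simp only: right_diff_distrib minus_mult_right)
  also have "\<dots> = - \<sigma> * (l - \<mu>) $ m"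
    unfolding 1(2,3)[symmetric] 2(1) by (simp only: right_diff_distrib minus_mult_right)
  finally show ?thesis .
qed

lemma cone_in_frame_flat:
  assumes l: "l \<in> model_flat" and min: "\<And>i. \<sigma> * (l - \<mu>) $ m \<le> \<sigma> * (l - \<mu>) $ i"
  shows "f l \<in> h m ` model_flat"
proof -
  note fD = frame_flatsD
  obtain n where n: "n \<noteq> m" using third_index[of m m] by metis
  obtain k where k: "k \<noteq> m" "k \<noteq> n" by (rule third_index)
  obtain s t where st: "0 \<le> s" "0 \<le> t" "l = \<mu> + s *\<^sub>R (\<sigma> *\<^sub>R vtx n) + t *\<^sub>R (\<sigma> *\<^sub>R vtx k)"
    using cone_decompose[OF l fD(4), of n k m \<sigma>] n k fD(1) min by metis
  show ?thesis unfolding st(3)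
    by (rule vertex_cone_in_flat[OF fD(2,4) fD(5)[of m] fD(6)[of m] fD(1), of n n k k]) (use fD(8) n k st in auto)
qed

text \<open>Let \<open>k\<close> be an index of the minimal coordinate. Then \<open>f l\<close> lies
  in the flat of \<open>h k\<close> too, and the two evaluations of the horofunction of \<xi>, in
  \<open>h m\<close> and in \<open>h k\<close>, force the \<open>m\<close>-th coordinate to be
  minimal as well.\<close>

lemma mem_frame_flat_iff:
  assumes l: "l \<in> model_flat"
  shows "f l \<in> h m ` model_flat \<longleftrightarrow> (\<forall>i. \<sigma> * (l - \<mu>) $ m \<le> \<sigma> * (l - \<mu>) $ i)"
proof
  assume mem: "f l \<in> h m ` model_flat"
  obtain k where k: "\<And>i. \<sigma> * (l - \<mu>) $ k \<le> \<sigma> * (l - \<mu>) $ i"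
    by (rule min_index_3[of "\<lambda>i. \<sigma> * (l - \<mu>) $ i"]) blast
  have "- \<sigma> * (l - \<mu>) $ m = - \<sigma> * (l - \<mu>) $ k"
    by (rule trans[OF horo_in_frame_flat[OF l mem, symmetric]
          horo_in_frame_flat[OF l cone_in_frame_flat[OF l k]]])
  then have "\<sigma> * (l - \<mu>) $ m = \<sigma> * (l - \<mu>) $ k" by (simp only: mult_minus_left neg_equal_iff_equal)
  then show "\<forall>i. \<sigma> * (l - \<mu>) $ m \<le> \<sigma> * (l - \<mu>) $ i"
    using k by (simp only: simp_thms)
qed (use cone_in_frame_flat[OF l] in blast)

text \<open>With \<open>k\<close> a minimal index, the horofunction of \<xi> is read off in
  \<open>h k\<close> and that of the opposite vertex in \<open>f\<close>; the sum is the excess of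
  the \<open>m\<close>-th signed coordinate over the minimum.\<close>

lemma horo_opposite_zero_iff:
  assumes l: "l \<in> model_flat"
  shows "horo \<xi> (f l) (f \<mu>) + horo (vertex (- \<sigma>) f m) (f l) (f \<mu>) = 0
    \<longleftrightarrow> (\<forall>i. \<sigma> * (l - \<mu>) $ m \<le> \<sigma> * (l - \<mu>) $ i)"
proof -
  note fD = frame_flatsD
  obtain k where k: "\<And>i. \<sigma> * (l - \<mu>) $ k \<le> \<sigma> * (l - \<mu>) $ i"
    by (rule min_index_3[of "\<lambda>i. \<sigma> * (l - \<mu>) $ i"]) blast
  have "\<bar>- \<sigma>\<bar> = 1" using fD(1) by simp
  then have "horo \<xi> (f l) (f \<mu>) + horo (vertex (- \<sigma>) f m) (f l) (f \<mu>)
      = \<sigma> * (l - \<mu>) $ m - \<sigma> * (l - \<mu>) $ k"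
    using horo_in_frame_flat[OF l cone_in_frame_flat[OF l k]] horo_flat[OF fD(2) l fD(4)] by simp
  moreover have "\<sigma> * (l - \<mu>) $ m - \<sigma> * (l - \<mu>) $ k = 0 \<longleftrightarrow> (\<forall>i. \<sigma> * (l - \<mu>) $ m \<le> \<sigma> * (l - \<mu>) $ i)"
    using k by (metis antisym eq_iff_diff_eq_0)
  ultimately show ?thesis by simp
qed

end

text \<open>The pair \<open>p\<close>, \<open>vertex (- 1) f n\<close> is opposite both in
  \<open>g\<close> and in \<open>h n\<close>, and the pair \<open>D\<close>,
  \<open>vertex 1 f m\<close> both in \<open>g\<close> and in \<open>h' m\<close>. So the base
  points in the criterion for \<open>g\<close> can be moved to the two frame centers, where
  \<open>horo_opposite_zero_iff\<close> applies.\<close>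

lemma mem_opposite_flat_iff:
  assumes ff: "frame_flats 1 f p \<mu> h" and ff': "frame_flats (- 1) f D \<mu>' h'" and mn: "m \<noteq> n"
    and g: "g \<in> \<F>" "vertex 1 g m = vertex 1 f m" "vertex (- 1) g n = vertex (- 1) f n"
      "vertex 1 g n = p" "vertex (- 1) g m = D"
    and l: "l \<in> model_flat"
  shows "f l \<in> g ` model_flat \<longleftrightarrow>
    (\<forall>i. (l - \<mu>) $ n \<le> (l - \<mu>) $ i) \<and> (\<forall>i. (l - \<mu>') $ i \<le> (l - \<mu>') $ m)"
proof -
  have one: "\<bar>1::real\<bar> = 1" "\<bar>- 1::real\<bar> = 1" by simp_all
  note D = frame_flatsD[OF ff] and D' = frame_flatsD[OF ff']
  have fl: "f l \<in> f ` model_flat" using l by simp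
  have g0: "g 0 \<in> g ` model_flat" by simp
  have "f l \<in> g ` model_flat \<longleftrightarrow>
      horo (vertex 1 g m) (f l) (g 0) + horo (vertex (- 1) g m) (f l) (g 0) = 0 \<and>
      horo (vertex 1 g n) (f l) (g 0) + horo (vertex (- 1) g n) (f l) (g 0) = 0"
    by (rule mem_flat_iff_horo[OF g(1) g0 D(2) fl one(1) mn])
  also have "horo (vertex 1 g n) (f l) (g 0) + horo (vertex (- 1) g n) (f l) (g 0)
      = horo (vertex 1 g n) (f l) (f \<mu>) + horo (vertex (- 1) g n) (f l) (f \<mu>)"
    using frame_flats_opposite[OF ff, of n] D(7)[of n] g
    by (intro horo_opposite_base[OF g(1) g0 D(5)[of n] D(6)[of n] one(1), of n n]) simp_all
  also have "horo (vertex 1 g m) (f l) (g 0) + horo (vertex (- 1) g m) (f l) (g 0)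
      = horo (vertex 1 g m) (f l) (f \<mu>') + horo (vertex (- 1) g m) (f l) (f \<mu>')"
    using frame_flats_opposite[OF ff', of m] D'(7)[of m] g
    by (intro horo_opposite_base[OF g(1) g0 D'(5)[of m] D'(6)[of m] one(1), of m m]) simp_all
  also have "horo (vertex 1 g n) (f l) (f \<mu>) + horo (vertex (- 1) g n) (f l) (f \<mu>) = 0
      \<longleftrightarrow> (\<forall>i. (l - \<mu>) $ n \<le> (l - \<mu>) $ i)"
    using horo_opposite_zero_iff[OF ff l, of n] by (simp only: g mult_1)
  also have "horo (vertex 1 g m) (f l) (f \<mu>') + horo (vertex (- 1) g m) (f l) (f \<mu>') = 0
      \<longleftrightarrow> (\<forall>i. (l - \<mu>') $ i \<le> (l - \<mu>') $ m)"
    using horo_opposite_zero_iff[OF ff' l, of m]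
    by (simp only: g minus_minus mult_minus1 neg_le_iff_le add.commute)
  finally show ?thesis by blast
qed

end


section \<open>Frame centers and the intersections of the flats\<close>

lemma frame_center_iff:
  "frame_center \<F> a b c d y \<longleftrightarrow>
    (\<exists>A. flat_through \<F> {a, b, c} A \<and> y \<in> A) \<and> (\<exists>A. flat_through \<F> {a, b, d} A \<and> y \<in> A) \<and>
    (\<exists>A. flat_through \<F> {a, c, d} A \<and> y \<in> A) \<and> (\<exists>A. flat_through \<F> {b, c, d} A \<and> y \<in> A)"
  by (simp add: frame_center_def)

lemma frame_center_rotate: "frame_center \<F> a b c d y \<Longrightarrow> frame_center \<F> b c a d y"
  unfolding frame_center_iff by (simp add: insert_commute)

lemma frame_center_swap: "frame_center \<F> a b c d y \<Longrightarrow> frame_center \<F> b a c d y"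
  unfolding frame_center_iff by (simp add: insert_commute)

lemma flat_through_iff:
  "flat_through \<F> S A \<longleftrightarrow> A \<in> flats \<F> \<and> (\<forall>\<xi>\<in>S. \<xi> \<in> ideal_boundary A)"
  by (auto simp: flat_through_def)

context A2_flats
begin

lemma \<phi>_marking:
  assumes "f \<in> \<F>" "l \<in> model_flat"
  shows "\<phi> f m (f l) = root_form m l"
proof -
  have "inj_on f model_flat" using flat_inj[OF assms(1)] by (intro inj_onI) blast
  with assms show ?thesis by (simp add: \<phi>_def)
qed

text \<open>The order of the arguments is that of the frame \<open>p i\<close>, \<open>p j\<close>,
  \<open>p k\<close>, \<open>pij\<close>, whose members will be the vertices 3 and 1 of
  \<open>f\<close>, then \<xi>, then the vertex 2.\<close>

lemma frame_flats_of_center: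
  assumes \<sigma>: "\<bar>\<sigma>\<bar> = 1" and f: "f \<in> \<F>" and \<xi>: "\<xi> \<in> vertices \<sigma>" "\<And>m. \<xi> \<noteq> vertex \<sigma> f m"
    and c: "frame_center \<F> (vertex \<sigma> f 3) (vertex \<sigma> f 1) \<xi> (vertex \<sigma> f 2) y"
  obtains \<mu> h where "y = f \<mu>" "frame_flats \<sigma> f \<xi> \<mu> h"
proof (rule frame_flats_exist[OF \<sigma> f \<xi>])
  show "\<exists>A. A \<in> flats \<F> \<and> y \<in> A \<and> (\<forall>l. vertex \<sigma> f l \<in> ideal_boundary A)"
    using c unfolding frame_center_iff flat_through_iff forall_3 by blast
  show "\<exists>A. A \<in> flats \<F> \<and> y \<in> A \<and> \<xi> \<in> ideal_boundary A \<and>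
      (\<forall>l. l \<noteq> m \<longrightarrow> vertex \<sigma> f l \<in> ideal_boundary A)" for m
  proof -
    consider "m = 1" | "m = 2" | "m = 3" using exhaust_3 by blast
    then show ?thesis
    proof cases
      case 1
      then show ?thesis using c unfolding frame_center_iff flat_through_iff forall_3 by auto
    next
      case 2
      then show ?thesis using c unfolding frame_center_iff flat_through_iff forall_3 by auto
    next
      case 3
      then show ?thesis using c unfolding frame_center_iff flat_through_iff forall_3 by auto
    qed
  qed
qed (use that in blast)

lemma flag_triple_intersections:
  fixes p D :: "3 \<Rightarrow> 'a ideal_point"
  assumes generic: "generic_triple \<F> p D" and ijk: "i \<noteq> j" "j \<noteq> k" "i \<noteq> k"
    and Aij: "flat_through \<F> {p i, D i, p j, D j} Aij"
    and Ajk: "flat_through \<F> {p j, D j, p k, D k} Ajk"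
    and Aki: "flat_through \<F> {p k, D k, p i, D i} Aki"
    and Ap: "flat_through \<F> {p i, p j, p k} Ap"
    and AD: "flat_through \<F> {D i, D j, D k} AD"
    and pij: "incident \<F> pij (D i)" "incident \<F> pij (D j)"
    and Dij: "incident \<F> (p i) Dij" "incident \<F> (p j) Dij"
    and yk: "frame_center \<F> (p i) (p j) (p k) pij yk"
    and yk': "frame_center \<F> (D i) (D j) (D k) Dij yk'"
    and f: "sends_chamber_to \<F> f (p j, D j)" "f ` model_flat = Aij"
  shows
    "Aij \<inter> Ap = sector \<F> Aij yk (p i) (p j) \<and>
     (\<forall>x\<in>Aij. x \<in> Ap \<longleftrightarrow> \<phi> f 1 x \<ge> \<phi> f 1 yk \<and> \<phi> f 2 x \<le> \<phi> f 2 yk) \<and>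
     Aij \<inter> AD = sector \<F> Aij yk' (D i) (D j) \<and>
     (\<forall>x\<in>Aij. x \<in> AD \<longleftrightarrow> \<phi> f 1 x \<le> \<phi> f 1 yk' \<and> \<phi> f 2 x \<ge> \<phi> f 2 yk') \<and>
     Aij \<inter> Ajk = sector \<F> Aij yk (p j) pij \<inter> sector \<F> Aij yk' (D j) Dij \<and>
     (\<forall>x\<in>Aij. x \<in> Ajk \<longleftrightarrow> \<phi> f 1 x \<ge> \<phi> f 1 yk' \<and> \<phi> f 2 x \<ge> \<phi> f 2 yk \<and>
        \<phi> f 3 x \<le> min (\<phi> f 3 yk) (\<phi> f 3 yk')) \<and>
     Aij \<inter> Aki = sector \<F> Aij yk (p i) pij \<inter> sector \<F> Aij yk' (D i) Dij \<and>
     (\<forall>x\<in>Aij. x \<in> Aki \<longleftrightarrow> \<phi> f 1 x \<le> \<phi> f 1 yk \<and> \<phi> f 2 x \<le> \<phi> f 2 yk' \<and>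
        \<phi> f 3 x \<ge> max (\<phi> f 3 yk) (\<phi> f 3 yk'))"
proof -
  have one: "\<bar>1::real\<bar> = 1" "\<bar>- 1::real\<bar> = 1" by simp_all
  have n3: "(1::3) \<noteq> 2" "(1::3) \<noteq> 3" "(2::3) \<noteq> 3" "(2::3) \<noteq> 1" "(3::3) \<noteq> 1" "(3::3) \<noteq> 2" by simp_all
  have inc: "adjacent 1 (p a) (D a)" for a
    using generic by (simp add: generic_triple_def incident_iff_adjacent)
  have opp: "\<not> adjacent 1 (p a) (D b)" if "a \<noteq> b" for a b
    using generic that by (auto simp: generic_triple_def opposite_flags_def incident_iff_adjacent)
  note pij = pij[unfolded incident_iff_adjacent] and Dij = Dij[unfolded incident_iff_adjacent]
  note vp = adjacent_vertices(1)[OF inc] and vD = adjacent_vertices(2)[OF inc]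
  have F: "f \<in> \<F>" and pj: "p j = vertex 1 f 1" and Dj: "D j = vertex (- 1) f 3"
    using f(1) by (simp_all add: sends_chamber_to_iff)
  note bd = Aij[unfolded flat_through_iff f(2)[symmetric]]
  obtain a where a: "p i = vertex 1 f a"
    using ideal_boundary_vertex[OF F order_refl one(1) vp] bd by (metis insertI1)
  \<comment> \<open>Any other index would make \<open>p i\<close> incident to \<open>D j\<close>,
    which has index 3.\<close>
  have "a = 3" using adjacent_vertex[OF F, of a 3 1] opp[OF ijk(1)] a Dj by auto
  then have pi: "p i = vertex 1 f 3" using a by simp
  obtain b where b: "D i = vertex (- 1) f b"
    using ideal_boundary_vertex[OF F order_refl one(2) vD] bd by (metis insertI1 insertI2)
  have "b = 1" using adjacent_vertex[OF F, of 1 b 1] opp[OF ijk(1)[symmetric]] b pj by auto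
  then have Di: "D i = vertex (- 1) f 1" using b by simp
  have P: "pij = vertex 1 f 2"
    using adjacent_two_unique[OF F one(1) n3(4,3,2)] pij Di Dj by simp
  have L: "Dij = vertex (- 1) f 2"
    using adjacent_two_unique[OF F one(2) n3(4,3,2)] adjacent_commute[OF Dij(1)] adjacent_commute[OF Dij(2)] pi pj
    by simp
  \<comment> \<open>Each of the points \<open>p i\<close>, \<open>p j\<close>, \<open>pij\<close>
    lies on \<open>D i\<close> or on \<open>D j\<close>, but \<open>p k\<close> lies on
    neither.\<close>
  have pk_new: "p k \<noteq> vertex 1 f m" for m
  proof -
    have "p k \<noteq> p j" "p k \<noteq> p i" "p k \<noteq> pij"
      using inc[of j] opp[of k j] inc[of i] opp[of k i] pij ijk by auto
    then show ?thesis using exhaust_3[of m] pj pi P by auto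
  qed
  have Dk_new: "D k \<noteq> vertex (- 1) f m" for m
  proof -
    have "D k \<noteq> D j" "D k \<noteq> D i" "D k \<noteq> Dij"
      using inc[of j] opp[of j k] inc[of i] opp[of i k] Dij ijk by auto
    then show ?thesis using exhaust_3[of m] Dj Di L by auto
  qed
  obtain \<mu> h where \<mu>: "yk = f \<mu>" and ff: "frame_flats 1 f (p k) \<mu> h"
    by (rule frame_flats_of_center[OF one(1) F vp pk_new]) (use yk pi pj P in auto)
  \<comment> \<open>The lines \<open>D i\<close> and \<open>D j\<close> carry the indices 1 and 3,
    whereas \<open>p i\<close> and \<open>p j\<close> carry 3 and 1; hence the swap.\<close>
  obtain \<nu> h' where \<nu>: "yk' = f \<nu>" and ff': "frame_flats (- 1) f (D k) \<nu> h'"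
    by (rule frame_flats_of_center[OF one(2) F vD Dk_new]) (use frame_center_swap[OF yk'] Di Dj L in auto)
  have M: "\<mu> \<in> model_flat" "\<nu> \<in> model_flat" using frame_flatsD(4)[OF ff] frame_flatsD(4)[OF ff'] .
  have Ap_eq: "Ap = h 2 ` model_flat"
  proof (rule frame_flats_unique[OF ff])
    show "vertex 1 f l \<in> ideal_boundary Ap" if "l \<noteq> 2" for l
      using Ap that exhaust_3[of l] pi pj by (auto simp: flat_through_iff)
  qed (use Ap in \<open>auto simp: flat_through_iff\<close>)
  have AD_eq: "AD = h' 2 ` model_flat"
  proof (rule frame_flats_unique[OF ff'])
    show "vertex (- 1) f l \<in> ideal_boundary AD" if "l \<noteq> 2" for l
      using AD that exhaust_3[of l] Di Dj by (auto simp: flat_through_iff)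
  qed (use AD in \<open>auto simp: flat_through_iff\<close>)
  \<comment> \<open>\<open>p j\<close> and \<open>D j\<close> keep their indices 1 and 3, so
    \<open>p k\<close> gets the index 3 and \<open>D k\<close> the index 1. For \<open>Aki\<close>
    the indices 1 and 3 are exchanged.\<close>
  obtain g where g: "g \<in> \<F>" "g ` model_flat = Ajk" "vertex 1 g 1 = p j" "vertex (- 1) g 3 = D j"
    "vertex 1 g 3 = p k" "vertex (- 1) g 1 = D k"
    by (rule opposite_flags_marking[OF _ _ _ _ _ inc[of j] inc[of k] opp[OF ijk(2)] opp[OF ijk(2)[symmetric]] n3(2)])
      (use Ajk in \<open>auto simp: flat_through_iff\<close>)
  obtain g' where g': "g' \<in> \<F>" "g' ` model_flat = Aki" "vertex 1 g' 3 = p i" "vertex (- 1) g' 1 = D i"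
    "vertex 1 g' 1 = p k" "vertex (- 1) g' 3 = D k"
    by (rule opposite_flags_marking[OF _ _ _ _ _ inc[of i] inc[of k] opp[OF ijk(3)] opp[OF ijk(3)[symmetric]] n3(5)])
      (use Aki in \<open>auto simp: flat_through_iff\<close>)
  have iff_p: "f l \<in> Ap \<longleftrightarrow> (\<forall>i. (l - \<mu>) $ 2 \<le> (l - \<mu>) $ i)" if "l \<in> model_flat" for l
    unfolding Ap_eq using mem_frame_flat_iff[OF ff that, of 2] by simp
  have iff_D: "f l \<in> AD \<longleftrightarrow> (\<forall>i. (l - \<nu>) $ i \<le> (l - \<nu>) $ 2)" if "l \<in> model_flat" for l
    unfolding AD_eq mem_frame_flat_iff[OF ff' that, of 2] by (simp only: mult_minus1 neg_le_iff_le)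
  have iff_jk: "f l \<in> Ajk \<longleftrightarrow> (\<forall>i. (l - \<mu>) $ 3 \<le> (l - \<mu>) $ i) \<and> (\<forall>i. (l - \<nu>) $ i \<le> (l - \<nu>) $ 1)"
    if "l \<in> model_flat" for l
    unfolding g(2)[symmetric] using g pj Dj by (intro mem_opposite_flat_iff[OF ff ff' n3(2)] that) simp_all
  have iff_ki: "f l \<in> Aki \<longleftrightarrow> (\<forall>i. (l - \<mu>) $ 1 \<le> (l - \<mu>) $ i) \<and> (\<forall>i. (l - \<nu>) $ i \<le> (l - \<nu>) $ 3)"
    if "l \<in> model_flat" for l
    unfolding g'(2)[symmetric] using g' pi Di by (intro mem_opposite_flat_iff[OF ff ff' n3(5)] that) simp_all
  have sector_p: "sector \<F> Aij yk (vertex 1 f m) (vertex 1 f n)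
      = f ` {l \<in> model_flat. \<forall>i. (l - \<mu>) $ c \<le> (l - \<mu>) $ i}"
    if "m \<noteq> n" "c \<noteq> m" "c \<noteq> n" for m n c
    using sector_eq[OF F M(1) one(1) that] unfolding f(2) \<mu> by simp
  have sector_D: "sector \<F> Aij yk' (vertex (- 1) f m) (vertex (- 1) f n)
      = f ` {l \<in> model_flat. \<forall>i. (l - \<nu>) $ i \<le> (l - \<nu>) $ c}"
    if "m \<noteq> n" "c \<noteq> m" "c \<noteq> n" for m n c
    using sector_eq[OF F M(2) one(2) that] unfolding f(2) \<nu> by (simp only: mult_minus1 neg_le_iff_le)
  have \<phi>: "\<phi> f m (f l) = root_form m l" if "l \<in> model_flat" for l m by (rule \<phi>_marking[OF F that])
  have Aij_Int: "Aij \<inter> G = f ` {l \<in> model_flat. Q l}" if "\<And>l. l \<in> model_flat \<Longrightarrow> f l \<in> G \<longleftrightarrow> Q l" for G Q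
    using that unfolding f(2)[symmetric] by blast
  have image_Int: "f ` {l \<in> model_flat. Q l} \<inter> f ` {l \<in> model_flat. R l}
      = f ` {l \<in> model_flat. Q l \<and> R l}" for Q R
    using flat_inj[OF F] by blast
  have ball: "(\<forall>x\<in>Aij. Q x) \<longleftrightarrow> (\<forall>l\<in>model_flat. Q (f l))" for Q unfolding f(2)[symmetric] by simp
  have "Aij \<inter> Ap = sector \<F> Aij yk (p i) (p j)"
    unfolding pi pj sector_p[OF n3(5,3,4)] by (rule Aij_Int[OF iff_p])
  moreover have "Aij \<inter> AD = sector \<F> Aij yk' (D i) (D j)"
    unfolding Di Dj sector_D[OF n3(2,4,3)] by (rule Aij_Int[OF iff_D])
  moreover have "Aij \<inter> Ajk = sector \<F> Aij yk (p j) pij \<inter> sector \<F> Aij yk' (D j) Dij"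
    unfolding pj P Dj L sector_p[OF n3(1,5,6)] sector_D[OF n3(6,2,1)] image_Int by (rule Aij_Int[OF iff_jk])
  moreover have "Aij \<inter> Aki = sector \<F> Aij yk (p i) pij \<inter> sector \<F> Aij yk' (D i) Dij"
    unfolding pi P Di L sector_p[OF n3(6,2,1)] sector_D[OF n3(1,5,6)] image_Int by (rule Aij_Int[OF iff_ki])
  \<comment> \<open>Comparing the extremal coordinate with each of the other two gives the root
    conditions: \<open>(l - \<mu>) $ 2 \<le> (l - \<mu>) $ 1\<close> is
    \<open>root_form 1 \<mu> \<le> root_form 1 l\<close>. For \<open>Ajk\<close> and
    \<open>Aki\<close> the third root occurs once for each center, whence \<open>min\<close> and
    \<open>max\<close>.\<close>
  moreover have "\<forall>x\<in>Aij. x \<in> Ap \<longleftrightarrow> \<phi> f 1 x \<ge> \<phi> f 1 yk \<and> \<phi> f 2 x \<le> \<phi> f 2 yk"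
    unfolding ball by (auto simp: iff_p \<phi> M \<mu> root_form_simps forall_3)
  moreover have "\<forall>x\<in>Aij. x \<in> AD \<longleftrightarrow> \<phi> f 1 x \<le> \<phi> f 1 yk' \<and> \<phi> f 2 x \<ge> \<phi> f 2 yk'"
    unfolding ball by (auto simp: iff_D \<phi> M \<nu> root_form_simps forall_3)
  moreover have "\<forall>x\<in>Aij. x \<in> Ajk \<longleftrightarrow> \<phi> f 1 x \<ge> \<phi> f 1 yk' \<and> \<phi> f 2 x \<ge> \<phi> f 2 yk \<and>
      \<phi> f 3 x \<le> min (\<phi> f 3 yk) (\<phi> f 3 yk')"
    unfolding ball by (auto simp: iff_jk \<phi> M \<mu> \<nu> root_form_simps forall_3)
  moreover have "\<forall>x\<in>Aij. x \<in> Aki \<longleftrightarrow> \<phi> f 1 x \<le> \<phi> f 1 yk \<and> \<phi> f 2 x \<le> \<phi> f 2 yk' \<and>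
      \<phi> f 3 x \<ge> max (\<phi> f 3 yk) (\<phi> f 3 yk')"
    unfolding ball by (auto simp: iff_ki \<phi> M \<mu> \<nu> root_form_simps forall_3)
  ultimately show ?thesis by blast
qed

end

theorem proposition4p2:
  fixes \<F> :: "(real^3 \<Rightarrow> 'a::metric_space) set"
    and p D :: "3 \<Rightarrow> 'a ideal_point"
    and i j k :: 3
    and Aij Ajk Aki Ap AD :: "'a set"
    and pij Dij :: "'a ideal_point"
    and yk yk' :: 'a
    and f :: "real^3 \<Rightarrow> 'a"
  assumes building: "euclidean_building_A2 \<F>"
    and generic: "generic_triple \<F> p D"
    and cyclic: "(i, j, k) \<in> {(1, 2, 3), (2, 3, 1), (3, 1, 2)}"
    and Aij: "flat_through \<F> {p i, D i, p j, D j} Aij"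
    and Ajk: "flat_through \<F> {p j, D j, p k, D k} Ajk"
    and Aki: "flat_through \<F> {p k, D k, p i, D i} Aki"
    and Ap: "flat_through \<F> {p 1, p 2, p 3} Ap"
    and AD: "flat_through \<F> {D 1, D 2, D 3} AD"
    and pij: "incident \<F> pij (D i)" "incident \<F> pij (D j)"
    and Dij: "incident \<F> (p i) Dij" "incident \<F> (p j) Dij"
    and yk: "frame_center \<F> (p 1) (p 2) (p 3) pij yk"
    and yk': "frame_center \<F> (D 1) (D 2) (D 3) Dij yk'"
    and f: "sends_chamber_to \<F> f (p j, D j)" "f ` model_flat = Aij"
  shows
    "Aij \<inter> Ap = sector \<F> Aij yk (p i) (p j) \<and>
     (\<forall>x\<in>Aij. x \<in> Ap \<longleftrightarrow> \<phi> f 1 x \<ge> \<phi> f 1 yk \<and> \<phi> f 2 x \<le> \<phi> f 2 yk) \<and>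

     Aij \<inter> AD = sector \<F> Aij yk' (D i) (D j) \<and>
     (\<forall>x\<in>Aij. x \<in> AD \<longleftrightarrow> \<phi> f 1 x \<le> \<phi> f 1 yk' \<and> \<phi> f 2 x \<ge> \<phi> f 2 yk') \<and>

     Aij \<inter> Ajk = sector \<F> Aij yk (p j) pij \<inter> sector \<F> Aij yk' (D j) Dij \<and>
     (\<forall>x\<in>Aij. x \<in> Ajk \<longleftrightarrow> \<phi> f 1 x \<ge> \<phi> f 1 yk' \<and> \<phi> f 2 x \<ge> \<phi> f 2 yk \<and>
        \<phi> f 3 x \<le> min (\<phi> f 3 yk) (\<phi> f 3 yk')) \<and>

     Aij \<inter> Aki = sector \<F> Aij yk (p i) pij \<inter> sector \<F> Aij yk' (D i) Dij \<and>
     (\<forall>x\<in>Aij. x \<in> Aki \<longleftrightarrow> \<phi> f 1 x \<le> \<phi> f 1 yk \<and> \<phi> f 2 x \<le> \<phi> f 2 yk' \<and>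
        \<phi> f 3 x \<ge> max (\<phi> f 3 yk) (\<phi> f 3 yk'))"
proof -
  interpret A2_flats \<F>
    using building by (unfold_locales) (simp_all add: euclidean_building_A2_def)
  have ijk: "i \<noteq> j" "j \<noteq> k" "i \<noteq> k" using cyclic by auto
  have Ap': "flat_through \<F> {p i, p j, p k} Ap" and AD': "flat_through \<F> {D i, D j, D k} AD"
    using Ap AD cyclic by (auto simp: insert_commute)
  \<comment> \<open>Rotating the first three entries of the frames brings the order 1, 2, 3 to
    \<open>i\<close>, \<open>j\<close>, \<open>k\<close>.\<close>
  have yk_ijk: "frame_center \<F> (p i) (p j) (p k) pij yk" and yk'_ijk: "frame_center \<F> (D i) (D j) (D k) Dij yk'"
    using cyclic yk yk' frame_center_rotate[OF yk] frame_center_rotate[OF frame_center_rotate[OF yk]]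
      frame_center_rotate[OF yk'] frame_center_rotate[OF frame_center_rotate[OF yk']] by auto
  show ?thesis
    by (rule flag_triple_intersections[OF generic ijk Aij Ajk Aki Ap' AD' pij Dij yk_ijk yk'_ijk f])
qed

end
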